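(* Suppose Assumptions 1, 2 and 3 hold. Then \[ \frac{1}{\sqrt{dr}}\big\|U^{(\lambda)}_{\mathsf{deb}}U^{(\lambda)\top}_{\mathsf{deb}}-U^{(0)}U^{(0)\top}\big\|_F=O\Big(\sigma r\sqrt{\tfrac{d}{n}}\Big) \] with probability at least $1-O\big(\exp(-c\,dr)+\exp(-cn)+\exp(-cd)\big)$.
   Context: Setting. Let $d,n,r$ be positive integers and $\sigma>0$. $\mathsf{GOE}(d)$ denotes the law of a symmetric $d\times d$ matrix whose diagonal entries are i.i.d. $N(0,1)$ and whose entries above the diagonal are i.i.d. $N(0,1/2)$, independent of the diagonal. One observes $(y_i,X_i)$, $i=1,\dots,n$, with $y_i=n^{-1/2}\langle X_i,M\rangle+\varepsilon_i$, where $\langle\cdot,\cdot\rangle$ is the Frobenius inner product, $X_i\sim\mathsf{GOE}(d)$, $\varepsilon_i\sim N(0,\sigma^2)$, all mutually independent, and $M$ is a symmetric positive semidefinite matrix of rank $r$. For $U\in\mathbb{R}^{d\times r}$ let $f^{(\lambda)}(U)=\frac14\sum_{i=1}^n(y_i-n^{-1/2}\langle X_i,UU^\top\rangle)^2+\frac{\lambda}{2}\|U\|_F^2$; $U^{(\lambda)}$ denotes any point satisfying the first- and second-order necessary conditions for a local minimum of $f^{(\lambda)}$ (with $\lambda=0$ giving $U^{(0)}$). Debiased factor: $U^{(\lambda)}_{\mathsf{deb}}=U^{(\lambda)}\big(I+\lambda(U^{(\lambda)\top}U^{(\lambda)})^{-1}\big)^{1/2}$. Assumption 1: $M=\sqrt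 d\,V\Lambda V^\top$ with $V\in\mathbb{R}^{d\times r}$ having orthonormal columns and $\Lambda$ an $r\times r$ positive diagonal matrix whose smallest entry $\lambda_r$ satisfies $C_1\sqrt r<\lambda_r/\sigma<C_2\sqrt r$ for sufficiently large constants $C_1,C_2$; moreover $\|M\|/(\lambda_r\sqrt d)\le\kappa$ with $\kappa=O(1)$, and $\sigma\ge\sigma_{\min}>c>0$. Assumption 2: $\gamma_n:=n/(dr)$ satisfies $\gamma_n\ge C_3 r$ for a sufficiently large constant $C_3$. Assumption 3: $C_4\sqrt d\le\lambda/\sigma\le C_5\sqrt d$ for constants $C_4,C_5$. *)

theory Defs
  imports "HOL-Probability.Probability" "Jordan_Normal_Form.Matrix"
    "Jordan_Normal_Form.Gauss_Jordan_Elimination"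
begin

definition frob_inner :: "real mat \<Rightarrow> real mat \<Rightarrow> real" where
  "frob_inner A B = (\<Sum>a<dim_row A. \<Sum>b<dim_col A. A $$ (a,b) * B $$ (a,b))"

definition frob_norm :: "real mat \<Rightarrow> real" where
  "frob_norm A = sqrt (frob_inner A A)"

definition op_norm :: "real mat \<Rightarrow> real" where
  "op_norm A = Sup {sqrt (\<Sum>a<dim_row A. ((A *\<^sub>v x) $ a)^2) | x.
       x \<in> carrier_vec (dim_col A) \<and> (\<Sum>b<dim_col A. (x $ b)^2) = 1}"

definition psd_mat :: "real mat \<Rightarrow> bool" where
  "psd_mat A \<longleftrightarrow> A \<in> carrier_mat (dim_row A) (dim_row A) \<and> A\<^sup>T = A \<and>
     (\<forall>x \<in> carrier_vec (dim_row A). 0 \<le> x \<bullet> (A *\<^sub>v x))"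

definition psd_sqrt :: "real mat \<Rightarrow> real mat" where
  "psd_sqrt A = (SOME B. psd_mat B \<and> dim_row B = dim_row A \<and> B * B = A)"

definition mat_inv :: "real mat \<Rightarrow> real mat" where
  "mat_inv A = the (mat_inverse A)"

(* GOE(d) sample space: for each i<n and a\<le>b<d one independent Gaussian coordinate,
   diagonal variance 1, off-diagonal variance 1/2 *)
definition goe_index :: "nat \<Rightarrow> nat \<Rightarrow> (nat \<times> nat \<times> nat) set" where
  "goe_index n d = {(i,a,b). i < n \<and> a \<le> b \<and> b < d}"

definition design_measure :: "nat \<Rightarrow> nat \<Rightarrow> (nat \<times> nat \<times> nat \<Rightarrow> real) measure" where
  "design_measure n d = PiM (goe_index n d)
     (\<lambda>(i,a,b). density lborel (normal_density 0 (if a = b then 1 else sqrt (1/2))))"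

definition noise_measure :: "nat \<Rightarrow> real \<Rightarrow> (nat \<Rightarrow> real) measure" where
  "noise_measure n \<sigma> = PiM {..<n} (\<lambda>_. density lborel (normal_density 0 \<sigma>))"

definition sample_measure :: "nat \<Rightarrow> nat \<Rightarrow> real \<Rightarrow>
    ((nat \<times> nat \<times> nat \<Rightarrow> real) \<times> (nat \<Rightarrow> real)) measure" where
  "sample_measure n d \<sigma> = design_measure n d \<Otimes>\<^sub>M noise_measure n \<sigma>"

definition design_mat :: "nat \<Rightarrow> (nat \<times> nat \<times> nat \<Rightarrow> real) \<Rightarrow> nat \<Rightarrow> real mat" where
  "design_mat d g i = mat d d (\<lambda>(a,b). g (i, min a b, max a b))"

definition response :: "nat \<Rightarrow> nat \<Rightarrow> real mat \<Rightarrow>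
    (nat \<times> nat \<times> nat \<Rightarrow> real) \<times> (nat \<Rightarrow> real) \<Rightarrow> nat \<Rightarrow> real" where
  "response n d M \<omega> i = frob_inner (design_mat d (fst \<omega>) i) M / sqrt n + snd \<omega> i"

definition objective :: "nat \<Rightarrow> nat \<Rightarrow> real mat \<Rightarrow> real \<Rightarrow>
    (nat \<times> nat \<times> nat \<Rightarrow> real) \<times> (nat \<Rightarrow> real) \<Rightarrow> real mat \<Rightarrow> real" where
  "objective n d M lam \<omega> U =
     (1/4) * (\<Sum>i<n. (response n d M \<omega> i
                 - frob_inner (design_mat d (fst \<omega>) i) (U * U\<^sup>T) / sqrt n)^2)
     + lam / 2 * (frob_norm U)^2"

definition second_order_stationary :: "nat \<Rightarrow> nat \<Rightarrow> (real mat \<Rightarrow> real) \<Rightarrow> real mat \<Rightarrow> bool" where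
  "second_order_stationary d r f U \<longleftrightarrow> U \<in> carrier_mat d r \<and>
     (\<forall>H \<in> carrier_mat d r.
        ((\<lambda>t. f (U + t \<cdot>\<^sub>m H)) has_real_derivative 0) (at 0) \<and>
        0 \<le> deriv (deriv (\<lambda>t. f (U + t \<cdot>\<^sub>m H))) 0)"

definition debiased :: "nat \<Rightarrow> real \<Rightarrow> real mat \<Rightarrow> real mat" where
  "debiased r lam U = U * psd_sqrt (1\<^sub>m r + lam \<cdot>\<^sub>m mat_inv (U\<^sup>T * U))"

definition diag_pos :: "nat \<Rightarrow> real mat \<Rightarrow> bool" where
  "diag_pos r L \<longleftrightarrow> L \<in> carrier_mat r r \<and>
     (\<forall>a<r. \<forall>b<r. a \<noteq> b \<longrightarrow> L $$ (a,b) = 0) \<and> (\<forall>a<r. 0 < L $$ (a,a))"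

end

theory Submission
  imports Defs "HOL-Analysis.Generalised_Binomial_Theorem" "Jordan_Normal_Form.Determinant"
begin

text \<open>Both estimators are, up to a small error, the rank-r truncation of the same
  matrix. Write N for the noise matrix and E for the deviation of the empirical
  Gram operator from the identity, applied to U U^T - M. The first-order condition says that the
  range of U is invariant under B = M + N - E, with B = U U^T + lambda P there (P the projection onto
  that range); the second-order condition, tested on rank-one directions leaving the range, bounds B on
  the orthogonal complement. A dimension count against the kernel of M turns this into
  B = U U^T + lambda P + R with a residual R of the order of the noise, without any a priori bound on
  U. For the debiased factor F one has F F^T = U U^T + lambda P, so D = F F^T - U0 U0^T equals the
  difference of two E terms minus a difference of residuals; the latter contributes at most half of
  the squared norm of D when the signal dominates the residuals, and the former is small.

  The probabilistic input is a bound of order sqrt (d/n) for the deviation operator on pairs of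
  rank-one matrices. It holds with probability 1 - O(exp (-d)), by chi-square tails and a union bound
  over a lattice that dominates every linear functional on the unit ball. Passing to matrices of
  rank 2r costs a factor r, which is exactly what the claimed rate allows.\<close>

section \<open>Gaussian linear forms\<close>

text \<open>The obstacle is circular: the size of E is controlled by the Frobenius norm of U U^T -
  M, and that norm is controlled only through E. Let eps bound the deviation on rank-one pairs.
  Passing from rank one to rank 2r costs sqrt (2r) in operator norm, and going back from operator
  norm to Frobenius norm costs sqrt (2r) again. The loop therefore closes as soon as r * eps lies
  below a constant, which is how n of order r^2 d enters. The matrices B for lambda and for 0 share
  M and N, so the noise cancels in their difference, which is E applied to U0 U0^T - U U^T. That
  difference of estimators is itself of the order of the noise, and E contributes the additional
  factor r * eps. All random bounds are homogeneous and hold for every direction at once, so they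
  apply to stationary points that depend on the data. The objects \<open>psd_sqrt\<close> and
  \<open>mat_inv\<close> are a choice and a partial inverse; both are shown to be meaningful from a
  lower bound on the singular values of the factor.\<close>

definition tri :: "nat \<Rightarrow> (nat \<times> nat) set" where "tri d = {(a,b). a \<le> b \<and> b < d}"

lemma finite_tri [simp]: "finite (tri d)"
  by (rule finite_subset[of _ "{..<d} \<times> {..<d}"]) (auto simp: tri_def)

definition goe_sd :: "nat \<times> nat \<Rightarrow> real" where
  "goe_sd p = (if fst p = snd p then 1 else sqrt (1/2))"

lemma goe_sd_pos: "0 < goe_sd p"
  by (simp add: goe_sd_def)

text \<open>Indexed by the upper triangle, where the entries are independent, so that
  \<open>goe_var\<close> is the exact variance. The pairing of a design matrix with any fixed matrix
  has this shape.\<close>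

definition goe_form :: "nat \<Rightarrow> (nat \<times> nat \<Rightarrow> real) \<Rightarrow> (nat \<times> nat \<times> nat \<Rightarrow> real) \<Rightarrow> nat \<Rightarrow> real" where
  "goe_form d c g i = (\<Sum>p\<in>tri d. c p * g (i, p))"

definition goe_var :: "nat \<Rightarrow> (nat \<times> nat \<Rightarrow> real) \<Rightarrow> real" where
  "goe_var d c = (\<Sum>p\<in>tri d. (c p * goe_sd p)\<^sup>2)"

abbreviation goe_coord :: "nat \<times> nat \<times> nat \<Rightarrow> real measure" where
  "goe_coord k \<equiv> density lborel (normal_density 0 (goe_sd (snd k)))"

lemma design_measure_eq: "design_measure n d = PiM (goe_index n d) goe_coord"
  unfolding design_measure_def
  by (intro PiM_cong refl) (auto simp: goe_sd_def split: prod.splits)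

lemma prob_space_design: "prob_space (design_measure n d)"
  unfolding design_measure_eq by (intro prob_space_PiM prob_space_normal_density goe_sd_pos)

lemma space_sets_design:
  "space (design_measure n d) = extensional (goe_index n d)"
  "sets (design_measure n d) = sets (PiM (goe_index n d) (\<lambda>_. borel))"
proof -
  show "space (design_measure n d) = extensional (goe_index n d)"
    by (auto simp: design_measure_eq space_PiM PiE_def extensional_def)
  show "sets (design_measure n d) = sets (PiM (goe_index n d) (\<lambda>_. borel))"
    unfolding design_measure_eq by (intro sets_PiM_cong) auto
qed

lemma measurable_coord:
  "k \<in> goe_index n d \<Longrightarrow> (\<lambda>\<omega>. \<omega> k) \<in> borel_measurable (design_measure n d)"
  unfolding measurable_cong_sets[OF space_sets_design(2) refl] by simp

lemma measurable_goe_form [measurable]: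
  "i < n \<Longrightarrow> (\<lambda>\<omega>. goe_form d c \<omega> i) \<in> borel_measurable (design_measure n d)"
  unfolding goe_form_def
  by (intro borel_measurable_sum borel_measurable_times borel_measurable_const measurable_coord)
    (auto simp: goe_index_def tri_def)

lemma indep_coords:
  "prob_space.indep_vars (design_measure n d) (\<lambda>_. borel) (\<lambda>k \<omega>. \<omega> k) (goe_index n d)"
\<comment> \<open>The characterisation of independence by the joint law, used below, asks for a
  nonempty index set.\<close>
proof (cases "goe_index n d = {}")
  case True
  then show ?thesis
    unfolding prob_space.indep_vars_def2[OF prob_space_design] prob_space.indep_sets_def[OF prob_space_design] by simp
next
  case False
  let ?D = "design_measure n d" and ?I = "goe_index n d"
  interpret prob_space ?D by (rule prob_space_design)
  have comp: "distr ?D borel (\<lambda>\<omega>. \<omega> k) = goe_coord k" if "k \<in> ?I" for k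
  proof -
    have "distr ?D borel (\<lambda>\<omega>. \<omega> k) = distr ?D (goe_coord k) (\<lambda>\<omega>. \<omega> k)"
      by (rule distr_cong) auto
    also have "\<dots> = goe_coord k"
      unfolding design_measure_eq
      by (rule distr_PiM_component) (auto intro: prob_space_normal_density goe_sd_pos that)
    finally show ?thesis .
  qed
  have "distr ?D (PiM ?I (\<lambda>_. borel)) (\<lambda>x. \<lambda>i\<in>?I. x i) = distr ?D ?D (\<lambda>x. x)"
    by (rule distr_cong) (auto simp: space_sets_design extensional_restrict)
  also have "\<dots> = ?D" by (rule distr_id)
  also have "\<dots> = PiM ?I (\<lambda>i. distr ?D borel (\<lambda>\<omega>. \<omega> i))"
    by (subst design_measure_eq) (rule PiM_cong, auto simp: comp)
  finally show ?thesis
    using False by (subst indep_vars_iff_distr_eq_PiM') (auto intro: measurable_coord)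
qed

lemma distributed_coord:
  assumes "k \<in> goe_index n d"
  shows "distributed (design_measure n d) lborel (\<lambda>\<omega>. \<omega> k) (normal_density 0 (goe_sd (snd k)))"
proof -
  have "distr (design_measure n d) lborel (\<lambda>\<omega>. \<omega> k) = distr (design_measure n d) (goe_coord k) (\<lambda>\<omega>. \<omega> k)"
    by (rule distr_cong) auto
  also have "\<dots> = goe_coord k"
    unfolding design_measure_eq
    by (rule distr_PiM_component) (auto intro: prob_space_normal_density goe_sd_pos assms)
  finally show ?thesis
    unfolding distributed_def using measurable_coord[OF assms] by simp
qed

lemma distributed_goe_form:
  assumes i: "i < n" and v: "goe_var d c \<noteq> 0"
  shows "distributed (design_measure n d) lborel (\<lambda>\<omega>. goe_form d c \<omega> i) (normal_density 0 (sqrt (goe_var d c)))"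
proof -
  interpret prob_space "design_measure n d" by (rule prob_space_design)
  \<comment> \<open>\<open>sum_indep_normal\<close> wants a positive deviation for every summand, so
    zero coefficients are dropped first; nonzero variance keeps the rest nonempty.\<close>
  let ?J = "{p\<in>tri d. c p \<noteq> 0}"
  have J: "?J \<noteq> {}"
  proof
    assume "?J = {}"
    then have "goe_var d c = 0" unfolding goe_var_def by (intro sum.neutral) auto
    with v show False ..
  qed
  let ?I = "Pair i ` ?J"
  have I: "?I \<subseteq> goe_index n d" using i by (auto simp: goe_index_def tri_def)
  have ind: "indep_vars (\<lambda>_. borel) (\<lambda>k \<omega>. c (snd k) * \<omega> k) ?I"
    by (rule indep_vars_compose2[OF indep_vars_subset[OF indep_coords I]]) simp
  have "distributed (design_measure n d) lborel (\<lambda>\<omega>. \<Sum>k\<in>?I. c (snd k) * \<omega> k)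
    (normal_density (\<Sum>k\<in>?I. 0) (sqrt (\<Sum>k\<in>?I. (\<bar>c (snd k)\<bar> * goe_sd (snd k))\<^sup>2)))"
  proof (rule sum_indep_normal[OF _ _ ind])
    show "?I \<noteq> {}" using J by simp
    fix k assume k: "k \<in> ?I"
    then have c: "c (snd k) \<noteq> 0" by auto
    then show "0 < \<bar>c (snd k)\<bar> * goe_sd (snd k)" by (simp add: goe_sd_pos)
    from normal_density_affine[OF distributed_coord[of k n d], of "c (snd k)" 0] k I c
    show "distributed (design_measure n d) lborel (\<lambda>\<omega>. c (snd k) * \<omega> k)
        (normal_density 0 (\<bar>c (snd k)\<bar> * goe_sd (snd k)))"
      by (auto simp: goe_sd_pos)
  qed simp
  moreover have "(\<Sum>k\<in>?I. c (snd k) * \<omega> k) = goe_form d c \<omega> i" for \<omega>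
    unfolding goe_form_def
    by (subst sum.reindex) (auto simp: inj_on_def intro!: sum.mono_neutral_left)
  moreover have "(\<Sum>k\<in>?I. (\<bar>c (snd k)\<bar> * goe_sd (snd k))\<^sup>2) = goe_var d c"
    unfolding goe_var_def power_mult_distrib power2_abs
    by (subst sum.reindex) (auto simp: inj_on_def intro!: sum.mono_neutral_left)
  ultimately show ?thesis by simp
qed

text \<open>Different i read disjoint blocks of coordinates.\<close>

lemma indep_goe_form:
  "prob_space.indep_vars (design_measure n d) (\<lambda>_. borel) (\<lambda>i \<omega>. goe_form d c \<omega> i) {..<n}"
proof -
  interpret prob_space "design_measure n d" by (rule prob_space_design)
  have "indep_vars (\<lambda>i. PiM (Pair i ` tri d) (\<lambda>_. borel)) (\<lambda>i \<omega>. \<lambda>k\<in>Pair i ` tri d. \<omega> k) {..<n}"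
    by (rule indep_vars_restrict[OF indep_coords]) (auto simp: goe_index_def tri_def disjoint_family_on_def)
  then have "indep_vars (\<lambda>_. borel) (\<lambda>i \<omega>. (\<lambda>g. goe_form d c g i) (\<lambda>k\<in>Pair i ` tri d. \<omega> k)) {..<n}"
    by (rule indep_vars_compose2) (simp add: goe_form_def)
  then show ?thesis by (simp add: goe_form_def)
qed

text \<open>Variance 0 has no density, so this case is split off in both moment computations: all
  coefficients vanish and the form is identically 0.\<close>

lemma goe_form_zero_var: "goe_var d c = 0 \<Longrightarrow> goe_form d c g i = 0"
  unfolding goe_var_def goe_form_def
  using less_imp_neq[OF goe_sd_pos, symmetric] by (simp add: sum_nonneg_eq_0_iff sum.neutral)

lemma goe_var_nonneg: "0 \<le> goe_var d c"
  unfolding goe_var_def by (intro sum_nonneg) auto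

section \<open>Exponential moments of Gaussian forms\<close>

lemma nn_integral_normal_exp_square:
  fixes t v :: real
  assumes v: "0 < v" and t: "2 * t * v < 1"
  shows "(\<integral>\<^sup>+x. ennreal (normal_density 0 (sqrt v) x) * ennreal (exp (t * x\<^sup>2)) \<partial>lborel)
    = ennreal (1 / sqrt (1 - 2 * t * v))"
proof -
  \<comment> \<open>The tilted density is a multiple of the centred Gaussian density of this
    variance, and the multiple is the claimed value.\<close>
  let ?w = "v / (1 - 2 * t * v)"
  have w: "0 < ?w" using assms by simp
  have eq: "normal_density 0 (sqrt v) x * exp (t * x\<^sup>2) = 1 / sqrt (1 - 2 * t * v) * normal_density 0 (sqrt ?w) x" for x
  proof -
    have "- (x\<^sup>2) / (2 * v) + t * x\<^sup>2 = - (x\<^sup>2) / (2 * ?w)"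
      using assms by (simp add: field_simps)
    then have e: "exp (- (x\<^sup>2) / (2 * v)) * exp (t * x\<^sup>2) = exp (- (x\<^sup>2) / (2 * ?w))"
      by (simp only: exp_add[symmetric])
    have "sqrt (2 * pi * v) = sqrt (1 - 2 * t * v) * sqrt (2 * pi * ?w)"
      using assms by (simp add: real_sqrt_mult[symmetric])
    then have s: "1 / sqrt (2 * pi * v) = 1 / sqrt (1 - 2 * t * v) * (1 / sqrt (2 * pi * ?w))" by simp
    show ?thesis using v w unfolding normal_density_def
      by (simp only: diff_zero real_sqrt_pow2 less_imp_le mult.assoc e) (simp only: s mult.assoc[symmetric])
  qed
  have "(\<integral>\<^sup>+x. ennreal (normal_density 0 (sqrt v) x) * ennreal (exp (t * x\<^sup>2)) \<partial>lborel)
    = (\<integral>\<^sup>+x. ennreal (1 / sqrt (1 - 2 * t * v)) * ennreal (normal_density 0 (sqrt ?w) x) \<partial>lborel)"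
    by (intro nn_integral_cong) (use assms in \<open>simp add: ennreal_mult[symmetric] eq\<close>)
  also have "\<dots> = ennreal (1 / sqrt (1 - 2 * t * v)) * (\<integral>\<^sup>+x. ennreal (normal_density 0 (sqrt ?w) x) \<partial>lborel)"
    by (rule nn_integral_cmult) simp
  also have "(\<integral>\<^sup>+x. ennreal (normal_density 0 (sqrt ?w) x) \<partial>lborel) = 1"
    using w by (subst nn_integral_eq_integral) (auto intro: integrable_normal_density)
  finally show ?thesis by simp
qed

text \<open>This is -ln (1 - y) \<le> y + 2 y^2, halved and exponentiated. The two signs of y need
  different one-sided logarithm bounds.\<close>

lemma inverse_sqrt_le_exp:
  fixes y :: real
  assumes y: "\<bar>y\<bar> \<le> 1/2"
  shows "1 / sqrt (1 - y) \<le> exp (y / 2 + y\<^sup>2)"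
proof -
  have "- y - 2 * y\<^sup>2 \<le> ln (1 - y)"
  proof (cases "0 \<le> y")
    case True
    then show ?thesis using ln_one_minus_pos_lower_bound[of y] y by linarith
  next
    case False
    then have "- y - (- y)\<^sup>2 \<le> ln (1 + - y)"
      using y by (intro ln_one_plus_pos_lower_bound) linarith+
    then show ?thesis using zero_le_power2[of y] by (simp only: power2_minus add_uminus_conv_diff)
  qed
  moreover have "ln (sqrt (1 - y)) = ln (1 - y) / 2"
    using y by (intro ln_sqrt) linarith
  ultimately have "- ln (sqrt (1 - y)) \<le> y / 2 + y\<^sup>2" by linarith
  then have "exp (- ln (sqrt (1 - y))) \<le> exp (y / 2 + y\<^sup>2)" by (rule exp_le_cancel_iff[THEN iffD2])
  moreover have "0 < sqrt (1 - y)" using y by simp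
  then have "exp (- ln (sqrt (1 - y))) = 1 / sqrt (1 - y)" by (simp only: exp_minus exp_ln inverse_eq_divide)
  ultimately show ?thesis by (simp only:)
qed

lemma chi_square_mgf_le:
  fixes t v :: real
  assumes "\<bar>t * v\<bar> \<le> 1/4"
  shows "1 / sqrt (1 - 2 * t * v) \<le> exp (t * v + 4 * (t * v)\<^sup>2)"
  using inverse_sqrt_le_exp[of "2 * t * v"] assms
  by (simp add: abs_mult power_mult_distrib mult.assoc)

text \<open>Completing the square moves the mean to \<open>\<theta> * v\<close>.\<close>

lemma nn_integral_normal_exp_linear:
  assumes v: "0 < v"
  shows "(\<integral>\<^sup>+x. ennreal (normal_density 0 (sqrt v) x) * ennreal (exp (\<theta> * x)) \<partial>lborel)
    = ennreal (exp (\<theta>\<^sup>2 * v / 2))"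
proof -
  have eq: "normal_density 0 (sqrt v) x * exp (\<theta> * x) = exp (\<theta>\<^sup>2 * v / 2) * normal_density (\<theta> * v) (sqrt v) x" for x
  proof -
    have "- (x\<^sup>2) / (2 * v) + \<theta> * x = \<theta>\<^sup>2 * v / 2 + - ((x - \<theta> * v)\<^sup>2) / (2 * v)"
      using v by (simp add: field_simps power2_eq_square)
    then have "exp (- (x\<^sup>2) / (2 * v)) * exp (\<theta> * x) = exp (\<theta>\<^sup>2 * v / 2) * exp (- ((x - \<theta> * v)\<^sup>2) / (2 * v))"
      by (simp only: exp_add[symmetric])
    then show ?thesis using v by (simp add: normal_density_def)
  qed
  have "(\<integral>\<^sup>+x. ennreal (normal_density 0 (sqrt v) x) * ennreal (exp (\<theta> * x)) \<partial>lborel)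
    = (\<integral>\<^sup>+x. ennreal (exp (\<theta>\<^sup>2 * v / 2)) * ennreal (normal_density (\<theta> * v) (sqrt v) x) \<partial>lborel)"
    by (intro nn_integral_cong) (use v in \<open>simp add: ennreal_mult[symmetric] eq\<close>)
  also have "\<dots> = ennreal (exp (\<theta>\<^sup>2 * v / 2)) * (\<integral>\<^sup>+x. ennreal (normal_density (\<theta> * v) (sqrt v) x) \<partial>lborel)"
    by (rule nn_integral_cmult) simp
  also have "(\<integral>\<^sup>+x. ennreal (normal_density (\<theta> * v) (sqrt v) x) \<partial>lborel) = 1"
    using v by (subst nn_integral_eq_integral) (auto intro: integrable_normal_density)
  finally show ?thesis by simp
qed

text \<open>Centring removes the term of first order in t. What remains is quadratic, for t of
  either sign, and this gives tails of Bernstein type.\<close>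

lemma goe_form_exp_square:
  assumes i: "i < n" and tv: "\<bar>t * goe_var d c\<bar> \<le> 1/4"
  shows "(\<integral>\<^sup>+\<omega>. ennreal (exp (t * ((goe_form d c \<omega> i)\<^sup>2 - goe_var d c))) \<partial>design_measure n d)
    \<le> ennreal (exp (4 * (t * goe_var d c)\<^sup>2))"
proof (cases "goe_var d c = 0")
  case True
  interpret prob_space "design_measure n d" by (rule prob_space_design)
  show ?thesis by (simp add: True goe_form_zero_var emeasure_space_1)
next
  case False
  let ?v = "goe_var d c"
  have v: "0 < ?v" using False goe_var_nonneg[of d c] by simp
  have "(\<integral>\<^sup>+\<omega>. ennreal (exp (t * ((goe_form d c \<omega> i)\<^sup>2 - ?v))) \<partial>design_measure n d)
    = (\<integral>\<^sup>+\<omega>. ennreal (exp (- t * ?v)) * ennreal (exp (t * (goe_form d c \<omega> i)\<^sup>2)) \<partial>design_measure n d)"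
    by (intro nn_integral_cong) (simp add: ennreal_mult[symmetric] exp_add[symmetric] algebra_simps)
  also have "\<dots> = ennreal (exp (- t * ?v)) * (\<integral>\<^sup>+\<omega>. ennreal (exp (t * (goe_form d c \<omega> i)\<^sup>2)) \<partial>design_measure n d)"
    using i by (intro nn_integral_cmult) measurable
  also have "(\<integral>\<^sup>+\<omega>. ennreal (exp (t * (goe_form d c \<omega> i)\<^sup>2)) \<partial>design_measure n d) =
      (\<integral>\<^sup>+x. ennreal (normal_density 0 (sqrt ?v) x) * ennreal (exp (t * x\<^sup>2)) \<partial>lborel)"
    by (rule distributed_nn_integral[OF distributed_goe_form[OF i False], symmetric]) measurable
  also have "\<dots> = ennreal (1 / sqrt (1 - 2 * t * ?v))"
    using tv by (intro nn_integral_normal_exp_square v) (simp add: abs_le_iff)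
  also have "\<dots> \<le> ennreal (exp (t * ?v + 4 * (t * ?v)\<^sup>2))"
    using chi_square_mgf_le[OF tv] by (rule ennreal_leI)
  also have "ennreal (exp (- t * ?v)) * \<dots> = ennreal (exp (4 * (t * ?v)\<^sup>2))"
    by (simp add: ennreal_mult[symmetric] exp_add[symmetric])
  finally show ?thesis by (simp add: mult_left_mono)
qed

lemma goe_form_exp_linear:
  assumes i: "i < n"
  shows "(\<integral>\<^sup>+\<omega>. ennreal (exp (\<theta> * goe_form d c \<omega> i)) \<partial>design_measure n d)
    = ennreal (exp (\<theta>\<^sup>2 * goe_var d c / 2))"
proof (cases "goe_var d c = 0")
  case True
  interpret prob_space "design_measure n d" by (rule prob_space_design)
  show ?thesis by (simp add: True goe_form_zero_var emeasure_space_1)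
next
  case False
  then have "0 < goe_var d c" using goe_var_nonneg[of d c] by simp
  have "(\<integral>\<^sup>+\<omega>. ennreal (exp (\<theta> * goe_form d c \<omega> i)) \<partial>design_measure n d)
    = (\<integral>\<^sup>+x. ennreal (normal_density 0 (sqrt (goe_var d c)) x) * ennreal (exp (\<theta> * x)) \<partial>lborel)"
    by (rule distributed_nn_integral[OF distributed_goe_form[OF i False], symmetric]) measurable
  then show ?thesis using nn_integral_normal_exp_linear[OF \<open>0 < goe_var d c\<close>] by simp
qed

lemma goe_form_prod:
  assumes f: "\<And>i. i < n \<Longrightarrow> f i \<in> borel_measurable borel"
  shows "(\<integral>\<^sup>+\<omega>. (\<Prod>i<n. ennreal (f i (goe_form d c \<omega> i))) \<partial>design_measure n d)
    = (\<Prod>i<n. \<integral>\<^sup>+\<omega>. ennreal (f i (goe_form d c \<omega> i)) \<partial>design_measure n d)"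
proof -
  interpret prob_space "design_measure n d" by (rule prob_space_design)
  show ?thesis
    by (rule indep_vars_nn_integral)
      (use f in \<open>auto intro!: indep_vars_compose2[OF indep_goe_form[of n d c]]\<close>)
qed

text \<open>Markov's inequality for \<open>exp W\<close>. Writing the moment as a nonnegative
  integral spares all integrability proofs.\<close>

lemma (in prob_space) chernoff:
  assumes W [measurable]: "W \<in> borel_measurable M"
    and le: "(\<integral>\<^sup>+\<omega>. ennreal (exp (W \<omega>)) \<partial>M) \<le> ennreal (exp b)"
  shows "prob {\<omega>\<in>space M. a \<le> W \<omega>} \<le> exp (b - a)"
proof -
  have "emeasure M {\<omega>\<in>space M. a \<le> W \<omega>} \<le> emeasure M {\<omega>\<in>space M. 1 \<le> ennreal (exp (- a)) * ennreal (exp (W \<omega>))}"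
    by (intro emeasure_mono)
      (auto simp: ennreal_mult[symmetric] exp_add[symmetric] simp flip: ennreal_1 intro!: ennreal_leI)
  also have "\<dots> \<le> ennreal (exp (- a)) * (\<integral>\<^sup>+\<omega>. ennreal (exp (W \<omega>)) * indicator (space M) \<omega> \<partial>M)"
    by (rule nn_integral_Markov_inequality) auto
  also have "(\<integral>\<^sup>+\<omega>. ennreal (exp (W \<omega>)) * indicator (space M) \<omega> \<partial>M) = (\<integral>\<^sup>+\<omega>. ennreal (exp (W \<omega>)) \<partial>M)"
    by (intro nn_integral_cong) simp
  also have "ennreal (exp (- a)) * \<dots> \<le> ennreal (exp (- a)) * ennreal (exp b)"
    by (intro mult_left_mono le) simp
  also have "\<dots> = ennreal (exp (b - a))" by (simp add: ennreal_mult[symmetric] exp_add[symmetric])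
  finally show ?thesis by (simp add: emeasure_eq_measure)
qed

section \<open>Concentration and discretisation\<close>

lemma prob_space_noise: "0 < \<sigma> \<Longrightarrow> prob_space (noise_measure n \<sigma>)"
  unfolding noise_measure_def by (intro prob_space_PiM prob_space_normal_density)

lemma prob_space_sample: "0 < \<sigma> \<Longrightarrow> prob_space (sample_measure n d \<sigma>)"
  unfolding sample_measure_def
  using prob_space_design[of n d] prob_space_noise[of \<sigma> n] by (rule prob_space_pair)

lemma measurable_noise: "i < n \<Longrightarrow> (\<lambda>e. e i) \<in> borel_measurable (noise_measure n \<sigma>)"
  unfolding noise_measure_def
  by (subst measurable_cong_sets[OF sets_PiM_cong[of _ _ _ "\<lambda>_. borel"] refl]) auto

lemma measurable_sample_form:
  "i < n \<Longrightarrow> (\<lambda>\<omega>. goe_form d c (fst \<omega>) i) \<in> borel_measurable (sample_measure n d \<sigma>)"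
  unfolding sample_measure_def
  using measurable_compose[OF measurable_fst measurable_goe_form] by blast

lemma measurable_sample_noise:
  "i < n \<Longrightarrow> (\<lambda>\<omega>. snd \<omega> i) \<in> borel_measurable (sample_measure n d \<sigma>)"
  unfolding sample_measure_def
  using measurable_compose[OF measurable_snd measurable_noise] by blast

text \<open>The sign of t selects the tail, so one statement serves for deviations in both
  directions.\<close>

lemma goe_square_tail:
  assumes \<sigma>: "0 < \<sigma>" and tv: "\<bar>t * goe_var d c\<bar> \<le> 1/4"
  shows "measure (sample_measure n d \<sigma>)
      {\<omega>\<in>space (sample_measure n d \<sigma>). a \<le> t * (\<Sum>i<n. (goe_form d c (fst \<omega>) i)\<^sup>2 - goe_var d c)}
    \<le> exp (4 * real n * (t * goe_var d c)\<^sup>2 - a)"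
proof -
  let ?S = "sample_measure n d \<sigma>" and ?D = "design_measure n d" and ?v = "goe_var d c"
  interpret prob_space ?S using \<sigma> by (rule prob_space_sample)
  let ?f = "\<lambda>g. t * (\<Sum>i<n. (goe_form d c g i)\<^sup>2 - ?v)"
  have meas: "?f \<in> borel_measurable ?D"
    by (intro borel_measurable_times borel_measurable_const borel_measurable_sum borel_measurable_diff
        borel_measurable_power measurable_goe_form) simp
  have meas': "(\<lambda>\<omega>. ?f (fst \<omega>)) \<in> borel_measurable ?S"
    unfolding sample_measure_def by (rule measurable_compose[OF measurable_fst meas])
  have "(\<integral>\<^sup>+\<omega>. ennreal (exp (?f (fst \<omega>))) \<partial>?S) = (\<integral>\<^sup>+g. ennreal (exp (?f g)) \<partial>distr ?S ?D fst)"
    by (rule nn_integral_distr[symmetric]) (use meas in \<open>auto simp: sample_measure_def\<close>)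
  also have "distr ?S ?D fst = ?D"
    unfolding sample_measure_def using prob_space_noise[OF \<sigma>] by (rule prob_space.distr_pair_fst)
  also have "(\<integral>\<^sup>+g. ennreal (exp (?f g)) \<partial>?D)
      = (\<integral>\<^sup>+g. (\<Prod>i<n. ennreal (exp (t * ((goe_form d c g i)\<^sup>2 - ?v)))) \<partial>?D)"
    by (intro nn_integral_cong) (simp add: sum_distrib_left exp_sum prod_ennreal)
  also have "\<dots> = (\<Prod>i<n. \<integral>\<^sup>+g. ennreal (exp (t * ((goe_form d c g i)\<^sup>2 - ?v))) \<partial>?D)"
    by (rule goe_form_prod) simp
  also have "\<dots> \<le> (\<Prod>i<n. ennreal (exp (4 * (t * ?v)\<^sup>2)))"
    by (intro prod_mono_ennreal goe_form_exp_square tv) simp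
  also have "\<dots> = ennreal (exp (4 * real n * (t * ?v)\<^sup>2))"
    by (simp add: prod_ennreal exp_of_nat_mult[symmetric] ennreal_power mult_ac)
  finally show ?thesis by (rule chernoff[OF meas'])
qed

text \<open>Integrating out the design in \<open>noise_form_tail\<close> leaves this moment of the
  squared noise. The squares are not centred, so a bound linear in t is enough.\<close>

lemma noise_mgf_le:
  assumes \<sigma>: "0 < \<sigma>" and t: "0 \<le> t" "t * \<sigma>\<^sup>2 \<le> 1/4"
  shows "(\<integral>\<^sup>+e. (\<Prod>i<n. ennreal (exp (t * (e i)\<^sup>2))) \<partial>noise_measure n \<sigma>) \<le> ennreal (exp (2 * real n * (t * \<sigma>\<^sup>2)))"
proof -
  interpret product_sigma_finite "\<lambda>_::nat. density lborel (normal_density 0 \<sigma>)"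
    by (intro product_sigma_finite.intro prob_space_imp_sigma_finite prob_space_normal_density \<sigma>)
  have "(\<integral>\<^sup>+e. (\<Prod>i<n. ennreal (exp (t * (e i)\<^sup>2))) \<partial>noise_measure n \<sigma>)
     = (\<Prod>i<n. \<integral>\<^sup>+x. ennreal (exp (t * x\<^sup>2)) \<partial>density lborel (normal_density 0 \<sigma>))"
    unfolding noise_measure_def by (rule product_nn_integral_prod) auto
  also have "(\<integral>\<^sup>+x. ennreal (exp (t * x\<^sup>2)) \<partial>density lborel (normal_density 0 \<sigma>))
     = (\<integral>\<^sup>+x. ennreal (normal_density 0 (sqrt (\<sigma>\<^sup>2)) x) * ennreal (exp (t * x\<^sup>2)) \<partial>lborel)"
    using \<sigma> by (subst nn_integral_density) auto
  also have "\<dots> = ennreal (1 / sqrt (1 - 2 * t * \<sigma>\<^sup>2))"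
    using \<sigma> t by (intro nn_integral_normal_exp_square) auto
  also have "(\<Prod>i<n. ennreal (1 / sqrt (1 - 2 * t * \<sigma>\<^sup>2))) \<le> (\<Prod>i<n. ennreal (exp (2 * (t * \<sigma>\<^sup>2))))"
  proof (intro prod_mono_ennreal ennreal_leI)
    have tv: "0 \<le> t * \<sigma>\<^sup>2" using t by simp
    have "1 / sqrt (1 - 2 * t * \<sigma>\<^sup>2) \<le> exp (t * \<sigma>\<^sup>2 + 4 * (t * \<sigma>\<^sup>2)\<^sup>2)"
      by (rule chi_square_mgf_le) (use t tv in simp)
    also have "4 * (t * \<sigma>\<^sup>2)\<^sup>2 \<le> t * \<sigma>\<^sup>2"
      using mult_right_mono[OF t(2) tv] by (simp add: power2_eq_square)
    finally show "1 / sqrt (1 - 2 * t * \<sigma>\<^sup>2) \<le> exp (2 * (t * \<sigma>\<^sup>2))" by simp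
  qed
  also have "\<dots> = ennreal (exp (2 * real n * (t * \<sigma>\<^sup>2)))"
    by (simp add: prod_ennreal exp_of_nat_mult[symmetric] ennreal_power mult_ac)
  finally show ?thesis .
qed

text \<open>For fixed noise the sum is Gaussian, with variance proportional to the squared length of
  the noise vector. Hence the design is integrated out first.\<close>

lemma noise_form_tail:
  assumes \<sigma>: "0 < \<sigma>" and small: "\<theta>\<^sup>2 * goe_var d c * \<sigma>\<^sup>2 \<le> 1/2"
  shows "measure (sample_measure n d \<sigma>)
      {\<omega>\<in>space (sample_measure n d \<sigma>). a \<le> \<theta> * (\<Sum>i<n. snd \<omega> i * goe_form d c (fst \<omega>) i)}
    \<le> exp (real n * (\<theta>\<^sup>2 * goe_var d c * \<sigma>\<^sup>2) - a)"
proof -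
  let ?S = "sample_measure n d \<sigma>" and ?D = "design_measure n d" and ?N = "noise_measure n \<sigma>"
    and ?v = "goe_var d c"
  interpret prob_space ?S using \<sigma> by (rule prob_space_sample)
  interpret D: prob_space ?D by (rule prob_space_design)
  interpret N: prob_space ?N using \<sigma> by (rule prob_space_noise)
  interpret pair_sigma_finite ?D ?N ..
  let ?f = "\<lambda>\<omega>. \<theta> * (\<Sum>i<n. snd \<omega> i * goe_form d c (fst \<omega>) i)"
  have meas: "?f \<in> borel_measurable ?S"
    by (intro borel_measurable_times borel_measurable_const borel_measurable_sum
        measurable_sample_form measurable_sample_noise) simp_all
  then have meas': "(\<lambda>\<omega>. ennreal (exp (?f \<omega>))) \<in> borel_measurable (?D \<Otimes>\<^sub>M ?N)"
    unfolding sample_measure_def by measurable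
  have "(\<integral>\<^sup>+\<omega>. ennreal (exp (?f \<omega>)) \<partial>?S) = (\<integral>\<^sup>+e. \<integral>\<^sup>+g. ennreal (exp (?f (g, e))) \<partial>?D \<partial>?N)"
    unfolding sample_measure_def by (rule nn_integral_snd[OF meas', symmetric])
  also have "\<dots> = (\<integral>\<^sup>+e. (\<Prod>i<n. ennreal (exp (\<theta>\<^sup>2 * ?v / 2 * (e i)\<^sup>2))) \<partial>?N)"
  proof (rule nn_integral_cong)
    fix e
    have "(\<integral>\<^sup>+g. ennreal (exp (?f (g, e))) \<partial>?D) = (\<integral>\<^sup>+g. (\<Prod>i<n. ennreal (exp (\<theta> * e i * goe_form d c g i))) \<partial>?D)"
      by (intro nn_integral_cong) (simp add: sum_distrib_left exp_sum prod_ennreal mult_ac)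
    also have "\<dots> = (\<Prod>i<n. \<integral>\<^sup>+g. ennreal (exp (\<theta> * e i * goe_form d c g i)) \<partial>?D)"
      by (rule goe_form_prod) simp
    also have "\<dots> = (\<Prod>i<n. ennreal (exp (\<theta>\<^sup>2 * ?v / 2 * (e i)\<^sup>2)))"
      by (intro prod.cong refl) (subst goe_form_exp_linear, simp, simp add: power_mult_distrib mult_ac)
    finally show "(\<integral>\<^sup>+g. ennreal (exp (?f (g, e))) \<partial>?D) = (\<Prod>i<n. ennreal (exp (\<theta>\<^sup>2 * ?v / 2 * (e i)\<^sup>2)))" .
  qed
  also have "\<dots> \<le> ennreal (exp (2 * real n * (\<theta>\<^sup>2 * ?v / 2 * \<sigma>\<^sup>2)))"
  proof (rule noise_mgf_le[OF \<sigma>])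
    show "0 \<le> \<theta>\<^sup>2 * ?v / 2" using goe_var_nonneg[of d c] by simp
    have "\<theta>\<^sup>2 * ?v / 2 * \<sigma>\<^sup>2 = (\<theta>\<^sup>2 * ?v * \<sigma>\<^sup>2) / 2" by simp
    then show "\<theta>\<^sup>2 * ?v / 2 * \<sigma>\<^sup>2 \<le> 1 / 4" using small by linarith
  qed
  also have "2 * real n * (\<theta>\<^sup>2 * ?v / 2 * \<sigma>\<^sup>2) = real n * (\<theta>\<^sup>2 * ?v * \<sigma>\<^sup>2)" by simp
  finally have "(\<integral>\<^sup>+\<omega>. ennreal (exp (?f \<omega>)) \<partial>?S) \<le> ennreal (exp (real n * (\<theta>\<^sup>2 * ?v * \<sigma>\<^sup>2)))" .
  then show ?thesis by (rule chernoff[OF meas])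
qed

section \<open>Rank-one forms and their empirical covariance\<close>

definition dot :: "nat \<Rightarrow> (nat \<Rightarrow> real) \<Rightarrow> (nat \<Rightarrow> real) \<Rightarrow> real" where
  "dot d a b = (\<Sum>p<d. a p * b p)"

text \<open>The rank-one matrix a b^T folded onto the upper triangle: off the diagonal one Gaussian
  coordinate serves two entries.\<close>

definition outer_coeff :: "(nat \<Rightarrow> real) \<Rightarrow> (nat \<Rightarrow> real) \<Rightarrow> nat \<times> nat \<Rightarrow> real" where
  "outer_coeff a b = (\<lambda>(p, q). if p = q then a p * b p else a p * b q + a q * b p)"

definition design_form :: "nat \<Rightarrow> (nat \<times> nat \<times> nat \<Rightarrow> real) \<Rightarrow> (nat \<Rightarrow> real) \<Rightarrow> (nat \<Rightarrow> real) \<Rightarrow> nat \<Rightarrow> real" where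
  "design_form d g a b i = (\<Sum>p<d. \<Sum>q<d. a p * b q * g (i, min p q, max p q))"

lemma sum_square_tri:
  fixes F :: "nat \<Rightarrow> nat \<Rightarrow> real"
  shows "(\<Sum>p<d. \<Sum>q<d. F p q) = (\<Sum>(p,q)\<in>tri d. if p = q then F p p else F p q + F q p)"
proof -
  let ?L = "{(p,q). p < q \<and> q < d}"
  have fin: "finite ?L" by (rule finite_subset[OF _ finite_tri[of d]]) (auto simp: tri_def)
  have "(\<Sum>p<d. \<Sum>q<d. F p q) = (\<Sum>(p,q)\<in>{..<d}\<times>{..<d}. F p q)" by (rule sum.cartesian_product)
  also have "{..<d}\<times>{..<d} = tri d \<union> prod.swap ` ?L" by (auto simp: tri_def image_iff)
  also have "(\<Sum>(p,q)\<in>tri d \<union> prod.swap ` ?L. F p q) = (\<Sum>(p,q)\<in>tri d. F p q) + (\<Sum>(p,q)\<in>prod.swap ` ?L. F p q)"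
    by (rule sum.union_disjoint, simp, simp add: fin) (auto simp: tri_def)
  also have "(\<Sum>(p,q)\<in>prod.swap ` ?L. F p q) = (\<Sum>(p,q)\<in>?L. F q p)"
    by (subst sum.reindex) (auto simp: case_prod_beta inj_on_def)
  also have "(\<Sum>(p,q)\<in>?L. F q p) = (\<Sum>(p,q)\<in>tri d. if p = q then 0 else F q p)"
    by (rule sum.mono_neutral_cong_left, simp) (auto simp: tri_def split: if_splits)
  finally show ?thesis
    by (simp add: sum.distrib[symmetric] case_prod_beta') (intro sum.cong refl, auto)
qed

lemma design_form_eq: "design_form d g a b i = goe_form d (outer_coeff a b) g i"
  unfolding design_form_def goe_form_def sum_square_tri
  by (intro sum.cong refl) (auto simp: outer_coeff_def tri_def algebra_simps)

text \<open>The off-diagonal variance 1/2 offsets the folding, so the covariance of two forms is the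
  Frobenius inner product of the symmetrised outer products.\<close>

lemma outer_coeff_cov:
  "(\<Sum>p\<in>tri d. outer_coeff a b p * outer_coeff u v p * (goe_sd p)\<^sup>2)
    = (dot d a u * dot d b v + dot d a v * dot d b u) / 2"
proof -
  have "(dot d a u * dot d b v + dot d a v * dot d b u) / 2
    = (\<Sum>p<d. \<Sum>q<d. a p * b q * (u p * v q + v p * u q) / 2)"
    by (simp add: dot_def sum_product sum.distrib[symmetric] sum_divide_distrib algebra_simps)
  also have "\<dots> = (\<Sum>p\<in>tri d. outer_coeff a b p * outer_coeff u v p * (goe_sd p)\<^sup>2)"
    unfolding sum_square_tri
    by (intro sum.cong refl) (auto simp: outer_coeff_def goe_sd_def algebra_simps add_divide_distrib real_sqrt_divide power_divide)
  finally show ?thesis by simp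
qed

text \<open>The subtracted term is the expectation of the empirical average, by
  \<open>outer_coeff_cov\<close>.\<close>

definition design_defect :: "nat \<Rightarrow> nat \<Rightarrow> (nat \<times> nat \<times> nat \<Rightarrow> real) \<Rightarrow>
    (nat \<Rightarrow> real) \<Rightarrow> (nat \<Rightarrow> real) \<Rightarrow> (nat \<Rightarrow> real) \<Rightarrow> (nat \<Rightarrow> real) \<Rightarrow> real" where
  "design_defect n d g a b u v = (\<Sum>i<n. design_form d g a b i * design_form d g u v i) / real n
    - (dot d a u * dot d b v + dot d a v * dot d b u) / 2"

definition form_dev :: "nat \<Rightarrow> nat \<Rightarrow> (nat \<times> nat \<times> nat \<Rightarrow> real) \<Rightarrow> (nat \<times> nat \<Rightarrow> real) \<Rightarrow> real" where
  "form_dev n d g c = (\<Sum>i<n. (goe_form d c g i)\<^sup>2 - goe_var d c)"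

text \<open>Polarisation: a product of two dependent Gaussian forms becomes a difference of two
  centred sums of squares, for which \<open>goe_square_tail\<close> is available.\<close>

lemma design_defect_polar:
  fixes a b u v :: "nat \<Rightarrow> real"
  assumes n: "0 < n"
  defines "c \<equiv> outer_coeff a b" and "c' \<equiv> outer_coeff u v"
  shows "4 * real n * design_defect n d g a b u v
    = form_dev n d g (\<lambda>p. c p + c' p) - form_dev n d g (\<lambda>p. c p - c' p)"
proof -
  have gf: "goe_form d (\<lambda>p. c p + c' p) g i = goe_form d c g i + goe_form d c' g i"
    "goe_form d (\<lambda>p. c p - c' p) g i = goe_form d c g i - goe_form d c' g i" for i
    by (simp_all add: goe_form_def algebra_simps sum.distrib sum_subtractf)
  have "goe_var d (\<lambda>p. c p + c' p) - goe_var d (\<lambda>p. c p - c' p)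
    = 4 * (\<Sum>p\<in>tri d. c p * c' p * (goe_sd p)\<^sup>2)"
    unfolding goe_var_def sum_subtractf[symmetric] sum_distrib_left
    by (intro sum.cong refl) (simp add: power2_eq_square algebra_simps)
  then have gv: "goe_var d (\<lambda>p. c p + c' p) = goe_var d (\<lambda>p. c p - c' p) + 4 * (\<Sum>p\<in>tri d. c p * c' p * (goe_sd p)\<^sup>2)"
    by simp
  have "form_dev n d g (\<lambda>p. c p + c' p) - form_dev n d g (\<lambda>p. c p - c' p)
    = (\<Sum>i<n. 4 * (goe_form d c g i * goe_form d c' g i) - 4 * (\<Sum>p\<in>tri d. c p * c' p * (goe_sd p)\<^sup>2))"
    unfolding form_dev_def sum_subtractf[symmetric] gf gv
    by (intro sum.cong refl) (simp add: power2_sum power2_diff)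
  also have "\<dots> = 4 * (\<Sum>i<n. goe_form d c g i * goe_form d c' g i)
     - 4 * real n * (\<Sum>p\<in>tri d. c p * c' p * (goe_sd p)\<^sup>2)"
    by (simp add: sum_subtractf sum_distrib_left[symmetric])
  finally have fin: "form_dev n d g (\<lambda>p. c p + c' p) - form_dev n d g (\<lambda>p. c p - c' p)
    = 4 * (\<Sum>i<n. goe_form d c g i * goe_form d c' g i)
      - 4 * real n * ((dot d a u * dot d b v + dot d a v * dot d b u) / 2)"
    unfolding c_def c'_def outer_coeff_cov .
  have "4 * real n * (S / real n - C) = 4 * S - 4 * real n * C" for S C
    using n by (simp add: right_diff_distrib)
  then show ?thesis unfolding fin unfolding design_defect_def design_form_eq c_def c'_def .
qed

lemma dot_cauchy_schwarz: "(dot d a b)\<^sup>2 \<le> dot d a a * dot d b b"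
  using Cauchy_Schwarz_ineq_sum[of a b "{..<d}"] by (simp add: dot_def power2_eq_square)

lemma dot_nonneg: "0 \<le> dot d a a"
  unfolding dot_def by (intro sum_nonneg) simp

text \<open>The bound 4 is the squared radius of the lattice points over which the union bound
  runs.\<close>

lemma goe_var_outer_le:
  assumes "dot d a a \<le> 4" "dot d b b \<le> 4"
  shows "goe_var d (outer_coeff a b) \<le> 16"
proof -
  have "goe_var d (outer_coeff a b) = (dot d a a * dot d b b + dot d a b * dot d b a) / 2"
    unfolding outer_coeff_cov[symmetric] goe_var_def by (intro sum.cong refl) (simp add: power2_eq_square mult_ac)
  also have "\<dots> = (dot d a a * dot d b b + (dot d a b)\<^sup>2) / 2"
    by (simp add: dot_def power2_eq_square mult.commute)
  also have "\<dots> \<le> dot d a a * dot d b b" using dot_cauchy_schwarz[of d a b] by simp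
  also have "\<dots> \<le> 4 * 4" using assms by (intro mult_mono) (auto simp: dot_nonneg)
  finally show ?thesis by simp
qed

text \<open>Parallelogram law: 64 = 2 * 16 + 2 * 16.\<close>

lemma goe_var_pm_le:
  assumes "goe_var d c \<le> 16" "goe_var d c' \<le> 16"
  shows "goe_var d (\<lambda>p. c p + c' p) \<le> 64" "goe_var d (\<lambda>p. c p - c' p) \<le> 64"
proof -
  have "goe_var d (\<lambda>p. c p + c' p) + goe_var d (\<lambda>p. c p - c' p) = 2 * goe_var d c + 2 * goe_var d c'"
    unfolding goe_var_def sum.distrib[symmetric] sum_distrib_left
    by (intro sum.cong refl) (simp add: power2_eq_square algebra_simps)
  then show "goe_var d (\<lambda>p. c p + c' p) \<le> 64" "goe_var d (\<lambda>p. c p - c' p) \<le> 64"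
    using assms goe_var_nonneg[of d "\<lambda>p. c p + c' p"] goe_var_nonneg[of d "\<lambda>p. c p - c' p"] by linarith+
qed

section \<open>A lattice in the ball of radius 2, and its size\<close>

definition lattice_ball :: "nat \<Rightarrow> (nat \<Rightarrow> int) set" where
  "lattice_ball d = {z \<in> PiE {..<d} (\<lambda>_. {- 2 * int d..2 * int d}). (\<Sum>i<d. (z i)\<^sup>2) \<le> 4 * int d}"

text \<open>Mesh 1 / sqrt d in the ball of radius 2. The box in \<open>lattice_ball\<close> excludes
  no integer point with that sum of squares, as |z_i| \<le> 2 sqrt d \<le> 2 d, and makes finiteness
  immediate.\<close>

definition lattice_point :: "nat \<Rightarrow> (nat \<Rightarrow> int) \<Rightarrow> nat \<Rightarrow> real" where
  "lattice_point d z i = real_of_int (z i) / sqrt d"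

lemma finite_lattice_ball: "finite (lattice_ball d)"
  unfolding lattice_ball_def by (intro finite_subset[OF _ finite_PiE[of "{..<d}" "\<lambda>_. {- 2 * int d..2 * int d}"]]) auto

lemma sum_exp_neg_square_le: "(\<Sum>k\<in>{- int m..int m}. exp (- (real_of_int k)\<^sup>2)) \<le> 3"
proof -
  \<comment> \<open>Strengthened for the induction: the two new terms add at most 2 * (1/2)^(m+1),
    which is exactly what the slack gives up.\<close>
  have "(\<Sum>k\<in>{- int m..int m}. exp (- (real_of_int k)\<^sup>2)) \<le> 3 - 2 * (1/2) ^ m"
  proof (induction m)
    case (Suc m)
    have eq: "{- int (Suc m)..int (Suc m)} = insert (- int (Suc m)) (insert (int (Suc m)) {- int m..int m})" by auto
    have "exp (- (real (Suc m))\<^sup>2) \<le> exp (- real (Suc m))"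
    proof -
      have "real (Suc m) * 1 \<le> real (Suc m) * real (Suc m)" by (intro mult_left_mono) auto
      then show ?thesis by (simp only: power2_eq_square mult_1_right exp_le_cancel_iff neg_le_iff_le)
    qed
    also have "\<dots> = exp (- 1) ^ Suc m"
      using exp_of_nat_mult[of "Suc m" "- 1::real"] by (simp only: mult_minus1_right)
    also have "\<dots> \<le> (1/2) ^ Suc m"
    proof (rule power_mono)
      have "2 \<le> exp (1::real)" using exp_ge_add_one_self[of 1] by simp
      then show "exp (- 1) \<le> (1/2::real)" by (simp add: exp_minus field_simps)
    qed simp
    finally have "exp (- (real (Suc m))\<^sup>2) \<le> (1/2) ^ Suc m" .
    moreover have "(\<Sum>k\<in>{- int (Suc m)..int (Suc m)}. exp (- (real_of_int k)\<^sup>2))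
        = 2 * exp (- (real (Suc m))\<^sup>2) + (\<Sum>k\<in>{- int m..int m}. exp (- (real_of_int k)\<^sup>2))"
      unfolding eq by (subst sum.insert; simp del: of_nat_Suc)+
    ultimately show ?case using Suc by simp
  qed simp
  then show ?thesis by (smt (verit) zero_le_power divide_nonneg_pos)
qed

text \<open>Counting with Gaussian weights: every point has exp (4 d - |z|^2) \<ge> 1, and the
  weighted sum over the box factorises over coordinates, each factor being at most 3 \<le> exp 2.
  Hence 6 = 4 + 2.\<close>

lemma card_lattice_ball_le: "real (card (lattice_ball d)) \<le> exp (6 * real d)"
proof -
  let ?K = "{- 2 * int d..2 * int d}" let ?B = "PiE {..<d} (\<lambda>_. ?K)"
  have sub: "lattice_ball d \<subseteq> ?B" and finB: "finite ?B" by (auto simp: lattice_ball_def intro!: finite_PiE)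
  have "real (card (lattice_ball d)) = (\<Sum>z\<in>lattice_ball d. 1)" by simp
  also have "\<dots> \<le> (\<Sum>z\<in>lattice_ball d. exp (4 * real d) * (\<Prod>i<d. exp (- (real_of_int (z i))\<^sup>2)))"
  proof (rule sum_mono)
    fix z assume "z \<in> lattice_ball d"
    then have "(\<Sum>i<d. (z i)\<^sup>2) \<le> 4 * int d" by (simp add: lattice_ball_def)
    then have "real_of_int (\<Sum>i<d. (z i)\<^sup>2) \<le> real_of_int (4 * int d)" by (rule of_int_le_iff[THEN iffD2])
    then have "(\<Sum>i<d. (real_of_int (z i))\<^sup>2) \<le> 4 * real d" by simp
    then have "0 \<le> 4 * real d + (\<Sum>i<d. - (real_of_int (z i))\<^sup>2)" unfolding sum_negf by linarith
    then have "1 \<le> exp (4 * real d + (\<Sum>i<d. - (real_of_int (z i))\<^sup>2))" by (rule one_le_exp_iff[THEN iffD2])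
    then show "1 \<le> exp (4 * real d) * (\<Prod>i<d. exp (- (real_of_int (z i))\<^sup>2))"
      by (simp only: exp_add exp_sum[OF finite_lessThan])
  qed
  also have "\<dots> \<le> (\<Sum>z\<in>?B. exp (4 * real d) * (\<Prod>i<d. exp (- (real_of_int (z i))\<^sup>2)))"
    by (rule sum_mono2[OF finB sub]) (intro mult_nonneg_nonneg prod_nonneg ballI exp_ge_zero)
  also have "\<dots> = exp (4 * real d) * (\<Prod>i<d. \<Sum>k\<in>?K. exp (- (real_of_int k)\<^sup>2))"
    unfolding sum_distrib_left[symmetric]
    by (rule arg_cong[where f="\<lambda>x. exp (4 * real d) * x"], rule prod_sum_PiE[symmetric]) (rule finite_lessThan finite_atLeastAtMost_int)+
  also have "\<dots> \<le> exp (4 * real d) * (\<Prod>i<d. exp 2)"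
  proof (intro mult_left_mono prod_mono conjI sum_nonneg)
    fix i
    have "?K = {- int (2 * d)..int (2 * d)}" by simp
    moreover have "3 \<le> exp (2::real)" using exp_ge_add_one_self[of "2::real"] by linarith
    ultimately show "(\<Sum>k\<in>?K. exp (- (real_of_int k)\<^sup>2)) \<le> exp 2"
      using sum_exp_neg_square_le[of "2 * d"] by (metis order_trans)
  qed (rule exp_ge_zero)+
  also have "\<dots> = exp (4 * real d) * exp (real d * 2)"
    by (simp only: prod_constant card_lessThan exp_of_nat_mult)
  also have "\<dots> = exp (6 * real d)" by (simp flip: exp_add)
  finally show ?thesis .
qed

lemma dot_lattice_point:
  assumes "z \<in> lattice_ball d"
  shows "dot d (lattice_point d z) (lattice_point d z) \<le> 4"
proof -
  have "real_of_int (\<Sum>i<d. (z i)\<^sup>2) \<le> real_of_int (4 * int d)"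
    using assms by (simp only: of_int_le_iff lattice_ball_def mem_Collect_eq)
  then have 1: "(\<Sum>i<d. (real_of_int (z i))\<^sup>2) \<le> 4 * real d" by simp
  have "dot d (lattice_point d z) (lattice_point d z) = (\<Sum>i<d. (real_of_int (z i))\<^sup>2) / real d"
    by (simp add: dot_def lattice_point_def sum_divide_distrib power2_eq_square)
  then show ?thesis using 1 by (cases "d = 0") (simp_all add: divide_le_eq del: of_int_sum)
qed

text \<open>Rounding each coordinate up or down according to the sign of its coefficient can only increase
  a linear functional, so no covering argument is needed.\<close>

lemma lattice_dominates:
  assumes x: "dot d x x \<le> 1"
  obtains z where "z \<in> lattice_ball d" "dot d l x \<le> dot d l (lattice_point d z)"
proof (cases "d = 0")
  case True
  then have "(\<lambda>_. undefined) \<in> lattice_ball d" by (auto simp: lattice_ball_def)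
  then show ?thesis using that True by (simp add: dot_def)
next
  case False
  let ?y = "\<lambda>i. sqrt d * x i"
  define z where "z = (\<lambda>i\<in>{..<d}. if 0 \<le> l i then \<lceil>?y i\<rceil> else \<lfloor>?y i\<rfloor>)"
  have gen: "a\<^sup>2 \<le> 2 * b\<^sup>2 + 2 * (a - b)\<^sup>2" for a b :: real
    using zero_le_power2[of "a - 2 * b"] by (simp add: power2_eq_square algebra_simps)
  \<comment> \<open>Rounding moves a coordinate by at most 1. Summed, this gives 2 d |x|^2 + 2 d
    \<le> 4 d, the origin of the radius 2.\<close>
  have "(real_of_int (z i))\<^sup>2 \<le> 2 * (real d * (x i)\<^sup>2) + 2" if "i < d" for i
  proof -
    have "\<bar>real_of_int (z i) - ?y i\<bar> \<le> 1" using that unfolding z_def by simp linarith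
    then have "(real_of_int (z i) - ?y i)\<^sup>2 \<le> 1" by (simp add: abs_square_le_1)
    moreover have "(real_of_int (z i))\<^sup>2 \<le> 2 * (?y i)\<^sup>2 + 2 * (real_of_int (z i) - ?y i)\<^sup>2"
      by (rule gen)
    ultimately show ?thesis by (simp add: power_mult_distrib)
  qed
  then have "(\<Sum>i<d. (real_of_int (z i))\<^sup>2) \<le> (\<Sum>i<d. 2 * (real d * (x i)\<^sup>2) + 2)"
    by (intro sum_mono) simp
  also have "\<dots> = 2 * real d * dot d x x + 2 * real d"
    by (simp add: sum.distrib dot_def sum_distrib_left power2_eq_square mult_ac)
  also have "\<dots> \<le> 4 * real d" using mult_left_mono[OF x, of "2 * real d"] by simp
  finally have "real_of_int (\<Sum>i<d. (z i)\<^sup>2) \<le> real_of_int (4 * int d)" by simp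
  then have sq: "(\<Sum>i<d. (z i)\<^sup>2) \<le> 4 * int d" by (simp only: of_int_le_iff)
  have "z i \<in> {- 2 * int d..2 * int d}" if "i < d" for i
  proof -
    have "(z i)\<^sup>2 \<le> (\<Sum>i<d. (z i)\<^sup>2)" using that by (intro member_le_sum) auto
    also have "\<dots> \<le> 4 * int d * int d" using sq False by (smt (verit) mult_le_cancel_left1 of_nat_0_less_iff not_gr_zero)
    finally have "\<bar>z i\<bar>\<^sup>2 \<le> (2 * int d)\<^sup>2" by (simp add: power2_eq_square)
    then have "\<bar>z i\<bar> \<le> 2 * int d" by (rule power2_le_imp_le) simp
    then show ?thesis by auto
  qed
  then have "z \<in> lattice_ball d" using sq by (auto simp: lattice_ball_def z_def)
  moreover have "dot d l x \<le> dot d l (lattice_point d z)"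
    unfolding dot_def
  proof (rule sum_mono)
    fix i assume "i \<in> {..<d}"
    then have "l i * ?y i \<le> l i * real_of_int (z i)"
      by (cases "0 \<le> l i") (auto simp: z_def intro: mult_left_mono mult_left_mono_neg)
    then show "l i * x i \<le> l i * lattice_point d z i"
      using False by (simp add: lattice_point_def field_simps)
  qed
  ultimately show ?thesis by (rule that)
qed

section \<open>Multilinear bounds from lattice points\<close>

definition linear_form :: "nat \<Rightarrow> ((nat \<Rightarrow> real) \<Rightarrow> real) \<Rightarrow> bool" where
  "linear_form d f \<longleftrightarrow> (\<exists>l. \<forall>x. f x = dot d l x)"

lemma linear_form_dot: "linear_form d (\<lambda>x. dot d l x)" "linear_form d (\<lambda>x. dot d x l)"
  unfolding linear_form_def dot_def by (auto intro!: exI[of _ l] simp: mult.commute)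

lemma linear_form_scale: "linear_form d f \<Longrightarrow> linear_form d (\<lambda>x. c * f x)" "linear_form d f \<Longrightarrow> linear_form d (\<lambda>x. f x * c)"
proof -
  assume "linear_form d f"
  then obtain l where "\<And>x. f x = dot d l x" unfolding linear_form_def by blast
  then have "c * f x = dot d (\<lambda>i. c * l i) x" "f x * c = dot d (\<lambda>i. c * l i) x" for x
    by (simp_all add: dot_def sum_distrib_left mult_ac)
  then show "linear_form d (\<lambda>x. c * f x)" "linear_form d (\<lambda>x. f x * c)"
    unfolding linear_form_def by blast+
qed

lemma linear_form_divide: "linear_form d f \<Longrightarrow> linear_form d (\<lambda>x. f x / c)"
  using linear_form_scale(2)[of d f "inverse c"] by (simp add: divide_inverse)

lemma linear_form_add: "linear_form d f \<Longrightarrow> linear_form d g \<Longrightarrow> linear_form d (\<lambda>x. f x + g x)"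
proof -
  assume "linear_form d f" "linear_form d g"
  then obtain l m where "\<And>x. f x = dot d l x" "\<And>x. g x = dot d m x" unfolding linear_form_def by blast
  then have "f x + g x = dot d (\<lambda>i. l i + m i) x" for x
    by (simp add: dot_def sum.distrib distrib_right)
  then show ?thesis unfolding linear_form_def by blast
qed

lemma linear_form_diff: "linear_form d f \<Longrightarrow> linear_form d g \<Longrightarrow> linear_form d (\<lambda>x. f x - g x)"
  using linear_form_add[OF _ linear_form_scale(1)[of d g "- 1"]] by fastforce

lemma linear_form_sum: "(\<And>i. i \<in> I \<Longrightarrow> linear_form d (f i)) \<Longrightarrow> linear_form d (\<lambda>x. \<Sum>i\<in>I. f i x)"
proof (induction I rule: infinite_finite_induct)
  case (insert i I)
  then show ?case by (simp add: linear_form_add)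
qed (auto simp: linear_form_def dot_def intro!: exI[of _ "\<lambda>_. 0"])

lemma linear_form_coord: "p < d \<Longrightarrow> linear_form d (\<lambda>x. x p)"
  unfolding linear_form_def dot_def
  by (intro exI[of _ "\<lambda>i. if i = p then 1 else 0"]) (simp add: if_distrib[of "\<lambda>c. c * _"] sum.delta cong: if_cong)

lemma linear_form_design: "linear_form d (\<lambda>a. design_form d g a b i)" "linear_form d (\<lambda>b. design_form d g a b i)"
  unfolding design_form_def
  by (intro linear_form_sum linear_form_scale linear_form_coord; simp)+

lemma linear_form_defect:
  "linear_form d (\<lambda>a. design_defect n d g a b u v)" "linear_form d (\<lambda>b. design_defect n d g a b u v)"
  "linear_form d (\<lambda>u. design_defect n d g a b u v)" "linear_form d (\<lambda>v. design_defect n d g a b u v)"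
  unfolding design_defect_def
  by (intro linear_form_diff linear_form_add linear_form_divide linear_form_sum linear_form_scale
      linear_form_design linear_form_dot)+

text \<open>Domination by a lattice point bounds f on the unit ball; applying this to x / |x| and to
  its negative and rescaling gives the absolute value. The constant s is kept, so the arguments of a
  multilinear form can be treated one after the other.\<close>

lemma linear_form_bound:
  assumes f: "linear_form d f" and s: "\<And>z. z \<in> lattice_ball d \<Longrightarrow> \<bar>f (lattice_point d z)\<bar> \<le> s"
  shows "\<bar>f x\<bar> \<le> s * sqrt (dot d x x)"
proof -
  obtain l where l: "\<And>x. f x = dot d l x" using f unfolding linear_form_def by blast
  have *: "f x \<le> s" if x: "dot d x x \<le> 1" for x
  proof -
    obtain z where "z \<in> lattice_ball d" "dot d l x \<le> dot d l (lattice_point d z)"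
      using lattice_dominates[OF x] .
    then show ?thesis using s[of z] l by fastforce
  qed
  show ?thesis
  proof (cases "dot d x x = 0")
    case True
    then have "\<forall>i<d. x i = 0" by (simp add: dot_def sum_nonneg_eq_0_iff)
    then have "f x = 0" unfolding l dot_def by simp
    then show ?thesis using True by simp
  next
    case False
    let ?r = "sqrt (dot d x x)"
    have r: "0 < ?r" using False dot_nonneg[of d x] by simp
    have sc: "f (\<lambda>i. c * x i) = c * f x" for c
      unfolding l dot_def by (simp add: sum_distrib_left mult_ac)
    have nr: "dot d (\<lambda>i. c * x i) (\<lambda>i. c * x i) = c\<^sup>2 * dot d x x" for c
      by (simp add: dot_def sum_distrib_left power2_eq_square mult_ac)
    have "(1 / ?r)\<^sup>2 * dot d x x \<le> 1" "(- (1 / ?r))\<^sup>2 * dot d x x \<le> 1"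
      using False dot_nonneg[of d x] by (simp_all add: power_divide)
    then have "(1 / ?r) * f x \<le> s" "- (1 / ?r) * f x \<le> s"
      using *[of "\<lambda>i. (1 / ?r) * x i"] *[of "\<lambda>i. - (1 / ?r) * x i"] sc[of "1 / ?r"] sc[of "- (1 / ?r)"]
        nr[of "1 / ?r"] nr[of "- (1 / ?r)"] by simp_all
    then show ?thesis using r by (simp add: field_simps abs_le_iff)
  qed
qed

section \<open>Tail bounds at the scale sqrt (d / n)\<close>

lemma sampling_ratio:
  assumes "0 < d" "d \<le> n"
  shows "0 < sqrt (real d / real n)" "sqrt (real d / real n) \<le> 1"
    "real n * (sqrt (real d / real n))\<^sup>2 = real d"
    "real d / sqrt (real d / real n) = real n * sqrt (real d / real n)"
proof -
  have n: "0 < n" using assms by simp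
  show 1: "0 < sqrt (real d / real n)" using assms n by simp
  show "sqrt (real d / real n) \<le> 1" using assms n by simp
  show 2: "real n * (sqrt (real d / real n))\<^sup>2 = real d" using n by simp
  show "real d / sqrt (real d / real n) = real n * sqrt (real d / real n)"
    using 1 2 by (simp add: power2_eq_square divide_eq_eq mult.assoc)
qed

text \<open>With e = sqrt (d / n) \<le> 1, the parameter e / 256 and variance at most 64 give |t v|
  \<le> e / 4 \<le> 1/4. The quadratic term is then at most n e^2 / 4 = d / 4, well below the
  threshold 26 d.\<close>

lemma form_dev_tail:
  assumes d: "0 < d" "d \<le> n" and \<sigma>: "0 < \<sigma>" and v: "goe_var d c \<le> 64" and s: "\<bar>s\<bar> = (1::real)"
  shows "measure (sample_measure n d \<sigma>) {\<omega>\<in>space (sample_measure n d \<sigma>).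
    26 * real d \<le> s * sqrt (real d / real n) / 256 * form_dev n d (fst \<omega>) c} \<le> exp (- 25 * real d)"
proof -
  define e where "e = sqrt (real d / real n)"
  let ?v = "goe_var d c"
  note er = sampling_ratio[OF d, folded e_def]
  let ?t = "s * e / 256"
  have s2: "s\<^sup>2 = 1" using s by (metis one_power2 power2_abs)
  have tv: "\<bar>?t * ?v\<bar> \<le> 1/4"
  proof -
    have "e * ?v \<le> 1 * 64" using er(1,2) v goe_var_nonneg[of d c] by (intro mult_mono) auto
    then show ?thesis using s er(1) goe_var_nonneg[of d c] by (simp add: abs_mult mult.commute)
  qed
  have "(?t * ?v)\<^sup>2 = e\<^sup>2 * ?v\<^sup>2 / 65536" using s2 by (simp add: power_mult_distrib power_divide)
  also have "\<dots> \<le> e\<^sup>2 * 64\<^sup>2 / 65536"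
    using v goe_var_nonneg[of d c] by (intro divide_right_mono mult_left_mono power_mono) auto
  finally have "(?t * ?v)\<^sup>2 \<le> e\<^sup>2 / 16" by simp
  then have "4 * real n * (?t * ?v)\<^sup>2 \<le> 4 * real n * (e\<^sup>2 / 16)" by (intro mult_left_mono) auto
  also have "\<dots> = real d / 4" unfolding er(3)[symmetric] by simp
  finally have "4 * real n * (?t * ?v)\<^sup>2 - 26 * real d \<le> - 25 * real d" by simp
  then have "exp (4 * real n * (?t * ?v)\<^sup>2 - 26 * real d) \<le> exp (- 25 * real d)" by (rule exp_le_cancel_iff[THEN iffD2])
  with goe_square_tail[OF \<sigma> tv, of n "26 * real d"]
  show ?thesis unfolding form_dev_def e_def[symmetric] by (rule order_trans)
qed

text \<open>The parameter scales with 1 / \<sigma>, which makes the exponent dimensionless; with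
  variance 16 its quadratic term is again at most d / 4.\<close>

lemma noise_dev_tail:
  assumes d: "0 < d" "d \<le> n" and \<sigma>: "0 < \<sigma>" and v: "goe_var d c \<le> 16" and s: "\<bar>s\<bar> = (1::real)"
  shows "measure (sample_measure n d \<sigma>) {\<omega>\<in>space (sample_measure n d \<sigma>).
    26 * real d \<le> s * sqrt (real d / real n) / (8 * \<sigma>) * (\<Sum>i<n. snd \<omega> i * goe_form d c (fst \<omega>) i)} \<le> exp (- 25 * real d)"
proof -
  define e where "e = sqrt (real d / real n)"
  let ?v = "goe_var d c"
  note er = sampling_ratio[OF d, folded e_def]
  let ?t = "s * e / (8 * \<sigma>)"
  have s2: "s\<^sup>2 = 1" using s by (metis one_power2 power2_abs)
  have "?t\<^sup>2 * ?v * \<sigma>\<^sup>2 = e\<^sup>2 * ?v / 64" using s2 \<sigma> by (simp add: power_mult_distrib power_divide)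
  also have "\<dots> \<le> e\<^sup>2 * 16 / 64"
    using v by (intro divide_right_mono mult_left_mono) auto
  finally have t: "?t\<^sup>2 * ?v * \<sigma>\<^sup>2 \<le> e\<^sup>2 / 4" by simp
  have "e\<^sup>2 \<le> 1" using er(1,2) by (intro power_le_one) auto
  then have small: "?t\<^sup>2 * ?v * \<sigma>\<^sup>2 \<le> 1/2" using t by linarith
  have "real n * (?t\<^sup>2 * ?v * \<sigma>\<^sup>2) \<le> real n * (e\<^sup>2 / 4)" by (intro mult_left_mono t) simp
  also have "\<dots> = real d / 4" unfolding er(3)[symmetric] by simp
  finally have "real n * (?t\<^sup>2 * ?v * \<sigma>\<^sup>2) - 26 * real d \<le> - 25 * real d" by simp
  then have "exp (real n * (?t\<^sup>2 * ?v * \<sigma>\<^sup>2) - 26 * real d) \<le> exp (- 25 * real d)" by (rule exp_le_cancel_iff[THEN iffD2])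
  with noise_form_tail[OF \<sigma> small, of n "26 * real d"]
  show ?thesis unfolding e_def[symmetric] by (rule order_trans)
qed

lemma measurable_form_dev: "(\<lambda>\<omega>. form_dev n d (fst \<omega>) c) \<in> borel_measurable (sample_measure n d \<sigma>)"
  unfolding form_dev_def
  by (intro borel_measurable_sum borel_measurable_diff borel_measurable_power borel_measurable_const
      measurable_sample_form) simp

lemma measurable_noise_dev:
  "(\<lambda>\<omega>. \<Sum>i<n. snd \<omega> i * goe_form d c (fst \<omega>) i) \<in> borel_measurable (sample_measure n d \<sigma>)"
  by (intro borel_measurable_sum borel_measurable_times measurable_sample_form measurable_sample_noise) simp_all

definition design_bounded :: "nat \<Rightarrow> nat \<Rightarrow> real \<Rightarrow> (nat \<times> nat \<times> nat \<Rightarrow> real) \<Rightarrow> bool" where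
  "design_bounded n d \<epsilon> g \<longleftrightarrow> (\<forall>a b u v. \<bar>design_defect n d g a b u v\<bar>
    \<le> \<epsilon> * sqrt (dot d a a) * sqrt (dot d b b) * sqrt (dot d u u) * sqrt (dot d v v))"

definition noise_bounded :: "nat \<Rightarrow> nat \<Rightarrow> real \<Rightarrow> (nat \<times> nat \<times> nat \<Rightarrow> real) \<times> (nat \<Rightarrow> real) \<Rightarrow> bool" where
  "noise_bounded n d \<nu> \<omega> \<longleftrightarrow> (\<forall>a b. \<bar>(\<Sum>i<n. snd \<omega> i * design_form d (fst \<omega>) a b i) / sqrt n\<bar>
    \<le> \<nu> * sqrt (dot d a a) * sqrt (dot d b b))"

text \<open>Tails of order exp (- 25 d) beat the union over exp (24 d) quadruples of lattice points; the
  constant is 6656 = 26 * 256, from the exponent 26 d and the Chernoff parameter sqrt (d / n) / 256.\<close>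

theorem good_event:
  assumes d: "0 < d" "d \<le> n" and \<sigma>: "0 < \<sigma>"
  obtains E where "E \<in> sets (sample_measure n d \<sigma>)" "1 - 6 * exp (- real d) \<le> measure (sample_measure n d \<sigma>) E"
    "\<And>\<omega>. \<omega> \<in> E \<Longrightarrow> design_bounded n d (6656 * sqrt (real d / real n)) (fst \<omega>)"
    "\<And>\<omega>. \<omega> \<in> E \<Longrightarrow> noise_bounded n d (6656 * \<sigma> * sqrt d) \<omega>"
proof -
  let ?S = "sample_measure n d \<sigma>" and ?e = "sqrt (real d / real n)" and ?p = "lattice_point d"
  interpret prob_space ?S using \<sigma> by (rule prob_space_sample)
  note e = sampling_ratio[OF d]
  define B1 where "B1 s c = {\<omega>\<in>space ?S. 26 * real d \<le> s * ?e / 256 * form_dev n d (fst \<omega>) c}" for s c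
  define B2 where "B2 s c = {\<omega>\<in>space ?S. 26 * real d \<le> s * ?e / (8 * \<sigma>) * (\<Sum>i<n. snd \<omega> i * goe_form d c (fst \<omega>) i)}" for s c
  have B1s [simp]: "B1 s c \<in> sets ?S" for s c
    unfolding B1_def by (intro borel_measurable_le[of "\<lambda>_. _"] borel_measurable_times borel_measurable_const measurable_form_dev)
  have B2s [simp]: "B2 s c \<in> sets ?S" for s c
    unfolding B2_def by (intro borel_measurable_le[of "\<lambda>_. _"] borel_measurable_times borel_measurable_const measurable_noise_dev)
  define c where "c a b = outer_coeff (?p a) (?p b)" for a b
  \<comment> \<open>Six bad events per quadruple: two signs for each of the two polarised forms and
    for the noise form.\<close>
  define B where "B = (\<lambda>(a, b, u, v).
    (B1 1 (\<lambda>p. c a b p + c u v p) \<union> B1 (- 1) (\<lambda>p. c a b p + c u v p)) \<union>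
    (B1 1 (\<lambda>p. c a b p - c u v p) \<union> B1 (- 1) (\<lambda>p. c a b p - c u v p)) \<union> (B2 1 (c a b) \<union> B2 (- 1) (c a b)))"
  define I where "I = lattice_ball d \<times> lattice_ball d \<times> lattice_ball d \<times> lattice_ball d"
  define E where "E = space ?S - (\<Union>z\<in>I. B z)"
  have finI: "finite I" by (simp add: I_def finite_lattice_ball)
  have Bs: "B z \<in> sets ?S" for z by (cases z) (simp only: B_def split, intro sets.Un B1s B2s)
  have Es: "E \<in> sets ?S" unfolding E_def using finI Bs by (intro sets.Diff sets.finite_UN) auto
  have Bz: "prob (B z) \<le> 6 * exp (- 25 * real d)" if zI: "z \<in> I" for z
  proof -
    obtain a b u v where z: "z = (a, b, u, v)" by (cases z)
    have l: "a \<in> lattice_ball d" "b \<in> lattice_ball d" "u \<in> lattice_ball d" "v \<in> lattice_ball d" using zI by (auto simp: I_def z)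
    have v16: "goe_var d (c a b) \<le> 16" "goe_var d (c u v) \<le> 16"
      unfolding c_def by (intro goe_var_outer_le dot_lattice_point l)+
    note v64 = goe_var_pm_le[OF v16]
    have un: "prob (X \<union> Y) \<le> x + y" if "X \<in> sets ?S" "Y \<in> sets ?S" "prob X \<le> x" "prob Y \<le> y" for X Y x y
      using measure_Un_le[OF that(1,2)] that(3,4) by linarith
    have "prob (B z) \<le> (exp (- 25 * real d) + exp (- 25 * real d)) + (exp (- 25 * real d) + exp (- 25 * real d))
        + (exp (- 25 * real d) + exp (- 25 * real d))"
      unfolding B_def z split
      by (intro un sets.Un B1s B2s; unfold B1_def B2_def; intro form_dev_tail noise_dev_tail d \<sigma> v64 v16; simp)
    then show ?thesis by simp
  qed
  have "prob (\<Union>z\<in>I. B z) \<le> (\<Sum>z\<in>I. prob (B z))"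
    using finI Bs by (intro finite_measure_subadditive_finite) auto
  also have "\<dots> \<le> (\<Sum>z\<in>I. 6 * exp (- 25 * real d))" by (intro sum_mono Bz)
  also have "\<dots> = (real (card (lattice_ball d)))^4 * (6 * exp (- 25 * real d))"
    by (simp add: I_def card_cartesian_product power4_eq_xxxx mult.assoc)
  also have "\<dots> \<le> (exp (6 * real d))^4 * (6 * exp (- 25 * real d))"
    by (intro mult_right_mono power_mono card_lattice_ball_le) auto
  also have "(exp (6 * real d))^4 = exp (24 * real d)" by (simp flip: exp_of_nat_mult)
  also have "exp (24 * real d) * (6 * exp (- 25 * real d)) = 6 * exp (- real d)"
    by (simp flip: exp_add)
  finally have pU: "prob (\<Union>z\<in>I. B z) \<le> 6 * exp (- real d)" .
  have "prob E = 1 - prob (\<Union>z\<in>I. B z)"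
    unfolding E_def using finI Bs by (intro prob_compl sets.finite_UN) auto
  then have pE: "1 - 6 * exp (- real d) \<le> prob E" using pU by simp
  have dev: "\<bar>X\<bar> \<le> 6656 * real n * ?e" if "\<not> 26 * real d \<le> 1 * ?e / 256 * X" "\<not> 26 * real d \<le> - 1 * ?e / 256 * X" for X
  proof -
    have "\<bar>?e * X\<bar> \<le> 6656 * real d" using that by (simp add: abs_le_iff)
    then have "?e * \<bar>X\<bar> \<le> 6656 * real d" using e(1) by (simp add: abs_mult)
    then have "\<bar>X\<bar> \<le> 6656 * (real d / ?e)" using e(1) by (simp add: field_simps)
    then show ?thesis unfolding e(4) by simp
  qed
  have dev2: "\<bar>X\<bar> \<le> 6656 * \<sigma> * (real n * ?e)"
    if "\<not> 26 * real d \<le> 1 * ?e / (8 * \<sigma>) * X" "\<not> 26 * real d \<le> - 1 * ?e / (8 * \<sigma>) * X" for X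
  proof -
    have "\<bar>?e / (8 * \<sigma>) * X\<bar> \<le> 26 * real d" using that by (simp add: abs_le_iff)
    then have "?e / (8 * \<sigma>) * \<bar>X\<bar> \<le> 26 * real d" using e(1) \<sigma> by (simp add: abs_mult)
    then have "\<bar>X\<bar> \<le> 208 * \<sigma> * (real d / ?e)" using e(1) \<sigma> by (simp add: field_simps)
    \<comment> \<open>The noise constant 208 = 26 * 8 is raised so that design and noise share one
      constant.\<close>
    also have "\<dots> \<le> 6656 * \<sigma> * (real d / ?e)" using e(1) \<sigma> by (intro mult_right_mono) auto
    finally show ?thesis unfolding e(4) .
  qed
  have point1: "\<bar>design_defect n d (fst \<omega>) (?p a) (?p b) (?p u) (?p v)\<bar> \<le> 6656 * ?e"
    if "\<omega> \<in> E" "a \<in> lattice_ball d" "b \<in> lattice_ball d" "u \<in> lattice_ball d" "v \<in> lattice_ball d" for \<omega> a b u v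
  proof -
    have "\<omega> \<in> space ?S" "\<omega> \<notin> B (a, b, u, v)" using that unfolding E_def I_def by auto
    then have "\<bar>form_dev n d (fst \<omega>) (\<lambda>p. c a b p + c u v p)\<bar> \<le> 6656 * real n * ?e"
      "\<bar>form_dev n d (fst \<omega>) (\<lambda>p. c a b p - c u v p)\<bar> \<le> 6656 * real n * ?e"
      by (intro dev; simp add: B_def B1_def)+
    moreover have "4 * real n * design_defect n d (fst \<omega>) (?p a) (?p b) (?p u) (?p v) =
        form_dev n d (fst \<omega>) (\<lambda>p. c a b p + c u v p) - form_dev n d (fst \<omega>) (\<lambda>p. c a b p - c u v p)"
      unfolding c_def using d by (intro design_defect_polar) auto
    \<comment> \<open>Two deviations of size 6656 n sqrt (d / n), divided by 4 n, leave half of the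
      claimed constant.\<close>
    ultimately have "\<bar>4 * real n * design_defect n d (fst \<omega>) (?p a) (?p b) (?p u) (?p v)\<bar> \<le> 4 * real n * (3328 * ?e)"
      by linarith
    then have "\<bar>design_defect n d (fst \<omega>) (?p a) (?p b) (?p u) (?p v)\<bar> \<le> 3328 * ?e"
      using d by (simp add: abs_mult)
    then show ?thesis using e(1) by linarith
  qed
  have point2: "\<bar>(\<Sum>i<n. snd \<omega> i * design_form d (fst \<omega>) (?p a) (?p b) i) / sqrt n\<bar> \<le> 6656 * \<sigma> * sqrt d"
    if "\<omega> \<in> E" "a \<in> lattice_ball d" "b \<in> lattice_ball d" for \<omega> a b
  proof -
    \<comment> \<open>The noise events depend only on the first pair, so any quadruple that starts
      with it serves.\<close>
    have "\<omega> \<in> space ?S" "\<omega> \<notin> B (a, b, a, b)" using that unfolding E_def I_def by auto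
    then have "\<bar>\<Sum>i<n. snd \<omega> i * goe_form d (c a b) (fst \<omega>) i\<bar> \<le> 6656 * \<sigma> * (real n * ?e)"
      by (intro dev2; simp add: B_def B2_def)
    also have "real n * ?e = sqrt n * sqrt d" using d by (simp add: real_sqrt_divide field_simps)
    finally show ?thesis using d by (simp add: design_form_eq c_def field_simps)
  qed
  \<comment> \<open>From lattice points to all vectors, one of the four arguments at a time.\<close>
  have bound1: "design_bounded n d (6656 * ?e) (fst \<omega>)" if "\<omega> \<in> E" for \<omega>
    unfolding design_bounded_def
    by (intro allI linear_form_bound[OF linear_form_defect(4)] linear_form_bound[OF linear_form_defect(3)]
        linear_form_bound[OF linear_form_defect(2)] linear_form_bound[OF linear_form_defect(1)] point1 that)
  have lf: "linear_form d (\<lambda>a. (\<Sum>i<n. snd \<omega> i * design_form d (fst \<omega>) a b i) / sqrt n)"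
    "linear_form d (\<lambda>b. (\<Sum>i<n. snd \<omega> i * design_form d (fst \<omega>) a b i) / sqrt n)" for \<omega> a b
    by (intro linear_form_divide linear_form_sum linear_form_scale linear_form_design)+
  have bound2: "noise_bounded n d (6656 * \<sigma> * sqrt d) \<omega>" if "\<omega> \<in> E" for \<omega>
    unfolding noise_bounded_def
    by (intro allI linear_form_bound[OF lf(2)] linear_form_bound[OF lf(1)] point2 that)
  show ?thesis by (rule that[OF Es pE bound1 bound2])
qed

section \<open>Finitely supported matrices as a real inner product algebra\<close>

text \<open>Matrices of all sizes live in one type: multiplication is total and associative, an m by n matrix
  is one fixed by the truncations idm m on the left and idm n on the right, and a vector is a matrix
  supported on column 0. The inner product is the Frobenius one, so a bound on the quadratic form of
  R for all vectors extends to inner X (R * X) for matrices X.\<close>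

typedef fmat = "{f :: nat \<Rightarrow> nat \<Rightarrow> real. \<exists>N. \<forall>i j. N \<le> i \<or> N \<le> j \<longrightarrow> f i j = 0}"
  morphisms ent Abs_fmat
  by (rule exI[of _ "\<lambda>_ _. 0"]) simp

definition supp_le :: "nat \<Rightarrow> fmat \<Rightarrow> bool" where
  "supp_le N A \<longleftrightarrow> (\<forall>i j. N \<le> i \<or> N \<le> j \<longrightarrow> ent A i j = 0)"

lemma ex_supp_le: "\<exists>N. supp_le N A"
  using ent[of A] unfolding supp_le_def by simp

lemma supp_le_mono: "supp_le N A \<Longrightarrow> N \<le> N' \<Longrightarrow> supp_le N' A"
  unfolding supp_le_def by (meson order_trans)

lemma ex_supp_le2: "\<exists>N. supp_le N A \<and> supp_le N B"
  using ex_supp_le[of A] ex_supp_le[of B] supp_le_mono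
  by (metis max.cobounded1 max.cobounded2)

lemma ex_supp_le3: "\<exists>N. supp_le N A \<and> supp_le N B \<and> supp_le N C"
  using ex_supp_le2[of A B] ex_supp_le[of C] supp_le_mono
  by (metis max.cobounded1 max.cobounded2)

lemma supp_leD: "supp_le N A \<Longrightarrow> N \<le> i \<or> N \<le> j \<Longrightarrow> ent A i j = 0"
  unfolding supp_le_def by blast

lemma supp_le_less: "supp_le N A \<Longrightarrow> ent A i j \<noteq> 0 \<Longrightarrow> i < N \<and> j < N"
  unfolding supp_le_def by (meson not_le)

lemma fmat_eqI: "(\<And>i j. ent A i j = ent B i j) \<Longrightarrow> A = B"
  by (simp add: ent_inject[symmetric] fun_eq_iff)

lemma ent_Abs_fmat:
  assumes "\<And>i j. N \<le> i \<or> N \<le> j \<Longrightarrow> f i j = 0"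
  shows "ent (Abs_fmat f) = f"
  by (rule Abs_fmat_inverse) (use assms in auto)

text \<open>The sum runs over the support of row i, which is finite, so no dimension has to be
  chosen; \<open>fmul_fun_eq\<close> recovers the sum up to any support bound.\<close>

definition fmul_fun :: "fmat \<Rightarrow> fmat \<Rightarrow> nat \<Rightarrow> nat \<Rightarrow> real" where
  "fmul_fun A B i j = (\<Sum>k\<in>{k. ent A i k \<noteq> 0}. ent A i k * ent B k j)"

instantiation fmat :: "{zero, plus, uminus, minus, times, scaleR}"
begin
definition "0 = Abs_fmat (\<lambda>_ _. 0)"
definition "A + B = Abs_fmat (\<lambda>i j. ent A i j + ent B i j)"
definition "A - B = Abs_fmat (\<lambda>i j. ent A i j - ent B i j)"
definition "- A = Abs_fmat (\<lambda>i j. - ent A i j)"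
definition "A * B = Abs_fmat (fmul_fun A B)"
definition "c *\<^sub>R A = Abs_fmat (\<lambda>i j. c * ent A i j)"
instance ..
end

lemma fmul_fun_eq:
  assumes "supp_le N A"
  shows "fmul_fun A B i j = (\<Sum>k<N. ent A i k * ent B k j)"
  unfolding fmul_fun_def
  by (rule sum.mono_neutral_left) (use supp_le_less[OF assms] in auto)

lemma ent_mult:
  assumes "supp_le N A"
  shows "ent (A * B) i j = (\<Sum>k<N. ent A i k * ent B k j)"
proof -
  obtain M where M: "supp_le M A" "supp_le M B" using ex_supp_le2 by blast
  have "ent (Abs_fmat (fmul_fun A B)) = fmul_fun A B"
    by (rule ent_Abs_fmat[of M]) (auto simp: fmul_fun_eq[OF M(1)] supp_leD[OF M(1)] supp_leD[OF M(2)])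
  then show ?thesis by (simp add: times_fmat_def fmul_fun_eq[OF assms])
qed

lemma ent_mult2:
  assumes "supp_le N B"
  shows "ent (A * B) i j = (\<Sum>k<N. ent A i k * ent B k j)"
proof -
  obtain M where M: "supp_le M A" "supp_le M B" using ex_supp_le2 by blast
  have "(\<Sum>k<max M N. ent A i k * ent B k j) = (\<Sum>k<N. ent A i k * ent B k j)"
    by (rule sum.mono_neutral_right) (auto simp: supp_leD[OF assms])
  then show ?thesis using ent_mult[OF supp_le_mono[OF M(1), of "max M N"]] by simp
qed

lemma ent_zero [simp]: "ent 0 i j = 0"
  unfolding zero_fmat_def by (subst ent_Abs_fmat[of 0]) auto

lemma ent_add [simp]: "ent (A + B) i j = ent A i j + ent B i j"
proof -
  obtain M where M: "supp_le M A" "supp_le M B" using ex_supp_le2 by blast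
  show ?thesis unfolding plus_fmat_def
    by (subst ent_Abs_fmat[of M]) (auto simp: supp_leD[OF M(1)] supp_leD[OF M(2)])
qed

lemma ent_diff [simp]: "ent (A - B) i j = ent A i j - ent B i j"
proof -
  obtain M where M: "supp_le M A" "supp_le M B" using ex_supp_le2 by blast
  show ?thesis unfolding minus_fmat_def
    by (subst ent_Abs_fmat[of M]) (auto simp: supp_leD[OF M(1)] supp_leD[OF M(2)])
qed

lemma ent_uminus [simp]: "ent (- A) i j = - ent A i j"
proof -
  obtain M where M: "supp_le M A" using ex_supp_le by blast
  show ?thesis unfolding uminus_fmat_def
    by (subst ent_Abs_fmat[of M]) (auto simp: supp_leD[OF M])
qed

lemma ent_scaleR [simp]: "ent (c *\<^sub>R A) i j = c * ent A i j"
proof -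
  obtain M where M: "supp_le M A" using ex_supp_le by blast
  show ?thesis unfolding scaleR_fmat_def
    by (subst ent_Abs_fmat[of M]) (auto simp: supp_leD[OF M])
qed

lemma supp_le_mult: "supp_le N A \<Longrightarrow> supp_le N B \<Longrightarrow> supp_le N (A * B)"
  by (subst supp_le_def) (auto simp: ent_mult supp_leD)

lemma fmat_mult_assoc: "(A * B) * C = A * (B * C)" for A B C :: fmat
proof -
  obtain N where N: "supp_le N A" "supp_le N B" "supp_le N C" using ex_supp_le3 by blast
  show ?thesis
  proof (rule fmat_eqI)
    fix i j
    have "ent ((A * B) * C) i j = (\<Sum>k<N. \<Sum>l<N. ent A i l * ent B l k * ent C k j)"
      by (simp add: ent_mult2[OF N(3)] ent_mult[OF N(1)] sum_distrib_right)
    also have "\<dots> = (\<Sum>l<N. \<Sum>k<N. ent A i l * ent B l k * ent C k j)"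
      by (rule sum.swap)
    also have "\<dots> = ent (A * (B * C)) i j"
      by (simp add: ent_mult[OF N(1)] ent_mult[OF N(2)] sum_distrib_left mult.assoc)
    finally show "ent ((A * B) * C) i j = ent (A * (B * C)) i j" .
  qed
qed

instance fmat :: real_algebra
proof
  fix A B C :: fmat and a b :: real
  obtain N where N: "supp_le N A" "supp_le N B" "supp_le N C" using ex_supp_le3 by blast
  show "A * B * C = A * (B * C)" by (rule fmat_mult_assoc)
  show "(A + B) * C = A * C + B * C"
    by (rule fmat_eqI) (simp add: ent_mult2[OF N(3)] algebra_simps sum.distrib)
  show "A * (B + C) = A * B + A * C"
    by (rule fmat_eqI) (simp add: ent_mult[OF N(1)] algebra_simps sum.distrib)
  show "(a *\<^sub>R A) * B = a *\<^sub>R (A * B)"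
    by (rule fmat_eqI) (simp add: ent_mult2[OF N(2)] sum_distrib_left mult.assoc)
  show "A * (a *\<^sub>R B) = a *\<^sub>R (A * B)"
    by (rule fmat_eqI) (simp add: ent_mult[OF N(1)] sum_distrib_left mult_ac)
qed (auto intro!: fmat_eqI simp: algebra_simps)

instantiation fmat :: real_inner
begin
definition inner_fmat :: "fmat \<Rightarrow> fmat \<Rightarrow> real" where
  "inner_fmat A B = (\<Sum>p\<in>{(i,j). ent A i j \<noteq> 0}. ent A (fst p) (snd p) * ent B (fst p) (snd p))"
definition norm_fmat :: "fmat \<Rightarrow> real" where "norm_fmat A = sqrt (inner A A)"
definition dist_fmat :: "fmat \<Rightarrow> fmat \<Rightarrow> real" where "dist_fmat A B = norm (A - B)"
definition sgn_fmat :: "fmat \<Rightarrow> fmat" where "sgn_fmat A = inverse (norm A) *\<^sub>R A"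
definition uniformity_fmat :: "(fmat \<times> fmat) filter" where
  "uniformity_fmat = (INF e\<in>{0 <..}. principal {(x, y). dist x y < e})"
definition open_fmat :: "fmat set \<Rightarrow> bool" where
  "open_fmat S = (\<forall>x\<in>S. \<forall>\<^sub>F (x', y) in uniformity. x' = x \<longrightarrow> y \<in> S)"

lemma inner_fmat_eq:
  assumes "supp_le N A"
  shows "inner A B = (\<Sum>i<N. \<Sum>j<N. ent A i j * ent B i j)"
proof -
  have "inner A B = (\<Sum>p\<in>{..<N}\<times>{..<N}. ent A (fst p) (snd p) * ent B (fst p) (snd p))"
    unfolding inner_fmat_def
    by (rule sum.mono_neutral_left) (use supp_le_less[OF assms] in auto)
  then show ?thesis by (simp add: sum.cartesian_product case_prod_unfold)
qed

instance
proof
  fix A B C :: fmat and c :: real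
  obtain N where N: "supp_le N A" "supp_le N B" "supp_le N C" using ex_supp_le3 by blast
  have N': "supp_le N (A + B)" "supp_le N (c *\<^sub>R A)" using N by (auto simp: supp_le_def)
  show "inner A B = inner B A" using N by (simp add: inner_fmat_eq mult.commute)
  show "inner (A + B) C = inner A C + inner B C"
    using N N' by (simp add: inner_fmat_eq algebra_simps sum.distrib)
  show "inner (c *\<^sub>R A) B = c * inner A B"
    using N N' by (simp add: inner_fmat_eq sum_distrib_left mult.assoc)
  show pos: "0 \<le> inner A A"
    using N by (auto simp: inner_fmat_eq intro!: sum_nonneg)
  show "(inner A A = 0) = (A = 0)"
  proof
    assume "inner A A = 0"
    then have "\<forall>i<N. \<forall>j<N. ent A i j = 0"
      using N by (auto simp: inner_fmat_eq sum_nonneg_eq_0_iff sum_nonneg)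
    then show "A = 0"
      using N(1) by (intro fmat_eqI) (metis ent_zero not_le supp_leD)
  qed (simp add: inner_fmat_def)
qed (auto simp: norm_fmat_def dist_fmat_def sgn_fmat_def uniformity_fmat_def open_fmat_def)
end

section \<open>Transposes, truncated identities and columns\<close>

definition ft :: "fmat \<Rightarrow> fmat"  ("(_\<^sup>t)" [1000] 1000) where
  "A\<^sup>t = Abs_fmat (\<lambda>i j. ent A j i)"

lemma ent_ft [simp]: "ent (A\<^sup>t) i j = ent A j i"
proof -
  obtain M where M: "supp_le M A" using ex_supp_le by blast
  show ?thesis unfolding ft_def
    by (subst ent_Abs_fmat[of M]) (auto simp: supp_leD[OF M])
qed

lemma supp_le_ft [simp]: "supp_le N (A\<^sup>t) = supp_le N A"
  unfolding supp_le_def by auto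

lemma ft_ft [simp]: "A\<^sup>t\<^sup>t = A"
  by (rule fmat_eqI) simp

lemma ft_linear [simp]:
  "0\<^sup>t = 0" "(A + B)\<^sup>t = A\<^sup>t + B\<^sup>t" "(A - B)\<^sup>t = A\<^sup>t - B\<^sup>t" "(- A)\<^sup>t = - A\<^sup>t"
  "(c *\<^sub>R A)\<^sup>t = c *\<^sub>R A\<^sup>t"
  by (auto intro!: fmat_eqI)

lemma ft_mult [simp]: "(A * B)\<^sup>t = B\<^sup>t * A\<^sup>t"
proof -
  obtain N where N: "supp_le N A" using ex_supp_le by blast
  then have N': "supp_le N (A\<^sup>t)" by simp
  show ?thesis
    by (rule fmat_eqI) (simp add: ent_mult[OF N] ent_mult2[OF N'] mult.commute)
qed

lemma ft_eq_0_iff [simp]: "A\<^sup>t = 0 \<longleftrightarrow> A = 0"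
  by (metis ft_ft ft_linear(1))

lemma inner_ft [simp]: "inner (A\<^sup>t) (B\<^sup>t) = inner A B"
proof -
  obtain N where N: "supp_le N A" "supp_le N B" using ex_supp_le2 by blast
  then show ?thesis by (simp add: inner_fmat_eq) (rule sum.swap)
qed

lemma norm_ft [simp]: "norm (A\<^sup>t) = norm A"
  by (simp add: norm_eq_sqrt_inner)

lemma inner_mult_left: "inner (A * B) C = inner B (A\<^sup>t * C)"
proof -
  obtain N where N: "supp_le N A" "supp_le N B" "supp_le N C" using ex_supp_le3 by blast
  have "inner (A * B) C = (\<Sum>i<N. \<Sum>j<N. \<Sum>k<N. ent A i k * ent B k j * ent C i j)"
    by (simp add: inner_fmat_eq[OF supp_le_mult[OF N(1,2)]] ent_mult[OF N(1)] sum_distrib_right)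
  also have "\<dots> = (\<Sum>i<N. \<Sum>k<N. \<Sum>j<N. ent A i k * ent B k j * ent C i j)"
    by (intro sum.cong refl sum.swap)
  also have "\<dots> = (\<Sum>k<N. \<Sum>i<N. \<Sum>j<N. ent A i k * ent B k j * ent C i j)"
    by (rule sum.swap)
  also have "\<dots> = (\<Sum>k<N. \<Sum>j<N. \<Sum>i<N. ent A i k * ent B k j * ent C i j)"
    by (intro sum.cong refl sum.swap)
  also have "\<dots> = inner B (A\<^sup>t * C)"
    using N by (simp add: inner_fmat_eq[OF N(2)] ent_mult[of N] sum_distrib_left mult_ac)
  finally show ?thesis .
qed

lemma inner_mult_right: "inner (A * B) C = inner A (C * B\<^sup>t)"
  by (metis ft_ft ft_mult inner_ft inner_mult_left)

definition idm :: "nat \<Rightarrow> fmat" where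
  "idm n = Abs_fmat (\<lambda>i j. if i = j \<and> i < n then 1 else 0)"

lemma ent_idm [simp]: "ent (idm n) i j = (if i = j \<and> i < n then 1 else 0)"
  unfolding idm_def by (subst ent_Abs_fmat[of n]) auto

lemma supp_le_idm: "supp_le n (idm n)"
  by (auto simp: supp_le_def)

lemma ft_idm [simp]: "(idm n)\<^sup>t = idm n"
  by (rule fmat_eqI) auto

lemma ent_idm_mult [simp]: "ent (idm n * A) i j = (if i < n then ent A i j else 0)"
proof -
  have "ent (idm n * A) i j = (\<Sum>k<n. if k = i then (if i < n then ent A i j else 0) else 0)"
    unfolding ent_mult[OF supp_le_idm] by (rule sum.cong) auto
  then show ?thesis by (simp add: sum.delta)
qed

lemma ent_mult_idm [simp]: "ent (A * idm n) i j = (if j < n then ent A i j else 0)"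
proof -
  have "A * idm n = (idm n * A\<^sup>t)\<^sup>t" by simp
  then show ?thesis by (simp only: ent_ft ent_idm_mult)
qed

lemma idm_mult_idm [simp]: "idm n * idm n = idm n"
  by (rule fmat_eqI) auto

lemma idm_mult_idm_assoc [simp]: "idm n * (idm n * A) = idm n * A"
  by (simp add: mult.assoc[symmetric])

definition ecol :: "nat \<Rightarrow> fmat" where
  "ecol j = Abs_fmat (\<lambda>i k. if i = j \<and> k = 0 then 1 else 0)"

lemma ent_ecol [simp]: "ent (ecol j) i k = (if i = j \<and> k = 0 then 1 else 0)"
  unfolding ecol_def by (subst ent_Abs_fmat[of "Suc j"]) auto

lemma supp_le_ecol: "supp_le (Suc j) (ecol j)"
  by (auto simp: supp_le_def)

lemma ent_mult_ecol [simp]: "ent (A * ecol j) i k = (if k = 0 then ent A i j else 0)"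
  unfolding ent_mult2[OF supp_le_ecol] by simp

lemma ecol_idm [simp]: "ecol j * idm (Suc 0) = ecol j"
  by (rule fmat_eqI) auto

lemma ent_sum [simp]: "ent (sum f I) i j = (\<Sum>k\<in>I. ent (f k) i j)"
  by (induction I rule: infinite_finite_induct) auto

lemma ft_sum [simp]: "(sum f I)\<^sup>t = (\<Sum>k\<in>I. (f k)\<^sup>t)"
  by (induction I rule: infinite_finite_induct) auto

definition is_col :: "fmat \<Rightarrow> bool" where "is_col x \<longleftrightarrow> x * idm (Suc 0) = x"

lemma is_col_mult: "is_col x \<Longrightarrow> is_col (A * x)"
  by (simp add: is_col_def mult.assoc)

lemma is_col_ecol: "is_col (ecol j)"
  by (simp add: is_col_def)

lemma is_col_ft: "is_col x \<Longrightarrow> idm (Suc 0) * x\<^sup>t = x\<^sup>t"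
  by (metis ft_idm ft_mult is_col_def)

lemma ent_is_col: "is_col x \<Longrightarrow> j > 0 \<Longrightarrow> ent x i j = 0"
  by (metis ent_mult_idm is_col_def less_Suc0 not_gr_zero)

text \<open>A 1 by 1 matrix is a multiple of \<open>idm (Suc 0)\<close>; this is how scalars appear
  inside the algebra.\<close>

lemma is_col_ft_mult:
  assumes "is_col x" "is_col y"
  shows "x\<^sup>t * y = inner x y *\<^sub>R idm (Suc 0)"
proof (rule fmat_eqI)
  fix i j
  obtain N where N: "supp_le N x" "supp_le N y" using ex_supp_le2 by blast
  then have N': "supp_le (Suc N) x" "supp_le (Suc N) y" using supp_le_mono by auto
  have sp: "supp_le (Suc N) (x\<^sup>t)" using N' by simp
  have "inner x y = (\<Sum>k<Suc N. ent x k 0 * ent y k 0)"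
    unfolding inner_fmat_eq[OF N'(1)] sum.lessThan_Suc_shift[where n=N]
    by (simp add: ent_is_col[OF assms(1)])
  then show "ent (x\<^sup>t * y) i j = ent (inner x y *\<^sub>R idm (Suc 0)) i j"
    unfolding ent_mult[OF sp] using assms
    by (cases "i = 0"; cases "j = 0") (auto simp: ent_is_col)
qed

lemma ent_col_mult_ft:
  assumes "is_col x"
  shows "ent (x * y\<^sup>t) i j = ent x i 0 * ent y j 0"
proof -
  obtain N where N: "supp_le N x" using ex_supp_le by blast
  then have N': "supp_le (Suc N) x" using supp_le_mono by auto
  show ?thesis
    unfolding ent_mult[OF N'] sum.lessThan_Suc_shift by (simp add: ent_is_col[OF assms])
qed

lemma sum_ecol_ecol: "(\<Sum>j<n. ecol j * (ecol j)\<^sup>t) = idm n"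
proof (rule fmat_eqI)
  fix i k
  have "ent (ecol j * (ecol j)\<^sup>t) i k = (if j = i then (if i = k then 1 else 0) else 0)" for j
    unfolding ent_col_mult_ft[OF is_col_ecol] by auto
  then show "ent (\<Sum>j<n. ecol j * (ecol j)\<^sup>t) i k = ent (idm n) i k" by (simp add: sum.delta)
qed

text \<open>Inserting the resolution of the identity \<open>sum_ecol_ecol\<close> between the
  factors writes a product as a sum of rank-one terms, the form in which the random bounds
  apply.\<close>

lemma mult_ft_sum_columns:
  assumes "A * idm n = A"
  shows "A * B\<^sup>t = (\<Sum>j<n. (A * ecol j) * (B * ecol j)\<^sup>t)"
proof -
  have "(\<Sum>j<n. (A * ecol j) * (B * ecol j)\<^sup>t) = A * (\<Sum>j<n. ecol j * (ecol j)\<^sup>t) * B\<^sup>t"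
    by (simp add: sum_distrib_left sum_distrib_right mult.assoc)
  then show ?thesis by (simp add: sum_ecol_ecol assms)
qed

lemma inner_sum_columns:
  assumes "A * idm n = A"
  shows "inner A B = (\<Sum>j<n. inner (A * ecol j) (B * ecol j))"
proof -
  have "(\<Sum>j<n. inner (A * ecol j) (B * ecol j)) = inner B (A * (\<Sum>j<n. ecol j * (ecol j)\<^sup>t))"
    by (simp add: inner_commute[of "A * _"] inner_mult_right[of B] inner_sum_right sum_distrib_left mult.assoc)
  then show ?thesis by (simp add: sum_ecol_ecol assms inner_commute)
qed

lemma norm_sum_columns:
  assumes "A * idm n = A"
  shows "(norm A)\<^sup>2 = (\<Sum>j<n. (norm (A * ecol j))\<^sup>2)"
  using inner_sum_columns[OF assms, of A] by (simp add: power2_norm_eq_inner)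

lemma ex_mult_idm: "\<exists>n. A * idm n = A"
proof -
  obtain N where "supp_le N A" using ex_supp_le by blast
  then have "A * idm N = A" by (intro fmat_eqI) (auto simp: supp_leD)
  then show ?thesis by blast
qed

section \<open>Orthogonal projections and quadratic forms\<close>

text \<open>For symmetric R this is the bound \<rho> on the operator norm, see
  \<open>quad_bound_norm\<close>. The noise estimate and the curvature condition both arrive as
  quadratic forms.\<close>

definition quad_bound :: "real \<Rightarrow> fmat \<Rightarrow> bool" where
  "quad_bound \<rho> R \<longleftrightarrow> (\<forall>X. \<bar>inner X (R * X)\<bar> \<le> \<rho> * (norm X)\<^sup>2)"

lemma quad_boundD: "quad_bound \<rho> R \<Longrightarrow> \<bar>inner X (R * X)\<bar> \<le> \<rho> * (norm X)\<^sup>2"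
  unfolding quad_bound_def by blast

lemma quad_bound_add: "quad_bound a A \<Longrightarrow> quad_bound b B \<Longrightarrow> quad_bound (a + b) (A + B)"
  unfolding quad_bound_def
  by (smt (verit) distrib_right inner_add_right)

lemma quad_bound_uminus: "quad_bound a A \<Longrightarrow> quad_bound a (- A)"
  unfolding quad_bound_def by simp

lemma quad_bound_diff: "quad_bound a A \<Longrightarrow> quad_bound b B \<Longrightarrow> quad_bound (a + b) (A - B)"
  using quad_bound_add[OF _ quad_bound_uminus] by fastforce

lemma quad_bound_mono: "quad_bound a A \<Longrightarrow> a \<le> b \<Longrightarrow> quad_bound b A"
  unfolding quad_bound_def by (smt (verit) mult_right_mono zero_le_power2)

lemma inner_symmetric_mult: "R\<^sup>t = R \<Longrightarrow> inner (R * X) Y = inner X (R * Y)"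
  by (simp add: inner_mult_left)

lemma quad_bound_nonneg: "quad_bound \<rho> R \<Longrightarrow> 0 \<le> \<rho>"
proof -
  assume "quad_bound \<rho> R"
  then have "0 \<le> \<rho> * (norm (ecol 0))\<^sup>2"
    using quad_boundD[of \<rho> R "ecol 0"] by linarith
  moreover have "ecol 0 \<noteq> 0" by (metis ent_ecol ent_zero zero_neq_one)
  ultimately show "0 \<le> \<rho>" by (simp add: zero_le_mult_iff)
qed

text \<open>Polarisation and the parallelogram law give a bound by the mean of the two squared
  norms; on normalised matrices this becomes the product of the norms.\<close>

lemma quad_bound_bilinear:
  assumes "R\<^sup>t = R" "quad_bound \<rho> R"
  shows "\<bar>inner X (R * Y)\<bar> \<le> \<rho> * norm X * norm Y"
proof -
  have *: "\<bar>inner X (R * Y)\<bar> \<le> \<rho> / 2 * ((norm X)\<^sup>2 + (norm Y)\<^sup>2)" for X Y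
  proof -
    have sym: "inner Y (R * X) = inner X (R * Y)"
      by (metis assms(1) inner_commute inner_symmetric_mult)
    have "4 * inner X (R * Y) = inner (X + Y) (R * (X + Y)) - inner (X - Y) (R * (X - Y))"
      by (simp add: algebra_simps inner_add_left inner_add_right inner_diff_left inner_diff_right sym)
    then have "4 * \<bar>inner X (R * Y)\<bar> \<le> \<rho> * (norm (X + Y))\<^sup>2 + \<rho> * (norm (X - Y))\<^sup>2"
      using quad_boundD[OF assms(2), of "X + Y"] quad_boundD[OF assms(2), of "X - Y"] by linarith
    also have "\<dots> = \<rho> * 2 * ((norm X)\<^sup>2 + (norm Y)\<^sup>2)"
      by (simp add: power2_norm_eq_inner algebra_simps inner_add_left inner_add_right inner_diff_left
          inner_diff_right inner_commute)
    finally show ?thesis by simp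
  qed
  show ?thesis
  proof (cases "X = 0 \<or> Y = 0")
    case False
    have "\<bar>inner (sgn X) (R * sgn Y)\<bar> \<le> \<rho>"
      using *[of "sgn X" "sgn Y"] False by (simp add: norm_sgn)
    then have "\<bar>inner X (R * Y)\<bar> / (norm X * norm Y) \<le> \<rho>"
      by (simp add: sgn_div_norm abs_mult divide_inverse mult_ac)
    then show ?thesis using False by (simp add: divide_le_eq mult_ac)
  qed auto
qed

lemma quad_bound_norm:
  assumes "R\<^sup>t = R" "quad_bound \<rho> R"
  shows "norm (R * Y) \<le> \<rho> * norm Y"
proof (cases "R * Y = 0")
  case False
  have "norm (R * Y) * norm (R * Y) \<le> norm (R * Y) * (\<rho> * norm Y)"
    using quad_bound_bilinear[OF assms, of "R * Y" Y]
    by (simp add: power2_norm_eq_inner[symmetric] power2_eq_square mult_ac)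
  then show ?thesis using False by simp
qed (use quad_bound_nonneg[OF assms(2)] in simp)

text \<open>Q carries the side conditions on the columns, such as orthogonality to the range of a
  factor.\<close>

lemma quad_le_of_columns:
  assumes "\<And>x. is_col x \<Longrightarrow> Q x \<Longrightarrow> inner x (R * x) \<le> \<rho> * (norm x)\<^sup>2"
    and "\<And>j. Q (X * ecol j)"
  shows "inner X (R * X) \<le> \<rho> * (norm X)\<^sup>2"
proof -
  obtain n where n: "X * idm n = X" using ex_mult_idm by blast
  have "inner X (R * X) = (\<Sum>j<n. inner (X * ecol j) (R * (X * ecol j)))"
    using inner_sum_columns[OF n, of "R * X"] by (simp add: mult.assoc)
  also have "\<dots> \<le> (\<Sum>j<n. \<rho> * (norm (X * ecol j))\<^sup>2)"
    by (intro sum_mono assms is_col_mult is_col_ecol)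
  also have "\<dots> = \<rho> * (norm X)\<^sup>2" by (simp add: norm_sum_columns[OF n] sum_distrib_left)
  finally show ?thesis .
qed

lemma inner_col_outer:
  assumes "is_col a" "is_col c"
  shows "inner (a * b\<^sup>t) (c * e\<^sup>t) = inner a c * inner (idm (Suc 0) * b\<^sup>t) (e\<^sup>t)"
proof -
  have "inner (a * b\<^sup>t) (c * e\<^sup>t) = inner (b\<^sup>t) (a\<^sup>t * c * e\<^sup>t)"
    by (simp add: inner_mult_left mult.assoc)
  also have "\<dots> = inner a c * inner (b\<^sup>t) (idm (Suc 0) * e\<^sup>t)"
    using assms by (simp add: is_col_ft_mult)
  finally show ?thesis by (simp add: inner_mult_left)
qed

lemma inner_outer:
  assumes "is_col a" "is_col c" "is_col b"
  shows "inner (a * b\<^sup>t) (c * e\<^sup>t) = inner a c * inner b e"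
  using assms by (simp add: inner_col_outer is_col_ft)

lemma norm_outer: "is_col a \<Longrightarrow> is_col b \<Longrightarrow> norm (a * b\<^sup>t) = norm a * norm b"
  by (simp add: norm_eq_sqrt_inner inner_outer real_sqrt_mult)

definition proj :: "fmat \<Rightarrow> bool" where
  "proj P \<longleftrightarrow> P\<^sup>t = P \<and> P * P = P"

lemma projD: "proj P \<Longrightarrow> P\<^sup>t = P" "proj P \<Longrightarrow> P * P = P" "proj P \<Longrightarrow> P * (P * A) = P * A"
  by (auto simp: proj_def mult.assoc[symmetric])

lemma proj_idm: "proj (idm n)"
  by (simp add: proj_def)

lemma proj_inner: "proj P \<Longrightarrow> inner X (P * X) = (norm (P * X))\<^sup>2"
  by (metis inner_mult_left power2_norm_eq_inner projD(1,3) inner_commute)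

lemma proj_pythagoras: "proj P \<Longrightarrow> (norm X)\<^sup>2 = (norm (P * X))\<^sup>2 + (norm (X - P * X))\<^sup>2"
  using proj_inner[of P X]
  by (simp add: power2_norm_eq_inner inner_diff_left inner_diff_right inner_commute)

lemma proj_norm_le: "proj P \<Longrightarrow> norm (P * X) \<le> norm X"
  using proj_pythagoras[of P X] by (simp add: norm_le_square power2_norm_eq_inner[symmetric])

lemma proj_compl_norm_le: "proj P \<Longrightarrow> norm (X - P * X) \<le> norm X"
  using proj_pythagoras[of P X] by (simp add: norm_le_square power2_norm_eq_inner[symmetric])

lemma proj_quad_bound: "proj P \<Longrightarrow> quad_bound 1 P"
  unfolding quad_bound_def using proj_inner proj_norm_le by (simp add: power_mono)

lemma idm_Suc: "idm (Suc n) = idm n + ecol n * (ecol n)\<^sup>t"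
  using sum_ecol_ecol[of n] sum_ecol_ecol[of "Suc n"] by simp

lemma norm_idm: "(norm (idm n))\<^sup>2 = real n"
  by (simp add: power2_norm_eq_inner inner_fmat_eq[OF supp_le_idm] if_distrib sum.delta cong: if_cong)

text \<open>Gram--Schmidt: the rank of an orthogonal projection is its squared Frobenius norm.\<close>

lemma ex_proj_idm:
  assumes Q: "proj Q"
  shows "\<exists>P. proj P \<and> P * Q = Q \<and> P * (U * idm n) = U * idm n \<and> (norm P)\<^sup>2 \<le> (norm Q)\<^sup>2 + real n \<and>
    (\<forall>Z. Q * Z = 0 \<longrightarrow> (U * idm n)\<^sup>t * Z = 0 \<longrightarrow> P * Z = 0)"
proof (induction n)
  case 0
  have "idm 0 = 0" by (rule fmat_eqI) auto
  then show ?case using Q by (intro exI[of _ Q]) (auto simp: proj_def)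
next
  case (Suc n)
  then obtain P where P: "proj P" "P * Q = Q" "P * (U * idm n) = U * idm n"
    "(norm P)\<^sup>2 \<le> (norm Q)\<^sup>2 + real n"
    "\<And>Z. Q * Z = 0 \<Longrightarrow> (U * idm n)\<^sup>t * Z = 0 \<Longrightarrow> P * Z = 0" by blast
  define u where "u = U * ecol n"
  define v where "v = u - P * u"
  have cu: "is_col u" unfolding u_def by (intro is_col_mult is_col_ecol)
  have cv: "is_col v" using cu by (simp add: v_def is_col_def algebra_simps mult.assoc)
  have US: "U * idm (Suc n) = U * idm n + u * (ecol n)\<^sup>t"
    by (simp add: idm_Suc u_def algebra_simps)
  have ker: "(U * idm n)\<^sup>t * Z = 0 \<and> u\<^sup>t * Z = 0" if "(U * idm (Suc n))\<^sup>t * Z = 0" for Z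
  proof -
    have "idm n * (idm (Suc n) * W) = idm n * W" "(ecol n)\<^sup>t * (idm (Suc n) * W) = (ecol n)\<^sup>t * W" for W
    proof -
      show "idm n * (idm (Suc n) * W) = idm n * W" by (rule fmat_eqI) auto
      have "idm (Suc n) * ecol n = ecol n" by (rule fmat_eqI) auto
      then have "(ecol n)\<^sup>t * idm (Suc n) = (ecol n)\<^sup>t" by (metis ft_idm ft_mult)
      then show "(ecol n)\<^sup>t * (idm (Suc n) * W) = (ecol n)\<^sup>t * W" by (metis mult.assoc)
    qed
    moreover from that have "idm n * ((U * idm (Suc n))\<^sup>t * Z) = 0"
      "(ecol n)\<^sup>t * ((U * idm (Suc n))\<^sup>t * Z) = 0" by simp_all
    ultimately show ?thesis by (simp add: u_def mult.assoc)
  qed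
  have Pv: "P * v = 0" using P(1) by (simp add: v_def algebra_simps projD)
  then have vP: "v\<^sup>t * P = 0" by (metis P(1) ft_eq_0_iff ft_ft ft_mult projD(1))
  show ?case
  proof (cases "v = 0")
    case True
    then have "P * u = u" by (simp add: v_def)
    then have "P * (U * idm (Suc n)) = U * idm (Suc n)"
      unfolding US distrib_left mult.assoc[symmetric] using P(3) by (simp add: mult.assoc)
    then show ?thesis using P ker by (intro exI[of _ P]) auto
  next
    case False
    define c where "c = inverse ((norm v)\<^sup>2)"
    define P' where "P' = P + c *\<^sub>R (v * v\<^sup>t)"
    have cn: "c * inner v v = 1" using False by (simp add: c_def power2_norm_eq_inner)
    have vv: "v\<^sup>t * v = inner v v *\<^sub>R idm (Suc 0)" using cv by (rule is_col_ft_mult[OF cv])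
    have vi: "v * idm (Suc 0) = v" using cv by (simp add: is_col_def)
    have vvv: "v * (v\<^sup>t * (v * A)) = inner v v *\<^sub>R (v * A)" for A
    proof -
      have "v * (v\<^sup>t * (v * A)) = v * (v\<^sup>t * v) * A" by (simp add: mult.assoc)
      then show ?thesis unfolding vv by (simp add: vi)
    qed
    have Pv': "P * (v * A) = 0" and vP': "v\<^sup>t * (P * A) = 0" for A
      using Pv vP by (simp_all add: mult.assoc[symmetric])
    have P'sym: "P'\<^sup>t = P'" using P(1) by (simp add: P'_def projD)
    have P'idem: "P' * P' = P'"
      using P(1) cn by (simp add: P'_def algebra_simps projD Pv Pv' vP vP' vvv)
    have P'A: "P' * A = A" if "P * A = A" for A
    proof -
      have "v\<^sup>t * A = 0" using that vP by (metis mult.assoc mult_zero_left)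
      then show ?thesis using that by (simp add: P'_def algebra_simps)
    qed
    have P'u: "P' * u = u"
    proof -
      have "v\<^sup>t * u = v\<^sup>t * v" by (simp add: v_def[of] algebra_simps) (use vP' in \<open>simp add: v_def algebra_simps\<close>)
      then have "P' * u = P * u + (c * inner v v) *\<^sub>R v"
        unfolding P'_def by (simp add: distrib_right mult.assoc vv vi)
      then show ?thesis unfolding cn by (simp add: v_def)
    qed
    have "P' * (U * idm (Suc n)) = U * idm (Suc n)"
      unfolding US distrib_left using P'A[OF P(3)] P'u by (simp add: mult.assoc[symmetric])
    moreover have "(norm P')\<^sup>2 \<le> (norm Q)\<^sup>2 + real (Suc n)"
    proof -
      \<comment> \<open>The new rank-one projection is Frobenius-orthogonal to P, so the squared
        norm grows by exactly 1.\<close>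
      have "inner P (v * v\<^sup>t) = 0"
        by (metis P(1) Pv inner_commute inner_mult_left inner_zero_left inner_mult_right projD(1) ft_ft)
      moreover from this have "inner (v * v\<^sup>t) P = 0" by (simp add: inner_commute)
      ultimately have "(norm P')\<^sup>2 = (norm P)\<^sup>2 + c * inner v v * (c * inner v v)"
        by (simp add: P'_def power2_norm_eq_inner inner_add_left inner_add_right
            inner_outer[OF cv cv cv])
      then show ?thesis using P(4) unfolding cn by simp
    qed
    moreover have "P' * Z = 0" if "Q * Z = 0" "(U * idm (Suc n))\<^sup>t * Z = 0" for Z
    proof -
      have "P * Z = 0" using P(5) that(1) ker[OF that(2)] by blast
      moreover have "v\<^sup>t * Z = u\<^sup>t * Z - u\<^sup>t * (P * Z)"
        using P(1) by (simp add: v_def projD algebra_simps)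
      ultimately have "v\<^sup>t * Z = 0" using ker[OF that(2)] by simp
      then show ?thesis using \<open>P * Z = 0\<close> by (simp add: P'_def algebra_simps)
    qed
    ultimately show ?thesis using P'sym P'idem P'A[OF P(2)]
      by (intro exI[of _ P']) (auto simp: proj_def)
  qed
qed

text \<open>The last property bounds the range of P from above: what is orthogonal to the range of Q
  and to the columns of U is killed by P. Minimality of the projection is always used in this
  form.\<close>

lemma ex_proj_extend:
  assumes "proj Q" "U * idm n = U"
  obtains P where "proj P" "P * Q = Q" "P * U = U" "(norm P)\<^sup>2 \<le> (norm Q)\<^sup>2 + real n"
    "\<And>Z. Q * Z = 0 \<Longrightarrow> U\<^sup>t * Z = 0 \<Longrightarrow> P * Z = 0"
  using ex_proj_idm[OF assms(1), of U n] assms(2) by auto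

lemma ex_proj_range:
  assumes "U * idm n = U"
  obtains P where "proj P" "P * U = U" "(norm P)\<^sup>2 \<le> real n" "\<And>Z. U\<^sup>t * Z = 0 \<Longrightarrow> P * Z = 0"
proof -
  have "proj 0" by (simp add: proj_def)
  from ex_proj_extend[OF this assms] show ?thesis using that by auto
qed

text \<open>The part of P outside the first d coordinates is annihilated by U^t, hence by P, and
  pairing it with P gives its squared norm.\<close>

lemma proj_range_supp:
  assumes "proj P" "\<And>Z. U\<^sup>t * Z = 0 \<Longrightarrow> P * Z = 0" "idm d * U = U"
  shows "idm d * P = P"
proof -
  have "U\<^sup>t * idm d = U\<^sup>t" by (metis assms(3) ft_idm ft_mult)
  then have "U\<^sup>t * (P - idm d * P) = 0" by (simp add: right_diff_distrib mult.assoc[symmetric])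
  then have 1: "P * (P - idm d * P) = 0" using assms(2) by blast
  have "(norm (P - idm d * P))\<^sup>2 = inner P (P - idm d * P)"
    by (simp add: power2_norm_eq_inner inner_diff_left inner_diff_right inner_mult_left[of "idm d"])
  also have "\<dots> = inner P (P * (P - idm d * P))"
    by (metis assms(1) inner_mult_left projD(1,2))
  finally show ?thesis using 1 by simp
qed

text \<open>The r by r + 1 matrix with columns those of W and then z has a kernel vector, namely (k,
  t). It is found in the complement of the projection onto the row space.\<close>

lemma ex_kernel_vector:
  assumes W: "idm r * W = W" "W * idm r = W" and z: "is_col z" "idm r * z = z"
  obtains k t where "is_col k" "idm r * k = k" "k \<noteq> 0 \<or> t \<noteq> 0" "W * k + t *\<^sub>R z = 0"
proof -
  define A where "A = W + z * (ecol r)\<^sup>t"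
  have e1: "idm (Suc r) * ecol r = ecol r" by (rule fmat_eqI) auto
  have e2: "idm (Suc r) * W\<^sup>t = W\<^sup>t"
  proof -
    have "idm (Suc r) * (idm r * W\<^sup>t) = idm r * W\<^sup>t" by (rule fmat_eqI) auto
    then show ?thesis using W(2) by (metis ft_idm ft_mult)
  qed
  have iA: "idm r * A = A" using W z by (simp add: A_def distrib_left mult.assoc[symmetric])
  then have "A\<^sup>t * idm r = A\<^sup>t" by (metis ft_idm ft_mult)
  then obtain P where P: "proj P" "P * A\<^sup>t = A\<^sup>t" "(norm P)\<^sup>2 \<le> real r"
    "\<And>Z. A * Z = 0 \<Longrightarrow> P * Z = 0" by (metis ex_proj_range ft_ft)
  have "idm (Suc r) * A\<^sup>t = A\<^sup>t"
    by (simp add: A_def distrib_left e2 mult.assoc[symmetric] e1)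
  then have iP: "idm (Suc r) * P = P" using proj_range_supp[OF P(1)] P(4) by (metis ft_ft)
  define Y where "Y = idm (Suc r) - P"
  \<comment> \<open>The dimension count in Frobenius norms: the squared norm of P is at most r, that
    of the identity is r + 1.\<close>
  have "Y \<noteq> 0" using P(3) norm_idm[of "Suc r"] by (auto simp: Y_def)
  then obtain i j where "ent Y i j \<noteq> 0" by (metis ent_zero fmat_eqI)
  then have y0: "Y * ecol j \<noteq> 0" by (metis ent_mult_ecol ent_zero)
  define y where "y = Y * ecol j"
  have iy: "idm (Suc r) * y = y"
    by (simp add: y_def Y_def mult.assoc[symmetric] right_diff_distrib iP)
  have "A * idm (Suc r) = A" "A * P = A"
    using \<open>idm (Suc r) * A\<^sup>t = A\<^sup>t\<close> P(1,2) by (metis ft_ft ft_idm ft_mult projD(1))+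
  then have "A * Y = 0" by (simp add: Y_def right_diff_distrib)
  then have Ay: "A * y = 0" by (simp add: y_def mult.assoc[symmetric])
  have cy: "is_col y" unfolding y_def by (intro is_col_mult is_col_ecol)
  define t where "t = inner (ecol r) y"
  have "W * (idm r * y) + t *\<^sub>R z = A * y"
    using W z cy unfolding A_def t_def
    by (simp add: distrib_right mult.assoc is_col_ft_mult is_col_ecol)
      (simp add: mult.assoc[symmetric] is_col_def)
  moreover have "idm r * y \<noteq> 0 \<or> t \<noteq> 0"
  proof (rule ccontr)
    assume a: "\<not> ?thesis"
    have "y = idm r * y + ecol r * ((ecol r)\<^sup>t * y)"
      using iy by (simp add: idm_Suc distrib_right mult.assoc)
    also have "\<dots> = 0" using a cy by (simp add: is_col_ft_mult is_col_ecol t_def)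
    finally show False using y0 by (simp add: y_def)
  qed
  ultimately show ?thesis
    using that[of "idm r * y" t] Ay cy by (simp add: is_col_mult)
qed

text \<open>A square matrix and its transpose have the same least singular value. The lower bound
  makes W injective, hence onto by \<open>ex_kernel_vector\<close>. For a column z = W y,
  Cauchy-Schwarz in |z|^2 = <y, W^t z> together with s |y|^2 \<le> |z|^2 gives the claim.\<close>

lemma square_lower_bound_transpose:
  assumes W: "idm r * W = W" "W * idm r = W" and s: "s > 0"
    and lower: "\<And>y. is_col y \<Longrightarrow> idm r * y = y \<Longrightarrow> s * (norm y)\<^sup>2 \<le> (norm (W * y))\<^sup>2"
    and z: "idm r * z = z"
  shows "s * (norm z)\<^sup>2 \<le> (norm (W\<^sup>t * z))\<^sup>2"
proof -
  have col: "s * (norm z)\<^sup>2 \<le> (norm (W\<^sup>t * z))\<^sup>2" if z: "is_col z" "idm r * z = z" for z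
  proof -
    obtain k t where k: "is_col k" "idm r * k = k" "k \<noteq> 0 \<or> t \<noteq> 0" "W * k + t *\<^sub>R z = 0"
      using ex_kernel_vector[OF W z] .
    have t: "t \<noteq> 0"
    proof
      assume "t = 0"
      then have "W * k = 0" using k by simp
      then show False using lower[OF k(1,2)] k(3) \<open>t = 0\<close> s
        by (simp add: mult_le_0_iff)
    qed
    define y where "y = (- 1 / t) *\<^sub>R k"
    have Wk: "W * k = - (t *\<^sub>R z)" using k(4) by (simp add: eq_neg_iff_add_eq_0)
    have zy: "W * y = z" using t by (simp add: y_def Wk)
    have y: "is_col y" "idm r * y = y" using k by (simp_all add: y_def is_col_def)
    have 1: "(norm z)\<^sup>2 \<le> norm y * norm (W\<^sup>t * z)"
    proof -
      have "(norm z)\<^sup>2 = inner y (W\<^sup>t * z)"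
        by (metis inner_mult_left power2_norm_eq_inner zy)
      then show ?thesis using norm_cauchy_schwarz[of y "W\<^sup>t * z"] by simp
    qed
    have 2: "s * (norm y)\<^sup>2 \<le> (norm z)\<^sup>2" using lower[OF y] zy by simp
    show ?thesis
    proof (cases "z = 0")
      case False
      have "s * ((norm z)\<^sup>2)\<^sup>2 \<le> s * (norm y * norm (W\<^sup>t * z))\<^sup>2"
        using 1 s by (intro mult_left_mono power_mono) auto
      also have "\<dots> = (s * (norm y)\<^sup>2) * (norm (W\<^sup>t * z))\<^sup>2" by (simp add: power_mult_distrib)
      also have "\<dots> \<le> (norm z)\<^sup>2 * (norm (W\<^sup>t * z))\<^sup>2" using 2 by (intro mult_right_mono) auto
      finally have "(norm z)\<^sup>2 * (s * (norm z)\<^sup>2) \<le> (norm z)\<^sup>2 * (norm (W\<^sup>t * z))\<^sup>2"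
        by (simp add: power2_eq_square mult_ac)
      then show ?thesis using False by simp
    qed simp
  qed
  obtain n where n: "z * idm n = z" using ex_mult_idm by blast
  then have n': "(W\<^sup>t * z) * idm n = W\<^sup>t * z" by (simp add: mult.assoc)
  have "s * (norm z)\<^sup>2 = (\<Sum>j<n. s * (norm (z * ecol j))\<^sup>2)"
    by (simp add: norm_sum_columns[OF n] sum_distrib_left)
  also have "\<dots> \<le> (\<Sum>j<n. (norm (W\<^sup>t * (z * ecol j)))\<^sup>2)"
    using z by (intro sum_mono col is_col_mult is_col_ecol) (simp add: mult.assoc[symmetric])
  also have "\<dots> = (norm (W\<^sup>t * z))\<^sup>2"
    unfolding norm_sum_columns[OF n'] by (simp add: mult.assoc)
  finally show ?thesis .
qed

section \<open>Second-order stationary points\<close>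

text \<open>Cauchy-Schwarz over the columns; it reassembles rank-one bounds into Frobenius norms in
  \<open>defect_outer\<close>.\<close>

lemma norm_mult_columns_le:
  assumes "A * idm n = A"
  shows "(\<Sum>j<n. norm (A * ecol j) * norm (B * ecol j)) \<le> norm A * norm B"
proof -
  have "(\<Sum>j<n. norm (A * ecol j) * norm (B * ecol j))
      \<le> L2_set (\<lambda>j. norm (A * ecol j)) {..<n} * L2_set (\<lambda>j. norm (B * ecol j)) {..<n}"
    using L2_set_mult_ineq[of "\<lambda>j. norm (A * ecol j)" "\<lambda>j. norm (B * ecol j)" "{..<n}"] by simp
  also have "L2_set (\<lambda>j. norm (A * ecol j)) {..<n} = norm A"
    unfolding L2_set_def norm_sum_columns[OF assms, symmetric] by simp
  also have "L2_set (\<lambda>j. norm (B * ecol j)) {..<n} = norm (B * idm n)"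
  proof -
    have "(\<Sum>j<n. (norm (B * ecol j))\<^sup>2) = (norm (B * idm n))\<^sup>2"
    proof -
      have "idm n * ecol j = ecol j" if "j < n" for j using that by (intro fmat_eqI) auto
      then show ?thesis
        by (subst norm_sum_columns[of _ n]) (simp_all add: mult.assoc)
    qed
    then show ?thesis unfolding L2_set_def by simp
  qed
  also have "norm (B * idm n) \<le> norm B"
    using proj_norm_le[OF proj_idm, of n "B\<^sup>t"] by (metis ft_idm ft_mult norm_ft)
  finally show ?thesis by (simp add: mult_left_mono)
qed

definition sym_part :: "fmat \<Rightarrow> fmat" where "sym_part A = (1/2) *\<^sub>R (A + A\<^sup>t)"

lemma sym_part_linear:
  "sym_part (A + B) = sym_part A + sym_part B" "sym_part (A - B) = sym_part A - sym_part B"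
  "sym_part 0 = 0"
  "sym_part (sum f I) = (\<Sum>i\<in>I. sym_part (f i))"
  unfolding sym_part_def by (simp_all add: algebra_simps sum.distrib scaleR_sum_right)

lemma inner_sym_part: "A\<^sup>t = A \<Longrightarrow> inner A (sym_part B) = inner A B"
  using inner_ft[of A B] unfolding sym_part_def by (simp add: inner_add_right)

lemma sym_part_symmetric: "A\<^sup>t = A \<Longrightarrow> sym_part A = A"
  by (simp add: sym_part_def scaleR_2[symmetric])

section \<open>The deviation operator of a family of measurement matrices\<close>

locale sensing =
  fixes d n :: nat and X :: "nat \<Rightarrow> fmat" and \<epsilon> :: real
  assumes X_sym: "\<And>i. (X i)\<^sup>t = X i" and X_supp: "\<And>i. idm d * X i = X i"
begin

text \<open>The matrices \<open>X i\<close> are symmetric and see only symmetric parts, so those are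
  what the empirical average is compared with. On symmetric A the form is represented by
  \<open>defect_op A\<close>.\<close>

definition defect :: "fmat \<Rightarrow> fmat \<Rightarrow> real" where
  "defect A B = (\<Sum>i<n. inner (X i) A * inner (X i) B) / real n - inner (sym_part A) (sym_part B)"

definition defect_op :: "fmat \<Rightarrow> fmat" where
  "defect_op A = (1 / real n) *\<^sub>R (\<Sum>i<n. inner (X i) A *\<^sub>R X i) - A"

lemma defect_zero: "defect 0 B = 0" "defect A 0 = 0"
  by (simp_all add: defect_def sym_part_linear)

lemma defect_add_left: "defect (A + A') B = defect A B + defect A' B"
  by (simp add: defect_def sym_part_linear inner_add_left inner_add_right distrib_right sum.distrib add_divide_distrib)

lemma defect_commute: "defect A B = defect B A"
  by (simp add: defect_def inner_commute mult.commute)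

lemma defect_add_right: "defect A (B + B') = defect A B + defect A B'"
  by (metis defect_add_left defect_commute)

lemma defect_sum_left: "defect (sum f I) B = (\<Sum>i\<in>I. defect (f i) B)"
  by (induction I rule: infinite_finite_induct) (simp_all add: defect_zero defect_add_left)

lemma defect_sum_right: "defect B (sum f I) = (\<Sum>i\<in>I. defect B (f i))"
  by (simp add: defect_commute[of B] defect_sum_left)

lemma defect_op_diff: "defect_op (A - B) = defect_op A - defect_op B"
  by (simp add: defect_op_def inner_diff_right scaleR_left_diff_distrib sum_subtractf scaleR_right_diff_distrib)

lemma defect_op_sym: "A\<^sup>t = A \<Longrightarrow> (defect_op A)\<^sup>t = defect_op A"
  by (simp add: defect_op_def X_sym)

lemma defect_op_supp: "idm d * A = A \<Longrightarrow> idm d * defect_op A = defect_op A"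
  by (simp add: defect_op_def right_diff_distrib sum_distrib_left X_supp)

lemma inner_defect_op: "A\<^sup>t = A \<Longrightarrow> inner (defect_op A) B = defect A B"
  by (simp add: defect_op_def defect_def sym_part_symmetric inner_sym_part inner_diff_left
      inner_sum_left sum_divide_distrib)

lemma sum_squares_eq_defect:
  "A\<^sup>t = A \<Longrightarrow> (\<Sum>i<n. (inner (X i) A)\<^sup>2) / real n = defect A A + (norm A)\<^sup>2"
  by (simp add: defect_def sym_part_symmetric power2_norm_eq_inner power2_eq_square[of "inner _ _"])

end

locale sensing_bound = sensing +
  assumes eps_nonneg: "0 \<le> \<epsilon>"
    and defect_cols: "\<And>a b u v. is_col a \<Longrightarrow> is_col b \<Longrightarrow> is_col u \<Longrightarrow> is_col v \<Longrightarrow>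
      idm d * a = a \<Longrightarrow> idm d * b = b \<Longrightarrow> idm d * u = u \<Longrightarrow> idm d * v = v \<Longrightarrow>
      \<bar>defect (a * b\<^sup>t) (u * v\<^sup>t)\<bar> \<le> \<epsilon> * norm a * norm b * norm u * norm v"
begin

text \<open>Expanding both products into columns and using Cauchy-Schwarz for each keeps the
  constant \<epsilon>. Rank enters only when a matrix A is written as P * A, since the squared norm
  of a projection is its rank.\<close>

lemma defect_outer:
  assumes "idm d * A = A" "idm d * B = B" "idm d * A' = A'" "idm d * B' = B'"
  shows "\<bar>defect (A * B\<^sup>t) (A' * B'\<^sup>t)\<bar> \<le> \<epsilon> * norm A * norm B * norm A' * norm B'"
proof -
  obtain m where m: "A * idm m = A" using ex_mult_idm by blast
  obtain k where k: "A' * idm k = A'" using ex_mult_idm by blast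
  let ?f = "\<lambda>j. norm (A * ecol j) * norm (B * ecol j)" and ?g = "\<lambda>j. norm (A' * ecol j) * norm (B' * ecol j)"
  have "\<bar>defect (A * B\<^sup>t) (A' * B'\<^sup>t)\<bar>
     = \<bar>\<Sum>i<m. \<Sum>j<k. defect ((A * ecol i) * (B * ecol i)\<^sup>t) ((A' * ecol j) * (B' * ecol j)\<^sup>t)\<bar>"
    unfolding mult_ft_sum_columns[OF m, of B] mult_ft_sum_columns[OF k, of B'] defect_sum_left defect_sum_right
    by (rule arg_cong[where f=abs], rule sum.swap)
  also have "\<dots> \<le> (\<Sum>i<m. \<Sum>j<k. \<bar>defect ((A * ecol i) * (B * ecol i)\<^sup>t) ((A' * ecol j) * (B' * ecol j)\<^sup>t)\<bar>)"
    by (rule order_trans[OF sum_abs]) (intro sum_mono sum_abs)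
  also have "\<dots> \<le> (\<Sum>i<m. \<Sum>j<k. \<epsilon> * norm (A * ecol i) * norm (B * ecol i) * norm (A' * ecol j) * norm (B' * ecol j))"
    using assms by (intro sum_mono defect_cols is_col_mult is_col_ecol) (simp_all add: mult.assoc[symmetric])
  also have "\<dots> = \<epsilon> * ((\<Sum>i<m. ?f i) * (\<Sum>j<k. ?g j))"
    by (subst sum_product) (simp add: sum_distrib_left mult_ac)
  also have "\<dots> \<le> \<epsilon> * ((norm A * norm B) * (norm A' * norm B'))"
    using eps_nonneg
    by (intro mult_left_mono mult_mono norm_mult_columns_le m k sum_nonneg mult_nonneg_nonneg) auto
  finally show ?thesis by (simp add: mult_ac)
qed

text \<open>The quadratic form at Y is the pairing with Y Y^t, which is already measured by |Y|^2.
  Only A = P * A pays for its rank, so a single factor \<open>norm P\<close> appears.\<close>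

lemma defect_op_quad_bound:
  assumes "A\<^sup>t = A" "proj P" "P * A = A" "idm d * P = P"
  shows "quad_bound (\<epsilon> * norm P * norm A) (defect_op A)"
  unfolding quad_bound_def
proof
  fix Y
  have A: "idm d * A = A" using assms by (metis mult.assoc)
  let ?Y = "idm d * Y"
  have "inner Y (defect_op A * Y) = inner ?Y (defect_op A * ?Y)"
  proof -
    have "defect_op A * idm d = defect_op A"
      by (metis A assms(1) defect_op_supp defect_op_sym ft_idm ft_mult)
    then have "defect_op A * Y = idm d * (defect_op A * ?Y)"
      using defect_op_supp[OF A] by (metis mult.assoc)
    then show ?thesis by (metis ft_idm inner_mult_left)
  qed
  also have "\<dots> = inner (defect_op A) (?Y * ?Y\<^sup>t)"
    by (metis ft_ft inner_commute inner_mult_right)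
  also have "\<dots> = defect (P * A\<^sup>t) (?Y * ?Y\<^sup>t)"
    using assms by (simp add: inner_defect_op)
  finally have "\<bar>inner Y (defect_op A * Y)\<bar> \<le> \<epsilon> * norm P * norm A * norm ?Y * norm ?Y"
    using defect_outer[of P A ?Y ?Y] A assms(4) by simp
  also have "\<dots> \<le> \<epsilon> * norm P * norm A * norm Y * norm Y"
    using proj_norm_le[OF proj_idm, of d Y] eps_nonneg
    by (intro mult_mono mult_nonneg_nonneg) auto
  finally show "\<bar>inner Y (defect_op A * Y)\<bar> \<le> \<epsilon> * norm P * norm A * (norm Y)\<^sup>2"
    by (simp add: power2_eq_square mult.assoc)
qed

text \<open>Here both arguments need P as an extra factor, so the full rank appears and not its
  square root.\<close>

lemma defect_two_sided:
  assumes "proj P" "P * A = A" "P * B = B" "idm d * P = P" "A\<^sup>t = A" "B\<^sup>t = B"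
  shows "\<bar>defect A B\<bar> \<le> \<epsilon> * (norm P)\<^sup>2 * norm A * norm B"
proof -
  have A: "idm d * A = A" "idm d * B = B" using assms by (metis mult.assoc)+
  have "\<bar>defect (P * A\<^sup>t) (P * B\<^sup>t)\<bar> \<le> \<epsilon> * norm P * norm A * norm P * norm B"
    by (rule defect_outer) (use A assms in auto)
  then show ?thesis using assms by (simp add: power2_eq_square mult_ac)
qed

end

lemma ex_proj_pair:
  assumes U_supp: "idm d * U = U" "U * idm r = U" and V_supp: "idm d * V = V" "V * idm r = V"
  obtains P where "proj P" "P * U = U" "P * V = V" "(norm P)\<^sup>2 \<le> 2 * real r" "idm d * P = P"
proof -
  obtain P1 where P1: "proj P1" "P1 * U = U" "(norm P1)\<^sup>2 \<le> real r" "\<And>Z. U\<^sup>t * Z = 0 \<Longrightarrow> P1 * Z = 0"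
    using ex_proj_range[OF U_supp(2)] by blast
  obtain P where P: "proj P" "P * P1 = P1" "P * V = V" "(norm P)\<^sup>2 \<le> (norm P1)\<^sup>2 + real r"
    "\<And>Z. P1 * Z = 0 \<Longrightarrow> V\<^sup>t * Z = 0 \<Longrightarrow> P * Z = 0"
    using ex_proj_extend[OF P1(1) V_supp(2)] by blast
  have "idm d * P1 = P1" using proj_range_supp[OF P1(1,4) U_supp(1)] .
  \<comment> \<open>\<open>proj_range_supp\<close> wants a single matrix. The sum P1 + V V^t is
    positive semidefinite, and its kernel is the intersection of the two kernels.\<close>
  then have "idm d * (P1 + V * V\<^sup>t) = P1 + V * V\<^sup>t" using V_supp by (simp add: distrib_left mult.assoc[symmetric])
  moreover have "P * Z = 0" if "(P1 + V * V\<^sup>t)\<^sup>t * Z = 0" for Z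
  proof -
    have "inner Z (P1 * Z) + inner Z (V * (V\<^sup>t * Z)) = 0"
      using that P1(1) by (metis distrib_right ft_ft ft_linear(2) ft_mult inner_add_right inner_zero_right mult.assoc projD(1))
    moreover have "inner Z (V * (V\<^sup>t * Z)) = (norm (V\<^sup>t * Z))\<^sup>2"
      by (metis ft_ft inner_mult_left power2_norm_eq_inner)
    ultimately have "(norm (P1 * Z))\<^sup>2 + (norm (V\<^sup>t * Z))\<^sup>2 = 0" using proj_inner[OF P1(1)] by simp
    then have "P1 * Z = 0" "V\<^sup>t * Z = 0" by (simp_all add: add_nonneg_eq_0_iff)
    then show ?thesis by (rule P(5))
  qed
  ultimately have "idm d * P = P" using proj_range_supp[OF P(1)] by blast
  then show ?thesis using that[of P] P P1 by (metis add_mono mult.assoc mult_2 order_trans order_refl)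
qed

text \<open>\<open>m\<close> is a lower bound for the nonzero eigenvalues of M;
  \<open>ground_truth_fmat_of\<close> supplies sqrt d times the least diagonal entry.\<close>

locale ground_truth =
  fixes d r :: nat and M V :: fmat and m :: real
  assumes r_pos: "0 < r"
    and M_sym: "M\<^sup>t = M" and M_supp: "idm d * M = M"
    and M_psd: "\<And>Y. 0 \<le> inner Y (M * Y)"
    and V_supp: "idm d * V = V" "V * idm r = V" and V_orth: "V\<^sup>t * V = idm r"
    and M_range: "V * (V\<^sup>t * M) = M"
    and M_lower: "\<And>Y. idm r * Y = Y \<Longrightarrow> m * (norm Y)\<^sup>2 \<le> inner (V * Y) (M * (V * Y))"
begin

lemma M_kernel: "V\<^sup>t * Y = 0 \<Longrightarrow> M * Y = 0"
proof -
  assume "V\<^sup>t * Y = 0"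
  moreover have "M * Y = (V * (V\<^sup>t * M))\<^sup>t * Y" using M_range M_sym by simp
  ultimately show ?thesis by (simp add: M_sym mult.assoc)
qed

lemma norm_V: "idm r * Y = Y \<Longrightarrow> norm (V * Y) = norm Y"
  by (simp add: norm_eq_sqrt_inner inner_mult_left mult.assoc[symmetric] V_orth)

lemma norm_Vt_le: "norm (V\<^sup>t * Y) \<le> norm Y"
proof -
  have "proj (V * V\<^sup>t)"
    using V_orth V_supp by (simp add: proj_def) (metis mult.assoc)
  moreover have "norm (V * V\<^sup>t * Y) = norm (V\<^sup>t * Y)"
    using V_supp(2) by (metis mult.assoc norm_V ft_idm ft_mult)
  ultimately show ?thesis using proj_norm_le by metis
qed

text \<open>The hypothesis bounds F F^t on the range of V, the conclusion bounds F itself. Both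
  concern the r by r matrix F^t V, and \<open>square_lower_bound_transpose\<close> leads from one to
  the other.\<close>

lemma factor_lower_bound:
  assumes F: "F * idm r = F" and s: "0 < s"
    and lower: "\<And>y. idm r * y = y \<Longrightarrow> s * (norm y)\<^sup>2 \<le> inner (V * y) (F * (F\<^sup>t * (V * y)))"
    and z: "idm r * z = z"
  shows "s * (norm z)\<^sup>2 \<le> (norm (F * z))\<^sup>2"
proof -
  let ?W = "F\<^sup>t * V"
  have "s * (norm z)\<^sup>2 \<le> (norm (?W\<^sup>t * z))\<^sup>2"
  proof (rule square_lower_bound_transpose[OF _ _ s _ z])
    show "idm r * ?W = ?W" using F by (metis ft_idm ft_mult mult.assoc)
    show "?W * idm r = ?W" using V_supp by (simp add: mult.assoc)
    show "s * (norm y)\<^sup>2 \<le> (norm (?W * y))\<^sup>2" if "idm r * y = y" for y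
      using lower[OF that] by (metis ft_ft inner_mult_left mult.assoc power2_norm_eq_inner)
  qed
  also have "(norm (?W\<^sup>t * z))\<^sup>2 \<le> (norm (F * z))\<^sup>2"
    using norm_Vt_le[of "F * z"] by (simp add: mult.assoc power_mono)
  finally show ?thesis .
qed

end

text \<open>Stationarity without probability: the two conditions are the gradient and the Hessian of
  the objective written with \<open>defect_op\<close>. The number 12 is chosen for
  \<open>eps_le\<close> and \<open>norm_Delta_le\<close>, which need r \<epsilon> \<le>
  1/12.\<close>

locale stationary = sensing_bound d n X \<epsilon> + ground_truth d r M V m
  for d n X \<epsilon> r M V m +
  fixes N U :: fmat and \<nu> lam :: real
  assumes lam_nonneg: "0 \<le> lam"
    and N_sym: "N\<^sup>t = N" and N_supp: "idm d * N = N" and N_bound: "quad_bound \<nu> N"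
    and eps_small: "12 * (real r * \<epsilon>) \<le> 1"
    and U_supp: "idm d * U = U" "U * idm r = U"
    and first_order: "(U * U\<^sup>t - M + defect_op (U * U\<^sup>t - M) - N) * U + lam *\<^sub>R U = 0"
    and second_order: "\<And>H. idm d * H = H \<Longrightarrow> H * idm r = H \<Longrightarrow>
      0 \<le> (\<Sum>i<n. (inner (X i) (U * H\<^sup>t + H * U\<^sup>t))\<^sup>2) / (2 * real n)
        + inner H ((U * U\<^sup>t - M + defect_op (U * U\<^sup>t - M) - N) * H) + lam * (norm H)\<^sup>2"
begin

definition \<Delta> where "\<Delta> = U * U\<^sup>t - M"
definition B where "B = M + N - defect_op \<Delta>"
text \<open>Bounds the perturbation B - M in operator norm. The factor sqrt (2 r) bounds the norm of
  the projection onto the joint range of U and V. The norm of \<open>\<Delta>\<close> inside it is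
  still unknown and is resolved in \<open>norm_Delta_le\<close>.\<close>

definition \<eta> where "\<eta> = \<nu> + \<epsilon> * sqrt (2 * real r) * norm \<Delta>"

lemma eps_le: "\<epsilon> \<le> 1/12"
proof -
  have "1 * \<epsilon> \<le> real r * \<epsilon>" using r_pos eps_nonneg by (intro mult_right_mono) auto
  then show ?thesis using eps_small by linarith
qed

lemma nu_nonneg: "0 \<le> \<nu>"
  using N_bound by (rule quad_bound_nonneg)

lemma eta_nonneg: "0 \<le> \<eta>"
  unfolding \<eta>_def using eps_nonneg nu_nonneg by simp

lemma Delta_sym: "\<Delta>\<^sup>t = \<Delta>"
  by (simp add: \<Delta>_def M_sym)

lemma Delta_supp: "idm d * \<Delta> = \<Delta>"
  by (simp add: \<Delta>_def right_diff_distrib M_supp mult.assoc[symmetric] U_supp)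

lemma B_sym: "B\<^sup>t = B"
  by (simp add: B_def M_sym N_sym defect_op_sym[OF Delta_sym])

lemma B_supp: "idm d * B = B" "B * idm d = B"
proof -
  show *: "idm d * B = B"
    by (simp add: B_def algebra_simps M_supp N_supp defect_op_supp[OF Delta_supp])
  then show "B * idm d = B" by (metis B_sym ft_idm ft_mult)
qed

lemma gradient_eq: "U * U\<^sup>t - M + defect_op (U * U\<^sup>t - M) - N = U * U\<^sup>t - B"
  by (simp add: B_def \<Delta>_def)

lemma B_U: "B * U = U * (U\<^sup>t * U) + lam *\<^sub>R U"
  using first_order unfolding gradient_eq by (simp add: algebra_simps)

lemma Delta_proj:
  assumes "P * U = U" "P * V = V"
  shows "P * \<Delta> = \<Delta>"
proof -
  have "P * M = M" using M_range assms(2) by (metis mult.assoc)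
  then show ?thesis using assms(1) by (simp add: \<Delta>_def right_diff_distrib mult.assoc[symmetric])
qed

lemma perturbation_bound: "quad_bound \<eta> (N - defect_op \<Delta>)"
proof -
  obtain P where P: "proj P" "P * U = U" "P * V = V" "(norm P)\<^sup>2 \<le> 2 * real r" "idm d * P = P"
    using ex_proj_pair[OF U_supp V_supp] by blast
  have "norm P \<le> sqrt (2 * real r)" using P(4) by (intro real_le_rsqrt) simp
  then have "\<epsilon> * norm P * norm \<Delta> \<le> \<epsilon> * sqrt (2 * real r) * norm \<Delta>"
    using eps_nonneg by (intro mult_right_mono mult_left_mono) auto
  then have "quad_bound (\<epsilon> * sqrt (2 * real r) * norm \<Delta>) (defect_op \<Delta>)"
    using quad_bound_mono[OF defect_op_quad_bound[OF Delta_sym P(1) Delta_proj[OF P(2,3)] P(5)]] by blast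
  then show ?thesis unfolding \<eta>_def by (intro quad_bound_diff N_bound)
qed

lemma inner_B: "inner Y (B * Y) = inner Y (M * Y) + inner Y ((N - defect_op \<Delta>) * Y)"
  by (simp add: B_def algebra_simps inner_add_right inner_diff_right)

lemma B_lower: "- \<eta> * (norm Y)\<^sup>2 \<le> inner Y (B * Y)"
  using inner_B[of Y] M_psd[of Y] quad_boundD[OF perturbation_bound, of Y] by linarith

text \<open>The second-order condition in the direction h k^t. As h is orthogonal to the range of U,
  the two halves of the symmetrised product are orthogonal, each of norm |U k| |h|. Replacing the
  empirical form by the Frobenius norm costs four rank-one defects, hence 2 \<epsilon> after
  halving.\<close>

lemma curvature:
  assumes h: "is_col h" "idm d * h = h" "U\<^sup>t * h = 0" and k: "is_col k" "idm r * k = k"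
  shows "inner h (B * h) * (norm k)\<^sup>2 \<le> (1 + 2 * \<epsilon>) * (norm (U * k))\<^sup>2 * (norm h)\<^sup>2 + lam * (norm h)\<^sup>2 * (norm k)\<^sup>2"
proof -
  define H where "H = h * k\<^sup>t"
  have H: "idm d * H = H" "H * idm r = H"
    using h k by (simp_all add: H_def mult.assoc[symmetric]) (metis ft_idm ft_mult mult.assoc)
  let ?a = "U * k" let ?S = "?a * h\<^sup>t + h * ?a\<^sup>t"
  have a: "is_col ?a" "idm d * ?a = ?a" using k U_supp by (simp_all add: is_col_mult mult.assoc[symmetric])
  have S: "U * H\<^sup>t + H * U\<^sup>t = ?S" by (simp add: H_def mult.assoc)
  have ha: "inner h ?a = 0" "inner ?a h = 0"
    by (metis h(3) inner_commute inner_mult_left inner_zero_right)+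
  have nS: "(norm ?S)\<^sup>2 = 2 * ((norm ?a)\<^sup>2 * (norm h)\<^sup>2)"
    by (simp add: power2_norm_eq_inner inner_add_left inner_add_right inner_outer a h ha del: ft_mult)
  have "\<bar>defect ?S ?S\<bar> \<le> 4 * (\<epsilon> * norm ?a * norm h * norm ?a * norm h)"
    using defect_cols[of ?a h ?a h] defect_cols[of ?a h h ?a] defect_cols[of h ?a ?a h] defect_cols[of h ?a h ?a] a h
    by (simp add: defect_add_left defect_add_right mult_ac del: ft_mult)
  then have "(\<Sum>i<n. (inner (X i) ?S)\<^sup>2) / real n \<le> (2 + 4 * \<epsilon>) * ((norm ?a)\<^sup>2 * (norm h)\<^sup>2)"
    using sum_squares_eq_defect[of ?S] nS by (simp add: algebra_simps power2_eq_square)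
  then have 1: "(\<Sum>i<n. (inner (X i) ?S)\<^sup>2) / (2 * real n) \<le> (1 + 2 * \<epsilon>) * ((norm ?a)\<^sup>2 * (norm h)\<^sup>2)"
    by (simp add: field_simps)
  have "(U * U\<^sup>t - B) * H = - (B * h) * k\<^sup>t"
    using h(3) by (simp add: H_def left_diff_distrib mult.assoc) (simp add: mult.assoc[symmetric])
  then have "inner H ((U * U\<^sup>t - B) * H) = - (inner h (B * h) * (norm k)\<^sup>2)"
    using inner_outer[OF h(1) is_col_mult[OF h(1), of B] k(1), of k]
    by (simp add: H_def power2_norm_eq_inner)
  moreover have "(norm H)\<^sup>2 = (norm h)\<^sup>2 * (norm k)\<^sup>2"
    by (simp add: H_def norm_outer h k power_mult_distrib)
  ultimately show ?thesis using second_order[OF H] 1 unfolding S gradient_eq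
    by (simp add: mult_ac)
qed

text \<open>Chosen so that <h, B h> > \<tau> |h|^2, put into \<open>curvature\<close>, cancels lam
  and the factor 1 + 2 \<epsilon> and leaves |U k|^2 > \<eta> |k|^2.\<close>

definition \<tau> where "\<tau> = (1 + 2 * \<epsilon>) * \<eta> + lam"

lemma tau_nonneg: "0 \<le> \<tau>"
  unfolding \<tau>_def using eps_nonneg eta_nonneg lam_nonneg by simp

text \<open>If the bound failed, every direction in the range of U would also carry curvature of B above
  the noise level, giving a space of dimension r + 1 on which B exceeds its value on the kernel of M.\<close>

lemma complement_upper_col:
  assumes h: "is_col h" "idm d * h = h" "U\<^sup>t * h = 0"
  shows "inner h (B * h) \<le> \<tau> * (norm h)\<^sup>2"
proof (rule ccontr)
  assume "\<not> ?thesis"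
  then have big: "\<tau> * (norm h)\<^sup>2 < inner h (B * h)" by simp
  have h0: "h \<noteq> 0" using big by auto
  have eta_lt: "\<eta> * (norm h)\<^sup>2 < inner h (B * h)"
  proof -
    have "0 \<le> 2 * \<epsilon> * \<eta> + lam" using eps_nonneg eta_nonneg lam_nonneg by simp
    then have "\<eta> * (norm h)\<^sup>2 \<le> \<tau> * (norm h)\<^sup>2"
      unfolding \<tau>_def by (intro mult_right_mono) (auto simp: algebra_simps)
    then show ?thesis using big by linarith
  qed
  have Uk: "\<eta> * (norm k)\<^sup>2 < (norm (U * k))\<^sup>2" if k: "is_col k" "idm r * k = k" "k \<noteq> 0" for k
  proof -
    have "\<tau> * (norm h)\<^sup>2 * (norm k)\<^sup>2 < inner h (B * h) * (norm k)\<^sup>2"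
      using big k(3) by (intro mult_strict_right_mono) auto
    also have "\<dots> \<le> ((1 + 2 * \<epsilon>) * (norm (U * k))\<^sup>2 + lam * (norm k)\<^sup>2) * (norm h)\<^sup>2"
      using curvature[OF h k(1,2)] by (simp add: algebra_simps)
    finally have "(norm h)\<^sup>2 * (\<tau> * (norm k)\<^sup>2) < (norm h)\<^sup>2 * ((1 + 2 * \<epsilon>) * (norm (U * k))\<^sup>2 + lam * (norm k)\<^sup>2)"
      by (simp add: mult_ac)
    then have "\<tau> * (norm k)\<^sup>2 < (1 + 2 * \<epsilon>) * (norm (U * k))\<^sup>2 + lam * (norm k)\<^sup>2"
      using h0 by simp
    then have "(1 + 2 * \<epsilon>) * (\<eta> * (norm k)\<^sup>2) < (1 + 2 * \<epsilon>) * (norm (U * k))\<^sup>2"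
      by (simp add: \<tau>_def algebra_simps)
    then show ?thesis using eps_nonneg by simp
  qed
  have W: "idm r * (V\<^sup>t * U) = V\<^sup>t * U" "V\<^sup>t * U * idm r = V\<^sup>t * U" "idm r * (V\<^sup>t * h) = V\<^sup>t * h"
    using V_supp U_supp by (metis ft_idm ft_mult mult.assoc)+
  \<comment> \<open>There are r + 1 directions, the columns of U and h, against the r equations V^t
    x = 0.\<close>
  obtain k t where k: "is_col k" "idm r * k = k" "k \<noteq> 0 \<or> t \<noteq> 0" "V\<^sup>t * U * k + t *\<^sub>R (V\<^sup>t * h) = 0"
    using ex_kernel_vector[OF W(1,2) is_col_mult[OF h(1)] W(3)] .
  define x where "x = U * k + t *\<^sub>R h"
  have "V\<^sup>t * x = 0" using k(4) by (simp add: x_def distrib_left mult.assoc)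
  then have "M * x = 0" by (rule M_kernel)
  then have up: "inner x (B * x) \<le> \<eta> * (norm x)\<^sup>2"
    using inner_B[of x] quad_boundD[OF perturbation_bound, of x] by simp
  have orth: "inner h (U * y) = 0" "inner (U * y) h = 0" for y
    by (metis h(3) inner_commute inner_mult_left inner_zero_right)+
  have hBU: "inner h (B * (U * k)) = 0" "inner (U * k) (B * h) = 0"
  proof -
    have "B * (U * k) = U * (U\<^sup>t * U * k + lam *\<^sub>R k)"
      using B_U by (simp add: distrib_left mult.assoc[symmetric]) (simp add: distrib_right mult.assoc)
    then show "inner h (B * (U * k)) = 0" using orth by simp
    then show "inner (U * k) (B * h) = 0" by (metis B_sym inner_commute inner_symmetric_mult)
  qed
  have UBU: "inner (U * k) (B * (U * k)) = (norm (U\<^sup>t * (U * k)))\<^sup>2 + lam * (norm (U * k))\<^sup>2"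
  proof -
    have "B * (U * k) = U * (U\<^sup>t * (U * k)) + lam *\<^sub>R (U * k)"
      using B_U by (simp add: mult.assoc[symmetric]) (simp add: distrib_right mult.assoc)
    then have "inner (U * k) (B * (U * k)) = inner (U * k) (U * (U\<^sup>t * (U * k))) + lam * inner (U * k) (U * k)"
      by (simp add: inner_add_right)
    also have "inner (U * k) (U * (U\<^sup>t * (U * k))) = (norm (U\<^sup>t * (U * k)))\<^sup>2"
      by (metis ft_ft inner_mult_left power2_norm_eq_inner)
    finally show ?thesis by (simp add: power2_norm_eq_inner)
  qed
  have xB: "inner x (B * x) = (norm (U\<^sup>t * (U * k)))\<^sup>2 + lam * (norm (U * k))\<^sup>2 + t\<^sup>2 * inner h (B * h)"
    by (simp add: x_def distrib_left inner_add_left inner_add_right hBU UBU power2_eq_square)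
  have nx: "(norm x)\<^sup>2 = (norm (U * k))\<^sup>2 + t\<^sup>2 * (norm h)\<^sup>2"
    by (simp add: x_def power2_norm_eq_inner inner_add_left inner_add_right orth power2_eq_square[of t])
  have t: "\<eta> * (t\<^sup>2 * (norm h)\<^sup>2) \<le> t\<^sup>2 * inner h (B * h)"
    using mult_left_mono[OF less_imp_le[OF eta_lt], of "t\<^sup>2"] by (simp add: mult_ac)
  \<comment> \<open>Cauchy-Schwarz in |U k|^2 = <k, U^t U k> carries the excess over \<eta> from U^t
    U to U U^t on the range of U.\<close>
  have Uk2: "\<eta> * (norm (U * k))\<^sup>2 < (norm (U\<^sup>t * (U * k)))\<^sup>2" if "k \<noteq> 0"
  proof -
    let ?a = "(norm (U * k))\<^sup>2"
    have a: "\<eta> * (norm k)\<^sup>2 < ?a" using Uk k that by blast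
    then have a0: "0 < ?a" using eta_nonneg by (meson le_less_trans mult_nonneg_nonneg zero_le_power2)
    have "?a = inner k (U\<^sup>t * (U * k))" by (simp add: power2_norm_eq_inner inner_mult_left)
    then have "?a \<le> norm k * norm (U\<^sup>t * (U * k))" by (simp add: norm_cauchy_schwarz)
    then have "?a * ?a \<le> (norm k)\<^sup>2 * (norm (U\<^sup>t * (U * k)))\<^sup>2"
      using mult_mono[of ?a _ ?a] by (fastforce simp: power2_eq_square mult_ac)
    moreover have "(norm k)\<^sup>2 * (\<eta> * ?a) < ?a * ?a"
      using mult_strict_right_mono[OF a a0] by (simp add: mult_ac)
    ultimately have "(norm k)\<^sup>2 * (\<eta> * ?a) < (norm k)\<^sup>2 * (norm (U\<^sup>t * (U * k)))\<^sup>2" by linarith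
    then show ?thesis by (simp add: mult_less_cancel_left)
  qed
  have "\<eta> * (norm x)\<^sup>2 < inner x (B * x)"
  proof (cases "k = 0")
    case True
    then have "t\<^sup>2 > 0" using k(3) by simp
    then have "\<eta> * (t\<^sup>2 * (norm h)\<^sup>2) < t\<^sup>2 * inner h (B * h)"
      using mult_strict_left_mono[OF eta_lt, of "t\<^sup>2"] by (simp add: mult_ac)
    then show ?thesis using True by (simp add: xB nx)
  next
    case False
    have "0 \<le> lam * (norm (U * k))\<^sup>2" using lam_nonneg by simp
    then show ?thesis using Uk2[OF False] t unfolding xB nx distrib_left by linarith
  qed
  then show False using up by simp
qed

lemma complement_bound:
  assumes h: "idm d * H = H" "U\<^sup>t * H = 0"
  shows "\<bar>inner H (B * H)\<bar> \<le> \<tau> * (norm H)\<^sup>2"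
proof -
  have "inner H (B * H) \<le> \<tau> * (norm H)\<^sup>2"
    by (rule quad_le_of_columns[of "\<lambda>x. idm d * x = x \<and> U\<^sup>t * x = 0"])
      (use complement_upper_col h in \<open>simp_all add: mult.assoc[symmetric]\<close>)
  moreover have "\<eta> * (norm H)\<^sup>2 \<le> \<tau> * (norm H)\<^sup>2"
  proof -
    have "0 \<le> 2 * \<epsilon> * \<eta> + lam" using eps_nonneg eta_nonneg lam_nonneg by simp
    then show ?thesis unfolding \<tau>_def by (intro mult_right_mono) (auto simp: algebra_simps)
  qed
  ultimately show ?thesis using B_lower[of H] by simp
qed

text \<open>A choice, so that all later facts speak of one projection; the listed properties
  determine it as the projection onto the range of U.\<close>

definition P where
  "P = (SOME P. proj P \<and> P * U = U \<and> (norm P)\<^sup>2 \<le> real r \<and> (\<forall>Z. U\<^sup>t * Z = 0 \<longrightarrow> P * Z = 0))"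

lemma P: "proj P" "P * U = U" "(norm P)\<^sup>2 \<le> real r" "U\<^sup>t * Z = 0 \<Longrightarrow> P * Z = 0"
proof -
  have "\<exists>P. proj P \<and> P * U = U \<and> (norm P)\<^sup>2 \<le> real r \<and> (\<forall>Z. U\<^sup>t * Z = 0 \<longrightarrow> P * Z = 0)"
    using ex_proj_range[OF U_supp(2)] by metis
  from someI_ex[OF this] show "proj P" "P * U = U" "(norm P)\<^sup>2 \<le> real r" "U\<^sup>t * Z = 0 \<Longrightarrow> P * Z = 0"
    unfolding P_def by blast+
qed

lemma P_supp: "idm d * P = P" "P * idm d = P"
proof -
  show "idm d * P = P" using proj_range_supp[OF P(1) P(4) U_supp(1)] by blast
  then show "P * idm d = P" by (metis P(1) ft_idm ft_mult projD(1))
qed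

text \<open>By the first-order condition B - U U^t - lam annihilates U from the left; by symmetry
  U^t annihilates it too, hence so does P. In particular P and B commute.\<close>

lemma P_B: "P * B = U * U\<^sup>t + lam *\<^sub>R P" "B * P = U * U\<^sup>t + lam *\<^sub>R P"
proof -
  let ?C = "B - U * U\<^sup>t - lam *\<^sub>R idm d"
  have "?C * U = 0" using B_U U_supp by (simp add: left_diff_distrib mult.assoc)
  moreover have "?C\<^sup>t = ?C" by (simp add: B_sym)
  ultimately have "U\<^sup>t * ?C = 0" by (metis ft_linear(1) ft_mult)
  then have "P * ?C = 0" by (rule P(4))
  then show 1: "P * B = U * U\<^sup>t + lam *\<^sub>R P"
    using P(2) P_supp by (simp add: right_diff_distrib mult.assoc[symmetric]) (simp add: diff_eq_eq add.commute)
  have "B * P = (P * B)\<^sup>t" using B_sym P(1) by (simp add: projD)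
  then show "B * P = U * U\<^sup>t + lam *\<^sub>R P" unfolding 1 using P(1) by (simp add: projD)
qed

text \<open>As P commutes with B, this is the compression of B to the orthogonal complement of the
  range of U.\<close>

definition R where "R = B - P * B"

lemma R: "R\<^sup>t = R" "R * U = 0" "B = U * U\<^sup>t + lam *\<^sub>R P + R"
proof -
  have PB: "P * B = B * P" by (simp add: P_B)
  show "R\<^sup>t = R" using B_sym P(1) PB by (simp add: R_def projD)
  show "R * U = 0" unfolding R_def PB using P(2) by (simp add: left_diff_distrib mult.assoc)
  show "B = U * U\<^sup>t + lam *\<^sub>R P + R" unfolding R_def P_B(1) by simp
qed

lemma R_bound: "quad_bound \<tau> R"
  unfolding quad_bound_def
proof
  fix Y
  let ?Z = "idm d * Y"
  let ?H = "?Z - P * ?Z"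
  have PB: "P * B = B * P" by (simp add: P_B)
  have RP: "R * P = 0" unfolding R_def using P(1)
    by (simp add: left_diff_distrib mult.assoc PB[symmetric]) (simp add: mult.assoc[symmetric] projD)
  have PH: "P * ?H = 0" using P(1) by (simp add: right_diff_distrib projD)
  have UH: "U\<^sup>t * ?H = 0"
    using P(1,2) by (metis (no_types, opaque_lifting) PH ft_mult mult.assoc mult_zero_right projD(1))
  have H: "idm d * ?H = ?H" by (simp add: right_diff_distrib mult.assoc[symmetric] P_supp)
  have RZ: "R * ?Z = R * Y"
    by (metis (no_types, opaque_lifting) B_supp(2) R_def left_diff_distrib mult.assoc)
  have RH: "R * ?H = B * ?H" "R * ?H = R * Y"
  proof -
    show "R * ?H = B * ?H" unfolding R_def PB by (simp only: left_diff_distrib mult.assoc PH) simp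
    show "R * ?H = R * Y" using RP RZ by (simp add: right_diff_distrib mult.assoc[symmetric])
  qed
  have "inner Y (R * Y) = inner (R * ?H) Y" using RH(2) by (simp add: inner_commute)
  also have "\<dots> = inner ?H (R * ?H)" by (metis RH(2) R(1) inner_symmetric_mult)
  finally have "\<bar>inner Y (R * Y)\<bar> \<le> \<tau> * (norm ?H)\<^sup>2"
    using complement_bound[OF H UH] RH by simp
  also have "\<dots> \<le> \<tau> * (norm Y)\<^sup>2"
    using proj_compl_norm_le[OF P(1), of ?Z] proj_norm_le[OF proj_idm, of d Y] tau_nonneg
    by (intro mult_left_mono power_mono) auto
  finally show "\<bar>inner Y (R * Y)\<bar> \<le> \<tau> * (norm Y)\<^sup>2" .
qed

text \<open>Solve M + N - \<open>defect_op \<Delta>\<close> = U U^t + lam P + R for U U^t - M; every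
  term on the other side is bounded in operator norm.\<close>

lemma Delta_quad: "quad_bound (\<eta> + lam + \<tau>) \<Delta>"
proof -
  have "\<Delta> = (N - defect_op \<Delta>) - lam *\<^sub>R P - R"
    using R(3) unfolding B_def by (simp add: \<Delta>_def algebra_simps)
  moreover have "quad_bound lam (lam *\<^sub>R P)"
    using quad_boundD[OF proj_quad_bound[OF P(1)]] lam_nonneg
    by (auto simp: quad_bound_def abs_mult intro: mult_left_mono)
  ultimately show ?thesis by (metis quad_bound_diff perturbation_bound R_bound)
qed

lemma norm_Delta_le_quad: "norm \<Delta> \<le> sqrt (2 * real r) * (\<eta> + lam + \<tau>)"
proof -
  obtain P where P: "proj P" "P * U = U" "P * V = V" "(norm P)\<^sup>2 \<le> 2 * real r" "idm d * P = P"
    using ex_proj_pair[OF U_supp V_supp] by blast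
  have "\<Delta> = (\<Delta> * P)\<^sup>t" using Delta_proj[OF P(2,3)] P(1) by (simp add: Delta_sym projD)
  then have "norm \<Delta> = norm (\<Delta> * P)" by (metis norm_ft)
  also have "\<dots> \<le> (\<eta> + lam + \<tau>) * norm P" by (rule quad_bound_norm[OF Delta_sym Delta_quad])
  also have "\<dots> \<le> (\<eta> + lam + \<tau>) * sqrt (2 * real r)"
    using P(4) quad_bound_nonneg[OF Delta_quad] by (intro mult_left_mono real_le_rsqrt) auto
  finally show ?thesis by (simp add: mult.commute)
qed

text \<open>This closes the circle between \<open>\<eta>\<close> and the norm of
  \<open>\<Delta>\<close>: the latter returns with a coefficient below 1 and is absorbed.\<close>

lemma norm_Delta_le: "norm \<Delta> \<le> 2 * sqrt (2 * real r) * (3 * \<nu> + 2 * lam)"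
  and eta_le: "\<eta> \<le> 2 * \<nu> + lam"
proof -
  let ?q = "sqrt (2 * real r)"
  have qq: "?q * ?q = 2 * r" by simp
  have "2 * \<epsilon> * \<eta> \<le> 1 * \<eta>" using eps_le eta_nonneg by (intro mult_right_mono) auto
  then have "\<eta> + lam + \<tau> \<le> 3 * \<eta> + 2 * lam" unfolding \<tau>_def by (simp add: algebra_simps)
  then have "norm \<Delta> \<le> ?q * (3 * \<eta> + 2 * lam)"
    using norm_Delta_le_quad mult_left_mono[of "\<eta> + lam + \<tau>" "3 * \<eta> + 2 * lam" ?q] by fastforce
  \<comment> \<open>Unfolding \<open>\<eta>\<close> reproduces the norm of \<open>\<Delta>\<close>
    with coefficient 3 \<epsilon> * 2 r = 6 r \<epsilon>, at most 1/2.\<close>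
  also have "\<dots> = ?q * (3 * \<nu> + 2 * lam) + 6 * (r * \<epsilon>) * norm \<Delta>"
    unfolding \<eta>_def using qq by (simp add: algebra_simps)
  also have "6 * (r * \<epsilon>) * norm \<Delta> \<le> 1/2 * norm \<Delta>"
    using eps_small by (intro mult_right_mono) auto
  finally show 1: "norm \<Delta> \<le> 2 * ?q * (3 * \<nu> + 2 * lam)" by simp
  have "\<epsilon> * ?q * norm \<Delta> \<le> \<epsilon> * ?q * (2 * ?q * (3 * \<nu> + 2 * lam))"
    using eps_nonneg by (intro mult_left_mono 1) auto
  also have "\<dots> = 4 * (r * \<epsilon>) * (3 * \<nu> + 2 * lam)" using qq by (simp add: algebra_simps)
  also have "\<dots> \<le> 1/3 * (3 * \<nu> + 2 * lam)"
    using eps_small nu_nonneg lam_nonneg by (intro mult_right_mono) auto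
  finally show "\<eta> \<le> 2 * \<nu> + lam" unfolding \<eta>_def using lam_nonneg by simp
qed

lemma tau_le: "\<tau> \<le> 4 * \<nu> + 3 * lam"
proof -
  have "2 * \<epsilon> * \<eta> \<le> 1 * \<eta>" using eps_le eta_nonneg by (intro mult_right_mono) auto
  then have "\<tau> \<le> 2 * \<eta> + lam" unfolding \<tau>_def by (simp add: algebra_simps)
  then show ?thesis using eta_le by linarith
qed

text \<open>Applied with c = 0 to U and with c = lam to the debiased factor. The loss is the bound
  for \<eta> + lam + \<tau>: 6 = 2 + 4 and 5 = 1 + 1 + 3.\<close>

lemma factor_lower:
  assumes F: "F * idm r = F" "F * F\<^sup>t = U * U\<^sup>t + c *\<^sub>R P" "0 \<le> c"
    and m: "s + (6 * \<nu> + 5 * lam) \<le> m" "0 < s" and z: "idm r * z = z"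
  shows "s * (norm z)\<^sup>2 \<le> (norm (F * z))\<^sup>2"
proof (rule factor_lower_bound[OF F(1) m(2) _ z])
  fix y assume y: "idm r * y = y"
  let ?x = "V * y"
  have "\<eta> + lam + \<tau> \<le> 6 * \<nu> + 5 * lam" using tau_le eta_le by linarith
  then have "(\<eta> + lam + \<tau>) * (norm ?x)\<^sup>2 \<le> (6 * \<nu> + 5 * lam) * (norm y)\<^sup>2"
    unfolding norm_V[OF y] by (intro mult_right_mono) auto
  then have 1: "- inner ?x (\<Delta> * ?x) \<le> (6 * \<nu> + 5 * lam) * (norm y)\<^sup>2"
    using quad_boundD[OF Delta_quad, of ?x] by linarith
  have "U * U\<^sup>t = M + \<Delta>" by (simp add: \<Delta>_def)
  then have "F * (F\<^sup>t * ?x) = M * ?x + \<Delta> * ?x + c *\<^sub>R (P * ?x)"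
    by (simp only: mult.assoc[symmetric] F(2)) (simp add: distrib_right mult.assoc)
  then have "inner ?x (F * (F\<^sup>t * ?x)) = inner ?x (M * ?x) + inner ?x (\<Delta> * ?x) + c * (norm (P * ?x))\<^sup>2"
    by (simp add: inner_add_right proj_inner[OF P(1)])
  moreover have "0 \<le> c * (norm (P * ?x))\<^sup>2" using F(3) by simp
  moreover have "(s + (6 * \<nu> + 5 * lam)) * (norm y)\<^sup>2 \<le> m * (norm y)\<^sup>2" using m(1) by (intro mult_right_mono) auto
  ultimately show "s * (norm y)\<^sup>2 \<le> inner ?x (F * (F\<^sup>t * ?x))"
    using M_lower[OF y] 1 unfolding distrib_right by linarith
qed

end

text \<open>R sees only the part Q of F' orthogonal to the range of F. Up to sign and transpose, F'
  Q^t is the part of D = F F^t - F' F'^t orthogonal to that range, so the lower bound on F' gives s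
  |Q|^2 \<le> |D|^2. The pairing with R is thus quadratic in D, with a coefficient set by the ratio
  of \<rho> to s.\<close>

lemma residual_inner_le:
  assumes R: "R\<^sup>t = R" "R * F = 0" "quad_bound \<rho> R" and F: "F * idm r = F" and F': "F' * idm r = F'"
    and lower: "\<And>z. idm r * z = z \<Longrightarrow> s * (norm z)\<^sup>2 \<le> (norm (F' * z))\<^sup>2" and s: "4 * \<rho> \<le> s"
  shows "inner F' (R * F') \<le> (norm (F * F\<^sup>t - F' * F'\<^sup>t))\<^sup>2 / 4"
proof -
  obtain P where P: "proj P" "P * F = F" "\<And>Z. F\<^sup>t * Z = 0 \<Longrightarrow> P * Z = 0"
    using ex_proj_range[OF F] by metis
  let ?D = "F * F\<^sup>t - F' * F'\<^sup>t" and ?Q = "F' - P * F'"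
  have "F\<^sup>t * R = 0" by (metis R(1,2) ft_linear(1) ft_mult)
  then have PR: "P * R = 0" by (rule P(3))
  then have RP: "R * P = 0" by (metis P(1) R(1) ft_linear(1) ft_mult projD(1))
  have "R * F' = R * ?Q" using RP by (simp add: right_diff_distrib mult.assoc[symmetric])
  then have "inner F' (R * F') = inner ?Q (R * ?Q)" by (metis R(1) inner_symmetric_mult)
  then have 1: "inner F' (R * F') \<le> \<rho> * (norm ?Q)\<^sup>2" using quad_boundD[OF R(3), of ?Q] by linarith
  have "idm r * ?Q\<^sup>t = ?Q\<^sup>t"
    using F' by (metis ft_idm ft_linear(3) ft_mult left_diff_distrib mult.assoc)
  then have Q: "s * (norm ?Q)\<^sup>2 \<le> (norm (F' * ?Q\<^sup>t))\<^sup>2"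
    using lower[of "?Q\<^sup>t"] by (simp only: norm_ft)
  have "?D - P * ?D = - (F' * ?Q\<^sup>t)\<^sup>t"
    using P(2) by (simp add: algebra_simps) (simp add: mult.assoc[symmetric])
  then have "norm (F' * ?Q\<^sup>t) = norm (?D - P * ?D)" by (metis norm_ft norm_minus_cancel)
  then have "norm (F' * ?Q\<^sup>t) \<le> norm ?D" using proj_compl_norm_le[OF P(1), of ?D] by (simp only:)
  from order_trans[OF Q power_mono[OF this, of 2]]
  have "s * (norm ?Q)\<^sup>2 \<le> (norm ?D)\<^sup>2" by simp
  moreover have "4 * \<rho> * (norm ?Q)\<^sup>2 \<le> s * (norm ?Q)\<^sup>2" using s by (intro mult_right_mono) auto
  ultimately show ?thesis using 1 by simp
qed

text \<open>The classical formula for the projection, with G the inverse of the Gram matrix; it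
  identifies the debiasing correction with lam P.\<close>

lemma (in stationary) P_eq:
  assumes "idm r * G = G" "U\<^sup>t * U * G = idm r"
  shows "U * (G * U\<^sup>t) = P"
proof -
  let ?P = "U * (G * U\<^sup>t)"
  have "idm r * U\<^sup>t = U\<^sup>t" using U_supp(2) by (metis ft_idm ft_mult)
  then have "U\<^sup>t * ?P = U\<^sup>t" using assms(2) by (metis mult.assoc)
  then have "P * (P - ?P) = 0"
    using P(1,2) by (intro P(4)) (simp add: right_diff_distrib, metis ft_mult projD(1))
  then show ?thesis using P(1,2) by (simp add: right_diff_distrib projD mult.assoc[symmetric])
qed

lemma inner_gram: "inner (A * A\<^sup>t) R = inner A (R * A)"
  by (simp add: inner_mult_right)

text \<open>Debiasing makes both matrices B a Gram matrix plus a residual annihilating its own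
  factor. Pairing D with the residuals therefore leaves only <U0, R1 U0> and <F, R0 F>, and
  \<open>residual_inner_le\<close> applies with the roles of the two factors exchanged.\<close>

theorem stationary_comparison:
  assumes S0: "stationary d n X \<epsilon> r M V m N U0 \<nu> 0"
    and S1: "stationary d n X \<epsilon> r M V m N U1 \<nu> lam"
    and F: "F * idm r = F" "F = U1 * K" "F * F\<^sup>t = U1 * U1\<^sup>t + lam *\<^sub>R (U1 * (G * U1\<^sup>t))"
    and G: "idm r * G = G" "U1\<^sup>t * U1 * G = idm r"
    and m: "22 * \<nu> + 17 * lam < m"
  shows "norm (F * F\<^sup>t - U0 * U0\<^sup>t) \<le> 8 * (real r * \<epsilon>) * sqrt (2 * real r) * (6 * \<nu> + 2 * lam)"
proof -
  interpret S0: stationary d n X \<epsilon> r M V m N U0 \<nu> 0 by (rule S0)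
  interpret S1: stationary d n X \<epsilon> r M V m N U1 \<nu> lam by (rule S1)
  \<comment> \<open>The curvature that \<open>factor_lower\<close> leaves in either factor.
    \<open>residual_inner_le\<close> asks for s \<ge> 4 (4 \<nu> + 3 lam) by \<open>tau_le\<close>;
    hence 22 = 6 + 16 and 17 = 5 + 12.\<close>
  define s where "s = m - (6 * \<nu> + 5 * lam)"
  have s: "0 < s" "s + (6 * \<nu> + 5 * lam) \<le> m" "s + (6 * \<nu> + 5 * 0) \<le> m"
    "4 * (4 * \<nu> + 3 * lam) \<le> s" "4 * (4 * \<nu> + 3 * 0) \<le> s"
    using m S0.nu_nonneg S1.lam_nonneg unfolding s_def by auto
  have FF: "F * F\<^sup>t = U1 * U1\<^sup>t + lam *\<^sub>R S1.P" using F(3) S1.P_eq[OF G] by simp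
  have B1: "S1.B = F * F\<^sup>t + S1.R" using S1.R(3) FF by simp
  have B0: "S0.B = U0 * U0\<^sup>t + S0.R" using S0.R(3) by simp
  let ?D = "F * F\<^sup>t - U0 * U0\<^sup>t" and ?E = "U0 * U0\<^sup>t - U1 * U1\<^sup>t"
  have RF: "S1.R * F = 0" using S1.R(2) F(2) by (simp add: mult.assoc[symmetric])
  have R1: "inner U0 (S1.R * U0) \<le> (norm ?D)\<^sup>2 / 4"
    by (rule residual_inner_le[OF S1.R(1) RF _ F(1) S0.U_supp(2) _ s(4)])
      (use quad_bound_mono[OF S1.R_bound S1.tau_le] S0.factor_lower[of U0 0 s] S0.U_supp s in auto)
  have "inner F (S0.R * F) \<le> (norm (U0 * U0\<^sup>t - F * F\<^sup>t))\<^sup>2 / 4"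
    by (rule residual_inner_le[OF S0.R(1,2) _ S0.U_supp(2) F(1) _ s(5)])
      (use quad_bound_mono[OF S0.R_bound S0.tau_le] S1.factor_lower[OF F(1) FF S1.lam_nonneg s(2,1)] in auto)
  then have R0: "inner F (S0.R * F) \<le> (norm ?D)\<^sup>2 / 4" by (simp add: norm_minus_commute)
  \<comment> \<open>Signal and noise cancel here; only the deviation operator at the difference of
    the two estimators survives.\<close>
  have BB: "S1.B - S0.B = S0.defect_op ?E"
    unfolding S1.B_def S0.B_def S0.defect_op_diff[symmetric]
    by (simp add: S0.defect_op_diff S1.\<Delta>_def S0.\<Delta>_def)
  obtain P where P: "proj P" "P * U1 = U1" "P * U0 = U0" "(norm P)\<^sup>2 \<le> 2 * real r" "idm d * P = P"
    using ex_proj_pair[OF S1.U_supp S0.U_supp] by blast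
  have PF: "P * F = F" using P(2) F(2) by (simp add: mult.assoc[symmetric])
  have PE: "P * ?E = ?E" "P * ?D = ?D"
    using P(2,3) PF by (simp_all add: right_diff_distrib mult.assoc[symmetric])
  have E_norm: "norm ?E \<le> 2 * sqrt (2 * real r) * (6 * \<nu> + 2 * lam)"
  proof -
    have "?E = S0.\<Delta> - S1.\<Delta>" by (simp add: S0.\<Delta>_def S1.\<Delta>_def)
    then have "norm ?E \<le> norm S0.\<Delta> + norm S1.\<Delta>" using norm_triangle_ineq4[of S0.\<Delta> S1.\<Delta>] by simp
    then show ?thesis using S0.norm_Delta_le S1.norm_Delta_le by (simp add: algebra_simps)
  qed
  have "inner ?D (S0.defect_op ?E) = S0.defect ?E ?D"
    using S0.inner_defect_op[of ?E ?D] by (simp add: inner_commute)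
  also have "\<dots> \<le> \<epsilon> * (norm P)\<^sup>2 * norm ?E * norm ?D"
    using S0.defect_two_sided[OF P(1) PE P(5)] by simp
  also have "\<dots> \<le> \<epsilon> * (2 * real r) * norm ?E * norm ?D"
    using P(4) S0.eps_nonneg by (intro mult_right_mono mult_left_mono) auto
  finally have main: "inner ?D (S0.defect_op ?E) \<le> \<epsilon> * (2 * real r) * norm ?E * norm ?D" .
  have "inner ?D S1.R = - inner U0 (S1.R * U0)"
    using RF by (simp add: inner_diff_left inner_gram)
  moreover have "inner ?D S0.R = inner F (S0.R * F)"
    using S0.R(2) by (simp add: inner_diff_left inner_gram)
  moreover have "?D = S0.defect_op ?E - S1.R + S0.R" using BB B1 B0 by (simp add: algebra_simps)
  then have "inner ?D ?D = inner ?D (S0.defect_op ?E) - inner ?D S1.R + inner ?D S0.R"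
    by (metis inner_add_right inner_diff_right)
  ultimately have "(norm ?D)\<^sup>2 \<le> \<epsilon> * (2 * real r) * norm ?E * norm ?D + (norm ?D)\<^sup>2 / 2"
    using main R1 R0 power2_norm_eq_inner[of ?D] by linarith
  then have "norm ?D * norm ?D \<le> norm ?D * (4 * (real r * \<epsilon>) * norm ?E)"
    by (simp add: power2_eq_square field_simps)
  then have "norm ?D \<le> 4 * (real r * \<epsilon>) * norm ?E"
    using S0.eps_nonneg by (cases "norm ?D = 0") auto
  also have "\<dots> \<le> 4 * (real r * \<epsilon>) * (2 * sqrt (2 * real r) * (6 * \<nu> + 2 * lam))"
    using S0.eps_nonneg by (intro mult_left_mono E_norm) auto
  also have "\<dots> = 8 * (real r * \<epsilon>) * sqrt (2 * real r) * (6 * \<nu> + 2 * lam)" by simp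
  finally show ?thesis .
qed

section \<open>Matrix square roots by the binomial series\<close>

lemma norm_mult_col_le:
  assumes "is_col y"
  shows "norm (A * y) \<le> norm A * norm y"
proof -
  obtain n where n: "A\<^sup>t * idm n = A\<^sup>t" using ex_mult_idm by blast
  then have n': "(A * y)\<^sup>t * idm n = (A * y)\<^sup>t" by (simp add: mult.assoc)
  have "(norm (A * y))\<^sup>2 = (\<Sum>i<n. (norm ((A * y)\<^sup>t * ecol i))\<^sup>2)"
    unfolding norm_sum_columns[OF n', symmetric] norm_ft ..
  also have "\<dots> \<le> (\<Sum>i<n. (norm (A\<^sup>t * ecol i))\<^sup>2 * (norm y)\<^sup>2)"
  proof (rule sum_mono)
    fix i
    let ?a = "A\<^sup>t * ecol i"
    have a: "is_col ?a" by (intro is_col_mult is_col_ecol)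
    have "(A * y)\<^sup>t * ecol i = inner y ?a *\<^sub>R idm (Suc 0)"
      using is_col_ft_mult[OF assms a] by (simp add: mult.assoc)
    moreover have "norm (idm (Suc 0)) = 1" using norm_idm[of "Suc 0"] power2_eq_iff_nonneg[of "norm (idm (Suc 0))" 1] by simp
    ultimately have "norm ((A * y)\<^sup>t * ecol i) = \<bar>inner y ?a\<bar>" by simp
    also have "\<dots> \<le> norm y * norm ?a" by (rule Cauchy_Schwarz_ineq2)
    finally show "(norm ((A * y)\<^sup>t * ecol i))\<^sup>2 \<le> (norm ?a)\<^sup>2 * (norm y)\<^sup>2"
      by (simp add: power_mult_distrib[symmetric] mult.commute power_mono)
  qed
  also have "\<dots> = (norm A * norm y)\<^sup>2"
    unfolding sum_distrib_right[symmetric] norm_sum_columns[OF n, symmetric] norm_ft power_mult_distrib ..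
  finally show ?thesis by (rule power2_le_imp_le) simp
qed

text \<open>The Frobenius norm bounds the operator norm; this crude bound suffices to rescale a
  matrix to a contraction.\<close>

lemma quad_bound_norm_self: "quad_bound (norm A) A"
proof -
  have "\<bar>inner X (A * X)\<bar> \<le> norm A * (norm X)\<^sup>2" for X
  proof -
    obtain n where n: "X * idm n = X" using ex_mult_idm by blast
    have "\<bar>inner X (A * X)\<bar> = \<bar>\<Sum>j<n. inner (X * ecol j) (A * (X * ecol j))\<bar>"
      using inner_sum_columns[OF n, of "A * X"] by (simp add: mult.assoc)
    also have "\<dots> \<le> (\<Sum>j<n. \<bar>inner (X * ecol j) (A * (X * ecol j))\<bar>)" by (rule sum_abs)
    also have "\<dots> \<le> (\<Sum>j<n. norm A * (norm (X * ecol j))\<^sup>2)"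
    proof (rule sum_mono)
      fix j
      let ?x = "X * ecol j"
      have "\<bar>inner ?x (A * ?x)\<bar> \<le> norm ?x * norm (A * ?x)" by (rule Cauchy_Schwarz_ineq2)
      also have "\<dots> \<le> norm ?x * (norm A * norm ?x)"
        by (intro mult_left_mono norm_mult_col_le is_col_mult is_col_ecol) simp
      finally show "\<bar>inner ?x (A * ?x)\<bar> \<le> norm A * (norm ?x)\<^sup>2" by (simp add: power2_eq_square mult_ac)
    qed
    also have "\<dots> = norm A * (norm X)\<^sup>2" by (simp add: norm_sum_columns[OF n] sum_distrib_left)
    finally show ?thesis .
  qed
  then show ?thesis unfolding quad_bound_def by blast
qed

text \<open>Setting for the binomial series of (I - X)^a; \<open>ex_fourth_root\<close> takes X = I
  - A / c.\<close>

locale contraction =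
  fixes r :: nat and X :: fmat and q :: real
  assumes X_sym: "X\<^sup>t = X" and X_supp: "idm r * X = X"
    and X_bound: "quad_bound q X" and q_less: "q < 1"
begin

fun pow where
  "pow 0 = idm r"
| "pow (Suc k) = X * pow k"

lemma X_supp': "X * idm r = X"
  by (metis X_supp X_sym ft_idm ft_mult)

lemma pow_add: "pow (k + l) = pow k * pow l"
proof -
  have "idm r * pow l = pow l" for l by (cases l) (simp_all add: mult.assoc[symmetric] X_supp)
  then show ?thesis by (induction k) (simp_all add: mult.assoc)
qed

lemma pow_commute: "X * pow k = pow k * X"
  using pow_add[of k 1] pow_add[of 1 k] by (simp add: X_supp')

lemma pow_sym: "(pow k)\<^sup>t = pow k"
  by (induction k) (simp_all add: X_sym pow_commute)

lemma pow_supp: "idm r * pow k = pow k" "pow k * idm r = pow k"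
  using pow_add[of 0 k] pow_add[of k 0] by simp_all

lemma q_nonneg: "0 \<le> q"
  using X_bound by (rule quad_bound_nonneg)

lemma norm_ecol: "norm (ecol j) = 1"
  by (simp add: norm_eq_sqrt_inner inner_fmat_eq[OF supp_le_ecol] if_distrib sum.If_cases cong: if_cong)

lemma ent_le_norm: "\<bar>ent A i j\<bar> \<le> norm (A * ecol j)"
proof -
  have "inner (ecol i) (A * ecol j) = ent A i j"
  proof -
    have "(ecol i)\<^sup>t * (A * ecol j) = inner (ecol i) (A * ecol j) *\<^sub>R idm (Suc 0)"
      by (intro is_col_ft_mult is_col_ecol is_col_mult)
    moreover have "ent ((ecol i)\<^sup>t * (A * ecol j)) 0 0 = ent A i j"
    proof -
      have "supp_le (Suc i) ((ecol i)\<^sup>t)" by (simp add: supp_le_ecol)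
      from ent_mult[OF this] show ?thesis by simp
    qed
    ultimately show ?thesis by simp
  qed
  then show ?thesis using Cauchy_Schwarz_ineq2[of "ecol i" "A * ecol j"] by (simp add: norm_ecol)
qed

lemma pow_ent: "\<bar>ent (pow k) i j\<bar> \<le> q ^ k"
proof -
  have "norm (pow k * ecol j) \<le> q ^ k * norm (ecol j)"
  proof (induction k)
    case 0
    show ?case using proj_norm_le[OF proj_idm] by simp
  next
    case (Suc k)
    have "norm (pow (Suc k) * ecol j) \<le> q * norm (pow k * ecol j)"
      using quad_bound_norm[OF X_sym X_bound] by (simp add: mult.assoc)
    also have "\<dots> \<le> q * (q ^ k * norm (ecol j))" by (intro mult_left_mono Suc q_nonneg)
    finally show ?case by (simp add: mult.assoc)
  qed
  then show ?thesis using ent_le_norm[of "pow k" i j] by (simp add: norm_ecol)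
qed

definition coeff :: "real \<Rightarrow> nat \<Rightarrow> real" where "coeff a k = (a gchoose k) * (- 1) ^ k"

text \<open>The power (I - X)^a, summed entry by entry; the alternating sign in \<open>coeff\<close>
  comes from the minus sign of X. The limit stays inside the type because all powers live on the
  first r indices.\<close>

definition binser :: "real \<Rightarrow> fmat" where
  "binser a = Abs_fmat (\<lambda>i j. \<Sum>k. coeff a k * ent (pow k) i j)"

lemma summable_coeff: "summable (\<lambda>k. norm (coeff a k * ent (pow k) i j))"
proof -
  \<comment> \<open>A point strictly between q and 1: \<open>powser_insidea\<close> turns
    convergence there into absolute convergence at q.\<close>
  obtain x where x: "q < x" "x < 1" using dense[OF q_less] by blast
  have "summable (\<lambda>k. (a gchoose k) * x ^ k)"
    using gen_binomial_real[of x a] x q_nonneg by (intro sums_summable) auto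
  then have "summable (\<lambda>k. norm ((a gchoose k) * q ^ k))"
    by (rule powser_insidea) (use x q_nonneg in auto)
  then show ?thesis
  proof (rule summable_comparison_test')
    fix k :: nat
    show "norm (norm (coeff a k * ent (pow k) i j)) \<le> norm ((a gchoose k) * q ^ k)"
      using pow_ent[of k i j] q_nonneg
      by (simp add: coeff_def abs_mult power_abs mult_left_mono)
  qed
qed

lemma ent_binser: "ent (binser a) i j = (\<Sum>k. coeff a k * ent (pow k) i j)"
proof -
  have "ent (pow k) i j = 0" if "r \<le> i \<or> r \<le> j" for k i j
    using that pow_supp[of k] by (metis ent_idm_mult ent_mult_idm not_le)
  then show ?thesis unfolding binser_def by (subst ent_Abs_fmat[of r]) auto
qed

lemma binser_supp: "idm r * binser a = binser a" "binser a * idm r = binser a"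
proof -
  have "ent (pow k) i j = 0" if "r \<le> i \<or> r \<le> j" for k i j
    using that pow_supp[of k] by (metis ent_idm_mult ent_mult_idm not_le)
  then have "ent (binser a) i j = 0" if "r \<le> i \<or> r \<le> j" for i j
    using that by (simp add: ent_binser)
  then show "idm r * binser a = binser a" "binser a * idm r = binser a"
    by (auto intro!: fmat_eqI simp: not_less)
qed

lemma binser_sym: "(binser a)\<^sup>t = binser a"
proof (rule fmat_eqI)
  have "ent (pow k) i j = ent (pow k) j i" for k i j by (metis ent_ft pow_sym)
  then show "ent ((binser a)\<^sup>t) i j = ent (binser a) i j" for i j by (simp add: ent_binser)
qed

text \<open>Vandermonde's identity is the convolution identity for the coefficients.\<close>

lemma binser_mult: "binser a * binser b = binser (a + b)"
proof (rule fmat_eqI)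
  fix i j
  have sp: "supp_le r (binser a)"
    unfolding supp_le_def using binser_supp[of a] by (metis ent_idm_mult ent_mult_idm not_le)
  let ?A = "\<lambda>l k. coeff a k * ent (pow k) i l" and ?B = "\<lambda>l k. coeff b k * ent (pow k) l j"
  have "ent (binser a * binser b) i j = (\<Sum>l<r. \<Sum>k. \<Sum>m\<le>k. ?A l m * ?B l (k - m))"
    unfolding ent_mult[OF sp] ent_binser by (intro sum.cong refl Cauchy_product summable_coeff)
  also have "\<dots> = (\<Sum>k. \<Sum>l<r. \<Sum>m\<le>k. ?A l m * ?B l (k - m))"
    by (rule suminf_sum[symmetric]) (intro summable_Cauchy_product summable_coeff)
  also have "\<dots> = (\<Sum>k. coeff (a + b) k * ent (pow k) i j)"
  proof (rule suminf_cong)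
    fix k
    have "(\<Sum>l<r. \<Sum>m\<le>k. ?A l m * ?B l (k - m))
        = (\<Sum>m\<le>k. \<Sum>l<r. ?A l m * ?B l (k - m))" by (rule sum.swap)
    also have "\<dots> = (\<Sum>m\<le>k. coeff a m * coeff b (k - m) * ent (pow k) i j)"
    proof (rule sum.cong[OF refl])
      fix m assume "m \<in> {..k}"
      then have "pow k = pow m * pow (k - m)" using pow_add[of m "k - m"] by simp
      moreover have "supp_le r (pow m)"
        unfolding supp_le_def using pow_supp[of m] by (metis ent_idm_mult ent_mult_idm not_le)
      ultimately have "ent (pow k) i j = (\<Sum>l<r. ent (pow m) i l * ent (pow (k - m)) l j)"
        by (simp add: ent_mult)
      then show "(\<Sum>l<r. ?A l m * ?B l (k - m)) = coeff a m * coeff b (k - m) * ent (pow k) i j"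
        by (simp add: sum_distrib_left mult_ac)
    qed
    also have "\<dots> = coeff (a + b) k * ent (pow k) i j"
    proof -
      have "coeff (a + b) k = (\<Sum>m\<le>k. (a gchoose m) * (b gchoose (k - m))) * (- 1) ^ k"
        unfolding coeff_def gbinomial_Vandermonde[symmetric] atLeast0AtMost ..
      also have "\<dots> = (\<Sum>m\<le>k. coeff a m * coeff b (k - m))"
        unfolding sum_distrib_right
      proof (rule sum.cong[OF refl])
        fix m assume "m \<in> {..k}"
        then have "(- 1::real) ^ k = (- 1) ^ m * (- 1) ^ (k - m)" by (simp add: power_add[symmetric])
        then show "(a gchoose m) * (b gchoose (k - m)) * (- 1) ^ k = coeff a m * coeff b (k - m)"
          by (simp add: coeff_def mult_ac)
      qed
      finally show ?thesis by (simp add: sum_distrib_right)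
    qed
    finally show "(\<Sum>l<r. \<Sum>m\<le>k. ?A l m * ?B l (k - m)) = coeff (a + b) k * ent (pow k) i j" .
  qed
  finally show "ent (binser a * binser b) i j = ent (binser (a + b)) i j" by (simp add: ent_binser)
qed

lemma binser_1: "binser 1 = idm r - X"
proof (rule fmat_eqI)
  fix i j
  have z: "(1::real) gchoose k = 0" if "2 \<le> k" for k
    using binomial_gbinomial[of 1 k, where 'a = real] that by (simp add: binomial_eq_0)
  have "(\<Sum>k. coeff 1 k * ent (pow k) i j) = (\<Sum>k\<in>{..<2}. coeff 1 k * ent (pow k) i j)"
    by (rule suminf_finite) (auto simp: coeff_def z)
  also have "\<dots> = ent (idm r) i j - ent X i j"
    by (simp add: numeral_2_eq_2 coeff_def X_supp')
  finally show "ent (binser 1) i j = ent (idm r - X) i j" by (simp add: ent_binser)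
qed

end

text \<open>A fourth root and not a square root, because \<open>psd_sqrt\<close> asks for a positive
  semidefinite witness: C * C with C symmetric is one by construction, so no positivity of the
  series has to be proved.\<close>

theorem ex_fourth_root:
  assumes A: "A\<^sup>t = A" "idm r * A = A" and \<alpha>: "0 < \<alpha>"
    and pos: "\<And>Y. idm r * Y = Y \<Longrightarrow> \<alpha> * (norm Y)\<^sup>2 \<le> inner Y (A * Y)"
  obtains C where "C\<^sup>t = C" "idm r * C = C" "(C * C) * (C * C) = A"
proof -
  \<comment> \<open>Scaling by c puts the spectrum of A / c into [\<alpha> / c, 1] on the first r
    coordinates, so I - A / c contracts with factor 1 - \<alpha> / c.\<close>
  define c where "c = norm A + \<alpha>"
  have c: "0 < c" "\<alpha> \<le> c" "norm A \<le> c" using \<alpha> by (simp_all add: c_def add_nonneg_pos)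
  define X where "X = idm r - (1 / c) *\<^sub>R A"
  have Ai: "A * idm r = A" using A by (metis ft_idm ft_mult)
  have X: "X\<^sup>t = X" "idm r * X = X" "X * idm r = X" using A Ai by (simp_all add: X_def algebra_simps)
  have "quad_bound (1 - \<alpha> / c) X"
    unfolding quad_bound_def
  proof
    fix Y
    let ?Y = "idm r * Y"
    have "inner Y (X * Y) = inner ?Y (X * ?Y)"
      using X by (metis ft_idm inner_mult_left mult.assoc)
    also have "\<dots> = (norm ?Y)\<^sup>2 - inner ?Y (A * ?Y) / c"
      by (simp add: X_def left_diff_distrib inner_diff_right power2_norm_eq_inner)
    finally have eq: "inner Y (X * Y) = (norm ?Y)\<^sup>2 - inner ?Y (A * ?Y) / c" .
    have lo: "\<alpha> / c * (norm ?Y)\<^sup>2 \<le> inner ?Y (A * ?Y) / c"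
      using divide_right_mono[OF pos[of ?Y], of c] c by simp
    have "inner ?Y (A * ?Y) \<le> norm A * (norm ?Y)\<^sup>2" using quad_boundD[OF quad_bound_norm_self[of A], of ?Y] by linarith
    also have "\<dots> \<le> c * (norm ?Y)\<^sup>2" using c by (intro mult_right_mono) auto
    finally have up: "inner ?Y (A * ?Y) / c \<le> (norm ?Y)\<^sup>2" using c by (simp add: divide_le_eq mult.commute)
    have "\<bar>inner Y (X * Y)\<bar> \<le> (1 - \<alpha> / c) * (norm ?Y)\<^sup>2"
      using lo up eq by (simp add: left_diff_distrib)
    also have "\<dots> \<le> (1 - \<alpha> / c) * (norm Y)\<^sup>2"
      using c proj_norm_le[OF proj_idm, of r Y] by (intro mult_left_mono power_mono) auto
    finally show "\<bar>inner Y (X * Y)\<bar> \<le> (1 - \<alpha> / c) * (norm Y)\<^sup>2" .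
  qed
  then interpret contraction r X "1 - \<alpha> / c"
    by unfold_locales (use X c \<alpha> in auto)
  define C where "C = c powr (1/4) *\<^sub>R binser (1/4)"
  have "c powr (1/4) * (c powr (1/4) * (c powr (1/4) * c powr (1/4))) = c"
    using c by (simp add: powr_add[symmetric])
  then have "(C * C) * (C * C) = c *\<^sub>R ((binser (1/4) * binser (1/4)) * (binser (1/4) * binser (1/4)))"
    by (simp add: C_def)
  also have "\<dots> = c *\<^sub>R (idm r - X)" by (simp add: binser_mult binser_1)
  also have "\<dots> = A" using c by (simp add: X_def)
  finally show ?thesis using that[of C] by (simp add: C_def binser_sym binser_supp)
qed

section \<open>Transfer from Jordan_Normal_Form matrices\<close>

definition fmat_of :: "real mat \<Rightarrow> fmat" where
  "fmat_of A = Abs_fmat (\<lambda>i j. if i < dim_row A \<and> j < dim_col A then A $$ (i, j) else 0)"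

lemma ent_fmat_of: "ent (fmat_of A) i j = (if i < dim_row A \<and> j < dim_col A then A $$ (i, j) else 0)"
  unfolding fmat_of_def by (subst ent_Abs_fmat[of "max (dim_row A) (dim_col A)"]) auto

lemma fmat_of_inject:
  assumes "A \<in> carrier_mat m n" "B \<in> carrier_mat m n" "fmat_of A = fmat_of B"
  shows "A = B"
proof (rule eq_matI)
  fix i j assume "i < dim_row B" "j < dim_col B"
  then show "A $$ (i, j) = B $$ (i, j)"
    using assms ent_fmat_of[of A i j] ent_fmat_of[of B i j] by auto
qed (use assms in auto)

lemma fmat_of_supp: "A \<in> carrier_mat m n \<Longrightarrow> idm m * fmat_of A = fmat_of A" "A \<in> carrier_mat m n \<Longrightarrow> fmat_of A * idm n = fmat_of A"
  by (auto intro!: fmat_eqI simp: ent_fmat_of)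

lemma fmat_of_mult: "A \<in> carrier_mat m n \<Longrightarrow> B \<in> carrier_mat n k \<Longrightarrow> fmat_of (A * B) = fmat_of A * fmat_of B"
proof (rule fmat_eqI)
  fix i j assume A: "A \<in> carrier_mat m n" and B: "B \<in> carrier_mat n k"
  let ?N = "max m n"
  have sp: "supp_le ?N (fmat_of A)" using A by (auto simp: supp_le_def ent_fmat_of)
  have "ent (fmat_of A * fmat_of B) i j = (\<Sum>l<?N. ent (fmat_of A) i l * ent (fmat_of B) l j)" by (rule ent_mult[OF sp])
  also have "\<dots> = (\<Sum>l<n. ent (fmat_of A) i l * ent (fmat_of B) l j)"
    by (rule sum.mono_neutral_right) (use A in \<open>auto simp: ent_fmat_of\<close>)
  also have "\<dots> = ent (fmat_of (A * B)) i j"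
    using A B by (auto simp: ent_fmat_of scalar_prod_def atLeast0LessThan intro!: sum.cong)
  finally show "ent (fmat_of (A * B)) i j = ent (fmat_of A * fmat_of B) i j" ..
qed

lemma fmat_of_transpose: "fmat_of (A\<^sup>T) = (fmat_of A)\<^sup>t"
  by (rule fmat_eqI) (auto simp: ent_fmat_of)

lemma fmat_of_add: "A \<in> carrier_mat m n \<Longrightarrow> B \<in> carrier_mat m n \<Longrightarrow> fmat_of (A + B) = fmat_of A + fmat_of B"
  by (rule fmat_eqI) (auto simp: ent_fmat_of)

lemma fmat_of_diff: "A \<in> carrier_mat m n \<Longrightarrow> B \<in> carrier_mat m n \<Longrightarrow> fmat_of (A - B) = fmat_of A - fmat_of B"
  by (rule fmat_eqI) (auto simp: ent_fmat_of)

lemma fmat_of_smult: "fmat_of (c \<cdot>\<^sub>m A) = c *\<^sub>R fmat_of A"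
  by (rule fmat_eqI) (auto simp: ent_fmat_of)

lemma fmat_of_one: "fmat_of (1\<^sub>m n) = idm n"
  by (rule fmat_eqI) (auto simp: ent_fmat_of)

lemma frob_inner_fmat_of:
  assumes "A \<in> carrier_mat m n" "B \<in> carrier_mat m n"
  shows "frob_inner A B = inner (fmat_of A) (fmat_of B)"
proof -
  let ?N = "max m n"
  have sp: "supp_le ?N (fmat_of A)" using assms by (auto simp: supp_le_def ent_fmat_of)
  have "inner (fmat_of A) (fmat_of B) = (\<Sum>i<?N. \<Sum>j<?N. ent (fmat_of A) i j * ent (fmat_of B) i j)" by (rule inner_fmat_eq[OF sp])
  also have "\<dots> = (\<Sum>i<m. \<Sum>j<?N. ent (fmat_of A) i j * ent (fmat_of B) i j)"
    by (rule sum.mono_neutral_right) (use assms in \<open>auto simp: ent_fmat_of\<close>)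
  also have "\<dots> = (\<Sum>i<m. \<Sum>j<n. ent (fmat_of A) i j * ent (fmat_of B) i j)"
    by (intro sum.cong refl sum.mono_neutral_right) (use assms in \<open>auto simp: ent_fmat_of\<close>)
  also have "\<dots> = frob_inner A B"
    using assms unfolding frob_inner_def by (intro sum.cong) (auto simp: ent_fmat_of)
  finally show ?thesis ..
qed

lemma frob_norm_fmat_of: "frob_norm A = norm (fmat_of A)"
  unfolding frob_norm_def norm_eq_sqrt_inner by (subst frob_inner_fmat_of[of _ "dim_row A" "dim_col A"]) auto

section \<open>Square roots and inverses of concrete matrices\<close>

definition mat_of_fmat :: "nat \<Rightarrow> nat \<Rightarrow> fmat \<Rightarrow> real mat" where
  "mat_of_fmat m n A = mat m n (\<lambda>(i, j). ent A i j)"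

lemma mat_of_fmat_carrier: "mat_of_fmat m n A \<in> carrier_mat m n"
  by (simp add: mat_of_fmat_def)

lemma fmat_of_mat_of_fmat: "idm m * A = A \<Longrightarrow> A * idm n = A \<Longrightarrow> fmat_of (mat_of_fmat m n A) = A"
proof (rule fmat_eqI)
  fix i j assume "idm m * A = A" "A * idm n = A"
  then have "ent A i j = 0" if "m \<le> i \<or> n \<le> j" using that by (metis ent_idm_mult ent_mult_idm not_le)
  then show "ent (fmat_of (mat_of_fmat m n A)) i j = ent A i j" by (auto simp: ent_fmat_of mat_of_fmat_def)
qed

lemma psd_mat_square:
  fixes C :: "real mat"
  assumes C: "C \<in> carrier_mat n n" "C\<^sup>T = C"
  shows "psd_mat (C * C)"
proof -
  have "0 \<le> scalar_prod x ((C * C) *\<^sub>v x)" if x: "x \<in> carrier_vec n" for x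
  proof -
    have "scalar_prod x ((C * C) *\<^sub>v x) = scalar_prod (C *\<^sub>v x) (C *\<^sub>v x)"
      using transpose_vec_mult_scalar[OF C(1), of "C *\<^sub>v x" x] C x
      by (simp add: assoc_mult_mat_vec[of _ n n _ n] comm_scalar_prod[of _ n])
    also have "0 \<le> \<dots>" unfolding scalar_prod_def by (intro sum_nonneg) simp
    finally show ?thesis .
  qed
  then show ?thesis using C unfolding psd_mat_def by (auto simp: transpose_mult[of C n n C n])
qed

text \<open>The constant is a choice, so exhibiting one root makes its defining properties
  available; symmetry is then part of \<open>psd_mat\<close>.\<close>

lemma psd_sqrt:
  fixes A :: "real mat"
  assumes A: "A \<in> carrier_mat n n" "A\<^sup>T = A" and \<alpha>: "0 < \<alpha>"
    and pos: "\<And>Y. idm n * Y = Y \<Longrightarrow> \<alpha> * (norm Y)\<^sup>2 \<le> inner Y (fmat_of A * Y)"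
  shows "psd_sqrt A \<in> carrier_mat n n" "(psd_sqrt A)\<^sup>T = psd_sqrt A" "psd_sqrt A * psd_sqrt A = A"
proof -
  have "(fmat_of A)\<^sup>t = fmat_of A" using A(2) by (metis fmat_of_transpose)
  then obtain C where C: "C\<^sup>t = C" "idm n * C = C" "(C * C) * (C * C) = fmat_of A"
    using ex_fourth_root[OF _ fmat_of_supp(1)[OF A(1)] \<alpha> pos] by metis
  have Ci: "C * idm n = C" using C by (metis ft_idm ft_mult)
  let ?C = "mat_of_fmat n n C"
  have fC: "fmat_of ?C = C" by (rule fmat_of_mat_of_fmat[OF C(2) Ci])
  have cC: "?C \<in> carrier_mat n n" by (rule mat_of_fmat_carrier)
  have "?C\<^sup>T = ?C" by (rule fmat_of_inject[of _ n n]) (use cC fC C in \<open>auto simp: fmat_of_transpose\<close>)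
  then have "psd_mat (?C * ?C)" by (rule psd_mat_square[OF cC])
  moreover have "(?C * ?C) * (?C * ?C) = A"
    by (rule fmat_of_inject[of _ n n]) (use A cC fC C(3) in \<open>auto simp: fmat_of_mult[of _ n n _ n]\<close>)
  ultimately have "\<exists>B. psd_mat B \<and> dim_row B = dim_row A \<and> B * B = A"
    using A cC by (intro exI[of _ "?C * ?C"]) auto
  from someI_ex[OF this] have B: "psd_mat (psd_sqrt A)" "dim_row (psd_sqrt A) = dim_row A" "psd_sqrt A * psd_sqrt A = A"
    unfolding psd_sqrt_def by blast+
  show "psd_sqrt A * psd_sqrt A = A" by (rule B(3))
  show "psd_sqrt A \<in> carrier_mat n n" "(psd_sqrt A)\<^sup>T = psd_sqrt A"
    using B(1,2) A unfolding psd_mat_def by auto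
qed

text \<open>\<open>mat_inv\<close> applies \<open>the\<close> and has meaning only if
  \<open>mat_inverse\<close> succeeds. The lower bound excludes kernel vectors of the Gram matrix,
  so its determinant is nonzero.\<close>

lemma mat_inv_of_lower_bound:
  fixes U :: "real mat"
  assumes U: "U \<in> carrier_mat d r" and s: "0 < s"
    and lower: "\<And>z. idm r * z = z \<Longrightarrow> s * (norm z)\<^sup>2 \<le> (norm (fmat_of U * z))\<^sup>2"
  shows "invertible_mat (U\<^sup>T * U)" "mat_inv (U\<^sup>T * U) \<in> carrier_mat r r"
    "U\<^sup>T * U * mat_inv (U\<^sup>T * U) = 1\<^sub>m r"
proof -
  let ?A = "U\<^sup>T * U"
  have A: "?A \<in> carrier_mat r r" using U by simp
  have "det ?A \<noteq> 0"
  proof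
    assume "det ?A = 0"
    then obtain v where v: "v \<in> carrier_vec r" "v \<noteq> 0\<^sub>v r" "?A *\<^sub>v v = 0\<^sub>v r"
      using det_0_iff_vec_prod_zero_field[OF A] by blast
    \<comment> \<open>The kernel vector becomes a one-column matrix, so that the bound on U applies
      to its transfer.\<close>
    let ?Z = "mat r 1 (\<lambda>(i, j). v $ i)"
    have Z: "?Z \<in> carrier_mat r 1" by simp
    have cZ: "col ?Z 0 = v" using v by (intro eq_vecI) auto
    have "?A * ?Z = 0\<^sub>m r 1"
    proof (rule eq_matI)
      fix i j assume "i < dim_row (0\<^sub>m r 1)" "j < dim_col (0\<^sub>m r 1)"
      then have ij: "i < r" "j = 0" by auto
      then have "(?A * ?Z) $$ (i, j) = (?A *\<^sub>v v) $ i" using A U cZ by simp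
      then show "(?A * ?Z) $$ (i, j) = 0\<^sub>m r 1 $$ (i, j)" using v(3) ij by simp
    qed (use A in auto)
    moreover have "fmat_of (0\<^sub>m r 1) = 0" by (rule fmat_eqI) (auto simp: ent_fmat_of)
    ultimately have "fmat_of ?A * fmat_of ?Z = 0" using fmat_of_mult[OF A Z] by simp
    then have "(fmat_of U)\<^sup>t * (fmat_of U * fmat_of ?Z) = 0"
      using fmat_of_mult[of "U\<^sup>T" r d U r] U by (simp add: fmat_of_transpose mult.assoc)
    then have "(norm (fmat_of U * fmat_of ?Z))\<^sup>2 = 0" by (simp add: power2_norm_eq_inner inner_mult_left)
    then have "s * (norm (fmat_of ?Z))\<^sup>2 \<le> 0" using lower[OF fmat_of_supp(1)[OF Z]] by simp
    then have Z0: "fmat_of ?Z = 0" using s by (simp add: mult_le_0_iff)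
    have "v = 0\<^sub>v r"
    proof (rule eq_vecI)
      fix i assume "i < dim_vec (0\<^sub>v r :: real vec)"
      then have i: "i < r" by simp
      then have "v $ i = ent (fmat_of ?Z) i 0" by (simp add: ent_fmat_of)
      then show "v $ i = 0\<^sub>v r $ i" using Z0 i by simp
    qed (use v in auto)
    then show False using v(2) by simp
  qed
  then have unit: "?A \<in> Units (ring_mat TYPE(real) r ())" by (rule det_non_zero_imp_unit[OF A])
  then obtain B where "mat_inverse ?A = Some B" using mat_inverse(1)[OF A, of "()"] by (cases "mat_inverse ?A") auto
  then have inv: "mat_inv ?A = B" "?A * B = 1\<^sub>m r" "B * ?A = 1\<^sub>m r" "B \<in> carrier_mat r r"
    using mat_inverse(2)[OF A] by (auto simp: mat_inv_def)
  then show "mat_inv ?A \<in> carrier_mat r r" "?A * mat_inv ?A = 1\<^sub>m r" by auto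
  have "inverts_mat ?A B" "inverts_mat B ?A" unfolding inverts_mat_def
    using inv(2-4) A by (simp_all only: carrier_matD)
  then show "invertible_mat ?A" unfolding invertible_mat_def using A by auto
qed

lemma debiased_gram:
  fixes U :: "real mat"
  assumes U: "U \<in> carrier_mat d r" and s: "0 < s" and lam: "0 \<le> lam"
    and lower: "\<And>z. idm r * z = z \<Longrightarrow> s * (norm z)\<^sup>2 \<le> (norm (fmat_of U * z))\<^sup>2"
  defines "F \<equiv> fmat_of (debiased r lam U)" and "G \<equiv> fmat_of (mat_inv (U\<^sup>T * U))"
  shows "debiased r lam U \<in> carrier_mat d r" "\<exists>K. F = fmat_of U * K"
    "F * F\<^sup>t = fmat_of U * (fmat_of U)\<^sup>t + lam *\<^sub>R (fmat_of U * (G * (fmat_of U)\<^sup>t))"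
    "idm r * G = G" "(fmat_of U)\<^sup>t * fmat_of U * G = idm r"
proof -
  note inv = mat_inv_of_lower_bound[OF U s lower]
  let ?G = "mat_inv (U\<^sup>T * U)" and ?u = "fmat_of U"
  let ?A = "1\<^sub>m r + lam \<cdot>\<^sub>m ?G"
  have gram: "fmat_of (U\<^sup>T * U) = ?u\<^sup>t * ?u" using fmat_of_mult[of "U\<^sup>T" r d U r] U by (simp add: fmat_of_transpose)
  show G1: "idm r * G = G" unfolding G_def by (rule fmat_of_supp(1)[OF inv(2)])
  have G2: "G * idm r = G" unfolding G_def by (rule fmat_of_supp(2)[OF inv(2)])
  show G3: "?u\<^sup>t * ?u * G = idm r"
    using arg_cong[OF inv(3), of fmat_of] fmat_of_mult[of "U\<^sup>T * U" r r ?G r] U inv(2) by (simp add: gram fmat_of_one G_def)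
  \<comment> \<open>G is a right inverse of a symmetric matrix, so its transpose is a left inverse,
    and the two agree.\<close>
  have "G\<^sup>t * (?u\<^sup>t * ?u) = idm r" using arg_cong[OF G3, of ft] by (simp add: mult.assoc)
  then have "G\<^sup>t * (?u\<^sup>t * ?u * G) = G" by (metis G1 mult.assoc)
  then have "G\<^sup>t * idm r = G" unfolding G3 .
  moreover have "G\<^sup>t * idm r = G\<^sup>t" by (metis G1 ft_idm ft_mult)
  ultimately have Gs: "G\<^sup>t = G" by simp
  have A: "?A \<in> carrier_mat r r" using inv(2) by simp
  have fA: "fmat_of ?A = idm r + lam *\<^sub>R G" using fmat_of_add[of "1\<^sub>m r" r r "lam \<cdot>\<^sub>m ?G"] inv(2) by (simp add: fmat_of_one fmat_of_smult G_def)
  have At: "?A\<^sup>T = ?A" by (rule fmat_of_inject[of _ r r]) (use A fA Gs in \<open>auto simp: fmat_of_transpose\<close>)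
  \<comment> \<open>As G = G u^t u G with G symmetric, <Y, G Y> is the square of |u G Y|; hence I +
    lam G dominates I and \<alpha> = 1 serves.\<close>
  have pos: "1 * (norm Y)\<^sup>2 \<le> inner Y (fmat_of ?A * Y)" if Y: "idm r * Y = Y" for Y
  proof -
    have "inner Y (G * Y) = (norm (?u * (G * Y)))\<^sup>2"
    proof -
      have "G * (?u\<^sup>t * (?u * (G * Y))) = G * Y" using G3 Y by (metis mult.assoc)
      then have "inner Y (G * Y) = inner (G * Y) (?u\<^sup>t * (?u * (G * Y)))"
        using inner_mult_left[of G Y "?u\<^sup>t * (?u * (G * Y))"] Gs by simp
      then show ?thesis by (simp add: power2_norm_eq_inner inner_mult_left[of ?u])
    qed
    then show ?thesis using Y lam
      by (simp add: fA distrib_right inner_add_right power2_norm_eq_inner[of Y])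
  qed
  have one: "0 < (1::real)" by simp
  note S = psd_sqrt[OF A At one pos]
  show D: "debiased r lam U \<in> carrier_mat d r" using U S(1) unfolding debiased_def by simp
  have F: "F = ?u * fmat_of (psd_sqrt ?A)" unfolding F_def debiased_def by (rule fmat_of_mult[OF U S(1)])
  then show "\<exists>K. F = ?u * K" by blast
  have "fmat_of (psd_sqrt ?A) * (fmat_of (psd_sqrt ?A))\<^sup>t = fmat_of ?A"
    using fmat_of_mult[OF S(1) S(1)] S(2,3) by (simp add: fmat_of_transpose[symmetric])
  then have "F * F\<^sup>t = ?u * (fmat_of ?A * ?u\<^sup>t)" unfolding F by (metis ft_mult mult.assoc)
  moreover have "idm r * ?u\<^sup>t = ?u\<^sup>t" using fmat_of_supp(2)[OF U] by (metis ft_idm ft_mult)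
  ultimately show "F * F\<^sup>t = ?u * ?u\<^sup>t + lam *\<^sub>R (?u * (G * ?u\<^sup>t))"
    unfolding fA by (simp add: distrib_left distrib_right mult.assoc)
qed

text \<open>Along a line the objective is a quartic polynomial in t: \<rho> holds the residuals, s
  and q the linear and quadratic parts of the change in the prediction.\<close>

lemma quartic_derivatives:
  fixes \<rho> s q :: "nat \<Rightarrow> real" and f :: "real \<Rightarrow> real"
  assumes f: "\<And>t. f t = 1/4 * (\<Sum>i<n. (\<rho> i - t * s i - t\<^sup>2 * q i)\<^sup>2) + lam / 2 * (\<alpha> + 2 * t * \<beta> + t\<^sup>2 * \<gamma>)"
  shows "(f has_real_derivative (lam * \<beta> - 1/2 * (\<Sum>i<n. \<rho> i * s i))) (at 0)"
    and "deriv (deriv f) 0 = 1/2 * (\<Sum>i<n. (s i)\<^sup>2) - (\<Sum>i<n. \<rho> i * q i) + lam * \<gamma>"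
proof -
  let ?f' = "\<lambda>t. 1/4 * (\<Sum>i<n. 2 * (\<rho> i - t * s i - t\<^sup>2 * q i) * (- s i - 2 * t * q i)) + lam / 2 * (2 * \<beta> + 2 * t * \<gamma>)"
  have fe: "f = (\<lambda>t. 1/4 * (\<Sum>i<n. (\<rho> i - t * s i - t\<^sup>2 * q i)\<^sup>2) + lam / 2 * (\<alpha> + 2 * t * \<beta> + t\<^sup>2 * \<gamma>))"
    using f by blast
  have a: "((\<lambda>t. (\<rho> i - t * s i - t\<^sup>2 * q i)\<^sup>2) has_real_derivative
      2 * (\<rho> i - t * s i - t\<^sup>2 * q i) * (- s i - 2 * t * q i)) (at t)" for i t
    by (rule derivative_eq_intros refl | simp)+
  have b: "((\<lambda>t. \<alpha> + 2 * t * \<beta> + t\<^sup>2 * \<gamma>) has_real_derivative (2 * \<beta> + 2 * t * \<gamma>)) (at t)" for t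
    by (rule derivative_eq_intros refl | simp)+
  have d1: "(f has_real_derivative ?f' t) (at t)" for t
    unfolding fe by (rule DERIV_add[OF DERIV_cmult[OF DERIV_sum[OF a]] DERIV_cmult[OF b]])
  have "?f' 0 = lam * \<beta> - 1/2 * (\<Sum>i<n. \<rho> i * s i)"
    by (simp add: sum_distrib_left sum_negf mult.assoc)
  then show "(f has_real_derivative (lam * \<beta> - 1/2 * (\<Sum>i<n. \<rho> i * s i))) (at 0)"
    using d1[of 0] by simp
  have df: "deriv f = ?f'" using d1 by (intro ext DERIV_imp_deriv)
  have "((\<lambda>t. 2 * (\<rho> i - t * s i - t\<^sup>2 * q i) * (- s i - 2 * t * q i)) has_real_derivative
      2 * ((s i)\<^sup>2 - 2 * (\<rho> i * q i))) (at 0)" for i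
    by (rule derivative_eq_intros refl | simp add: power2_eq_square)+
  moreover have "((\<lambda>t. 2 * \<beta> + 2 * t * \<gamma>) has_real_derivative 2 * \<gamma>) (at 0)"
    by (rule derivative_eq_intros refl | simp)+
  ultimately have "(?f' has_real_derivative 1/4 * (\<Sum>i<n. 2 * ((s i)\<^sup>2 - 2 * (\<rho> i * q i))) + lam / 2 * (2 * \<gamma>)) (at 0)"
    by (intro DERIV_add DERIV_cmult DERIV_sum)
  then have "(?f' has_real_derivative 1/4 * (\<Sum>i<n. 2 * ((s i)\<^sup>2 - 2 * (\<rho> i * q i))) + lam * \<gamma>) (at 0)"
    by simp
  then have "deriv (deriv f) 0 = 1/4 * (\<Sum>i<n. 2 * ((s i)\<^sup>2 - 2 * (\<rho> i * q i))) + lam * \<gamma>"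
    unfolding df by (rule DERIV_imp_deriv)
  also have "\<dots> = 1/2 * (\<Sum>i<n. (s i)\<^sup>2) - (\<Sum>i<n. \<rho> i * q i) + lam * \<gamma>"
    by (simp add: sum_subtractf sum_distrib_left[symmetric])
  finally show "deriv (deriv f) 0 = 1/2 * (\<Sum>i<n. (s i)\<^sup>2) - (\<Sum>i<n. \<rho> i * q i) + lam * \<gamma>" .
qed

section \<open>From sampled data to the deterministic setting\<close>

definition colfun :: "fmat \<Rightarrow> nat \<Rightarrow> real" where "colfun x i = ent x i 0"

lemma dot_colfun:
  assumes "is_col x" "idm d * x = x"
  shows "dot d (colfun x) (colfun y) = inner x y"
proof -
  have sp: "supp_le (Suc d) x"
    using assms by (auto simp: supp_le_def not_less ent_is_col) (metis ent_idm_mult Suc_le_lessD not_less_iff_gr_or_eq)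
  have x0: "ent x i j = 0" if "d \<le> i \<or> 0 < j" for i j
    using assms that by (metis ent_idm_mult ent_is_col not_le)
  have "inner x y = (\<Sum>i<Suc d. ent x i 0 * ent y i 0)"
    unfolding inner_fmat_eq[OF sp] sum.lessThan_Suc_shift[where n = d and g = "\<lambda>j. ent x _ j * ent y _ j"]
    by (simp add: x0)
  then show ?thesis by (simp add: dot_def colfun_def x0)
qed

lemma sqrt_dot_colfun: "is_col x \<Longrightarrow> idm d * x = x \<Longrightarrow> sqrt (dot d (colfun x) (colfun x)) = norm x"
  by (simp add: dot_colfun norm_eq_sqrt_inner)

lemma design_mat_carrier [simp]: "design_mat d g i \<in> carrier_mat d d"
  by (simp add: design_mat_def)

lemma fmat_of_design_sym: "(fmat_of (design_mat d g i))\<^sup>t = fmat_of (design_mat d g i)"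
  by (rule fmat_eqI) (auto simp: ent_fmat_of design_mat_def min.commute max.commute)

lemma inner_design_outer:
  assumes "is_col a"
  shows "inner (fmat_of (design_mat d g i)) (a * b\<^sup>t) = design_form d g (colfun a) (colfun b) i"
proof -
  have sp: "supp_le d (fmat_of (design_mat d g i))" by (auto simp: supp_le_def ent_fmat_of design_mat_def)
  show ?thesis
    unfolding inner_fmat_eq[OF sp] design_form_def
    by (intro sum.cong refl) (simp add: ent_col_mult_ft[OF assms] ent_fmat_of design_mat_def colfun_def mult_ac)
qed

lemma sensing_design: "sensing d (\<lambda>i. fmat_of (design_mat d g i))"
  by unfold_locales (simp_all add: fmat_of_design_sym fmat_of_supp(1)[OF design_mat_carrier])

lemma sensing_bound_design:
  assumes \<epsilon>: "0 \<le> \<epsilon>"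
    and bound: "design_bounded n d \<epsilon> g"
  shows "sensing_bound d n (\<lambda>i. fmat_of (design_mat d g i)) \<epsilon>"
proof -
  interpret sensing d n "\<lambda>i. fmat_of (design_mat d g i)" \<epsilon> by (rule sensing_design)
  show ?thesis
  proof unfold_locales
    fix a b u v
    assume c: "is_col a" "is_col b" "is_col u" "is_col v"
      and i: "idm d * a = a" "idm d * b = b" "idm d * u = u" "idm d * v = v"
    have "inner (sym_part (a * b\<^sup>t)) (sym_part (u * v\<^sup>t)) = (inner a u * inner b v + inner a v * inner b u) / 2"
      by (simp add: sym_part_def inner_add_left inner_add_right inner_outer c del: ft_mult)
        (simp add: inner_add_left inner_add_right inner_outer c field_simps)
    then have "defect (a * b\<^sup>t) (u * v\<^sup>t) = design_defect n d g (colfun a) (colfun b) (colfun u) (colfun v)"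
      using c i by (simp add: defect_def design_defect_def inner_design_outer dot_colfun)
    then show "\<bar>defect (a * b\<^sup>t) (u * v\<^sup>t)\<bar> \<le> \<epsilon> * norm a * norm b * norm u * norm v"
      using bound[unfolded design_bounded_def, rule_format, of "colfun a" "colfun b" "colfun u" "colfun v"] c i
      by (simp add: sqrt_dot_colfun)
  qed (rule \<epsilon>)
qed

text \<open>The adjoint of the scaled measurement map applied to the noise vector, which is how the
  noise enters the gradient.\<close>

definition noise_mat :: "nat \<Rightarrow> nat \<Rightarrow> (nat \<times> nat \<times> nat \<Rightarrow> real) \<times> (nat \<Rightarrow> real) \<Rightarrow> fmat" where
  "noise_mat n d \<omega> = (\<Sum>i<n. (snd \<omega> i / sqrt n) *\<^sub>R fmat_of (design_mat d (fst \<omega>) i))"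

lemma noise_mat_sym: "(noise_mat n d \<omega>)\<^sup>t = noise_mat n d \<omega>"
  by (simp add: noise_mat_def fmat_of_design_sym)

lemma noise_mat_supp: "idm d * noise_mat n d \<omega> = noise_mat n d \<omega>"
  by (simp add: noise_mat_def sum_distrib_left fmat_of_supp(1)[OF design_mat_carrier])

lemma noise_mat_bound:
  assumes \<nu>: "0 \<le> \<nu>"
    and bound: "noise_bounded n d \<nu> \<omega>"
  shows "quad_bound \<nu> (noise_mat n d \<omega>)"
  unfolding quad_bound_def
proof
  fix Y
  let ?N = "noise_mat n d \<omega>" and ?Y = "idm d * Y"
  have col: "\<bar>inner x (?N * x)\<bar> \<le> \<nu> * (norm x)\<^sup>2" if x: "is_col x" "idm d * x = x" for x
  proof -
    have "inner x (?N * x) = inner ?N (x * x\<^sup>t)" by (simp add: inner_mult_right[of ?N, symmetric] inner_commute inner_mult_right[of x])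
    also have "\<dots> = (\<Sum>i<n. snd \<omega> i * design_form d (fst \<omega>) (colfun x) (colfun x) i) / sqrt n"
      by (simp add: noise_mat_def inner_sum_left inner_design_outer[OF x(1)] sum_divide_distrib)
    finally show ?thesis using bound[unfolded noise_bounded_def, rule_format, of "colfun x" "colfun x"] x
      by (simp add: sqrt_dot_colfun power2_eq_square mult.assoc)
  qed
  have up: "inner ?Y (?N * ?Y) \<le> \<nu> * (norm ?Y)\<^sup>2"
    by (rule quad_le_of_columns[of "\<lambda>x. idm d * x = x"]) (use col in \<open>fastforce simp: mult.assoc[symmetric]\<close>)+
  have "inner ?Y (- ?N * ?Y) \<le> \<nu> * (norm ?Y)\<^sup>2"
    by (rule quad_le_of_columns[of "\<lambda>x. idm d * x = x"]) (use col in \<open>fastforce simp: mult.assoc[symmetric]\<close>)+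
  then have abs: "\<bar>inner ?Y (?N * ?Y)\<bar> \<le> \<nu> * (norm ?Y)\<^sup>2" using up by simp
  have "?N * idm d = ?N" by (metis ft_idm ft_mult noise_mat_sym noise_mat_supp)
  then have eq: "inner Y (?N * Y) = inner ?Y (?N * ?Y)"
    using noise_mat_supp by (metis ft_idm inner_mult_left mult.assoc)
  have "\<nu> * (norm ?Y)\<^sup>2 \<le> \<nu> * (norm Y)\<^sup>2"
    using \<nu> proj_norm_le[OF proj_idm, of d Y] by (intro mult_left_mono power_mono) auto
  then show "\<bar>inner Y (?N * Y)\<bar> \<le> \<nu> * (norm Y)\<^sup>2" using abs eq by simp
qed

text \<open>Sorted by powers of t, to match \<open>quartic_derivatives\<close>.\<close>

lemma objective_line:
  fixes U H M :: "real mat" and \<omega> :: "(nat \<times> nat \<times> nat \<Rightarrow> real) \<times> (nat \<Rightarrow> real)"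
  assumes U: "U \<in> carrier_mat d r" and H: "H \<in> carrier_mat d r" and M: "M \<in> carrier_mat d d"
  defines "X \<equiv> \<lambda>i. fmat_of (design_mat d (fst \<omega>) i)" and "u \<equiv> fmat_of U" and "h \<equiv> fmat_of H"
  shows "objective n d M lam \<omega> (U + t \<cdot>\<^sub>m H) =
    1/4 * (\<Sum>i<n. ((snd \<omega> i - inner (X i) (u * u\<^sup>t - fmat_of M) / sqrt n)
        - t * (inner (X i) (u * h\<^sup>t + h * u\<^sup>t) / sqrt n) - t\<^sup>2 * (inner (X i) (h * h\<^sup>t) / sqrt n))\<^sup>2)
    + lam / 2 * ((norm u)\<^sup>2 + 2 * t * inner u h + t\<^sup>2 * (norm h)\<^sup>2)"
proof -
  let ?W = "U + t \<cdot>\<^sub>m H"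
  have W: "?W \<in> carrier_mat d r" "?W\<^sup>T \<in> carrier_mat r d" using U H by auto
  have w: "fmat_of ?W = u + t *\<^sub>R h" unfolding u_def h_def using U H by (subst fmat_of_add[of _ d r]) (auto simp: fmat_of_smult)
  have ww: "fmat_of (?W * ?W\<^sup>T) = u * u\<^sup>t + t *\<^sub>R (u * h\<^sup>t + h * u\<^sup>t) + t\<^sup>2 *\<^sub>R (h * h\<^sup>t)"
    unfolding fmat_of_mult[OF W] fmat_of_transpose w by (simp add: algebra_simps power2_eq_square)
  have fr: "frob_inner (design_mat d (fst \<omega>) i) B = inner (X i) (fmat_of B)" if "B \<in> carrier_mat d d" for B i
    unfolding X_def using that by (intro frob_inner_fmat_of) auto
  have WW: "?W * ?W\<^sup>T \<in> carrier_mat d d" using W by simp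
  have res: "response n d M \<omega> i - frob_inner (design_mat d (fst \<omega>) i) (?W * ?W\<^sup>T) / sqrt n
     = (snd \<omega> i - inner (X i) (u * u\<^sup>t - fmat_of M) / sqrt n)
        - t * (inner (X i) (u * h\<^sup>t + h * u\<^sup>t) / sqrt n) - t\<^sup>2 * (inner (X i) (h * h\<^sup>t) / sqrt n)" for i
    unfolding response_def fr[OF M] fr[OF WW] ww
    by (simp add: inner_add_right inner_diff_right add_divide_distrib diff_divide_distrib distrib_left)
  have nrm: "(frob_norm ?W)\<^sup>2 = (norm u)\<^sup>2 + 2 * t * inner u h + t\<^sup>2 * (norm h)\<^sup>2"
    unfolding frob_norm_fmat_of w power2_norm_eq_inner
    by (simp add: inner_add_left inner_add_right inner_commute[of h u] power2_eq_square algebra_simps)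
  show ?thesis unfolding objective_def res nrm ..
qed

lemma stationary_of_second_order:
  assumes n: "0 < n" and lam: "0 \<le> lam" and M: "M \<in> carrier_mat d d"
    and sos: "second_order_stationary d r (objective n d M lam \<omega>) U"
    and sb: "sensing_bound d n (\<lambda>i. fmat_of (design_mat d (fst \<omega>) i)) \<epsilon>"
    and gt: "ground_truth d r (fmat_of M) V m"
    and N: "quad_bound \<nu> (noise_mat n d \<omega>)" and eps: "12 * (real r * \<epsilon>) \<le> 1"
  shows "stationary d n (\<lambda>i. fmat_of (design_mat d (fst \<omega>) i)) \<epsilon> r (fmat_of M) V m (noise_mat n d \<omega>) (fmat_of U) \<nu> lam"
proof -
  let ?X = "\<lambda>i. fmat_of (design_mat d (fst \<omega>) i)" and ?u = "fmat_of U"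
  interpret sensing_bound d n ?X \<epsilon> by (rule sb)
  interpret ground_truth d r "fmat_of M" V m by (rule gt)
  have U: "U \<in> carrier_mat d r" using sos by (simp add: second_order_stationary_def)
  define \<Delta> where "\<Delta> = ?u * ?u\<^sup>t - fmat_of M"
  define \<rho> where "\<rho> i = snd \<omega> i - inner (?X i) \<Delta> / sqrt n" for i
  define G where "G = \<Delta> + defect_op \<Delta> - noise_mat n d \<omega>"
  \<comment> \<open>The adjoint of the measurement map, applied to the residuals, is -G; so the
    cross terms of both derivatives become inner products with G.\<close>
  have G: "(\<Sum>i<n. (\<rho> i / sqrt n) *\<^sub>R ?X i) = - G"
  proof -
    have "(\<Sum>i<n. (\<rho> i / sqrt n) *\<^sub>R ?X i)
        = noise_mat n d \<omega> - (\<Sum>i<n. (inner (?X i) \<Delta> / sqrt n / sqrt n) *\<^sub>R ?X i)"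
      by (simp add: \<rho>_def noise_mat_def diff_divide_distrib scaleR_left_diff_distrib sum_subtractf)
    also have "(\<Sum>i<n. (inner (?X i) \<Delta> / sqrt n / sqrt n) *\<^sub>R ?X i) = (1 / real n) *\<^sub>R (\<Sum>i<n. inner (?X i) \<Delta> *\<^sub>R ?X i)"
      using n by (simp add: scaleR_sum_right)
    finally show ?thesis by (simp add: G_def defect_op_def)
  qed
  have Gs: "G\<^sup>t = G"
    by (simp add: G_def noise_mat_sym defect_op_sym \<Delta>_def M_sym)
  have Gd: "idm d * G = G"
  proof -
    have "idm d * \<Delta> = \<Delta>" using fmat_of_supp(1)[OF U] M_supp by (simp add: \<Delta>_def right_diff_distrib mult.assoc[symmetric])
    then show ?thesis by (simp add: G_def algebra_simps noise_mat_supp defect_op_supp)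
  qed
  have lin: "(\<Sum>i<n. \<rho> i * (inner (?X i) Z / sqrt n)) = - inner G Z" for Z
  proof -
    have "(\<Sum>i<n. \<rho> i * (inner (?X i) Z / sqrt n)) = inner (\<Sum>i<n. (\<rho> i / sqrt n) *\<^sub>R ?X i) Z"
      by (simp add: inner_sum_left)
    then show ?thesis unfolding G by simp
  qed
  have both: "inner (G * ?u + lam *\<^sub>R ?u) h = 0 \<and>
      0 \<le> (\<Sum>i<n. (inner (?X i) (?u * h\<^sup>t + h * ?u\<^sup>t))\<^sup>2) / (2 * real n) + inner h (G * h) + lam * (norm h)\<^sup>2"
    if h: "idm d * h = h" "h * idm r = h" for h
  proof -
    let ?H = "mat_of_fmat d r h" and ?S = "?u * h\<^sup>t + h * ?u\<^sup>t"
    have fH: "fmat_of ?H = h" by (rule fmat_of_mat_of_fmat[OF h])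
    have H: "?H \<in> carrier_mat d r" by (rule mat_of_fmat_carrier)
    let ?f = "\<lambda>t. objective n d M lam \<omega> (U + t \<cdot>\<^sub>m ?H)"
    have f: "?f t = 1/4 * (\<Sum>i<n. (\<rho> i - t * (inner (?X i) ?S / sqrt n) - t\<^sup>2 * (inner (?X i) (h * h\<^sup>t) / sqrt n))\<^sup>2)
        + lam / 2 * ((norm ?u)\<^sup>2 + 2 * t * inner ?u h + t\<^sup>2 * (norm h)\<^sup>2)" for t
      unfolding objective_line[OF U H M] fH \<rho>_def \<Delta>_def ..
    note q = quartic_derivatives[of ?f, OF f]
    have s: "(?f has_real_derivative 0) (at 0)" "0 \<le> deriv (deriv ?f) 0"
      using sos H unfolding second_order_stationary_def by blast+
    have "lam * inner ?u h - 1/2 * (\<Sum>i<n. \<rho> i * (inner (?X i) ?S / sqrt n)) = 0"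
      using DERIV_unique[OF q(1) s(1)] .
    then have "lam * inner ?u h + 1/2 * inner G ?S = 0" unfolding lin by simp
    moreover have "inner G (h * ?u\<^sup>t) = inner (G * ?u) h"
      using inner_mult_right[of G ?u h] by simp
    moreover have "inner G (?u * h\<^sup>t) = inner G (h * ?u\<^sup>t)"
      using inner_ft[of G "?u * h\<^sup>t"] Gs by simp
    ultimately have 1: "inner (G * ?u + lam *\<^sub>R ?u) h = 0" by (simp add: inner_add_left inner_add_right)
    have "0 \<le> 1/2 * (\<Sum>i<n. (inner (?X i) ?S / sqrt n)\<^sup>2) - (\<Sum>i<n. \<rho> i * (inner (?X i) (h * h\<^sup>t) / sqrt n)) + lam * (norm h)\<^sup>2"
      using s(2) unfolding q(2) .
    moreover have "(\<Sum>i<n. (inner (?X i) ?S / sqrt n)\<^sup>2) = (\<Sum>i<n. (inner (?X i) ?S)\<^sup>2) / real n"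
      by (simp add: power_divide sum_divide_distrib)
    moreover have "inner G (h * h\<^sup>t) = inner h (G * h)" using inner_mult_right[of h "h\<^sup>t" G] by (simp add: inner_commute)
    ultimately have "0 \<le> (\<Sum>i<n. (inner (?X i) ?S)\<^sup>2) / (2 * real n) + inner h (G * h) + lam * (norm h)\<^sup>2"
      unfolding lin by simp
    with 1 show ?thesis ..
  qed
  have u: "idm d * ?u = ?u" "?u * idm r = ?u" using fmat_of_supp[OF U] by auto
  \<comment> \<open>The gradient is orthogonal to every d by r direction and is such a direction
    itself.\<close>
  let ?h = "G * ?u + lam *\<^sub>R ?u"
  have "idm d * ?h = ?h" "?h * idm r = ?h"
    using Gd u by (simp_all add: distrib_left distrib_right mult.assoc[symmetric]) (simp add: mult.assoc)
  then have foc: "?h = 0" using both[of ?h] by simp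
  show ?thesis
    by unfold_locales
      (use lam noise_mat_sym noise_mat_supp N eps u foc both in \<open>auto simp: G_def \<Delta>_def\<close>)
qed

lemma ground_truth_fmat_of:
  fixes L :: "real mat"
  assumes r: "0 < r" and V: "V \<in> carrier_mat d r" "V\<^sup>T * V = 1\<^sub>m r" and L: "diag_pos r L"
    and M: "M = sqrt d \<cdot>\<^sub>m (V * L * V\<^sup>T)"
  defines "m \<equiv> sqrt d * Min ((\<lambda>a. L $$ (a,a)) ` {..<r})"
  shows "M \<in> carrier_mat d d" "ground_truth d r (fmat_of M) (fmat_of V) m"
proof -
  let ?v = "fmat_of V" and ?l = "fmat_of L" and ?mu = "Min ((\<lambda>a. L $$ (a,a)) ` {..<r})"
  have Lc: "L \<in> carrier_mat r r" and Lpos: "\<And>a. a < r \<Longrightarrow> 0 < L $$ (a, a)"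
    and Ld: "\<And>a b. a < r \<Longrightarrow> b < r \<Longrightarrow> a \<noteq> b \<Longrightarrow> L $$ (a, b) = 0"
    using L by (auto simp: diag_pos_def)
  show Mc: "M \<in> carrier_mat d d" unfolding M using V Lc by auto
  have fM: "fmat_of M = sqrt d *\<^sub>R (?v * ?l * ?v\<^sup>t)"
  proof -
    have c: "V * L \<in> carrier_mat d r" "V\<^sup>T \<in> carrier_mat r d" using V Lc by auto
    show ?thesis unfolding M fmat_of_smult fmat_of_mult[OF c] fmat_of_mult[OF V(1) Lc] fmat_of_transpose ..
  qed
  have v: "idm d * ?v = ?v" "?v * idm r = ?v" using fmat_of_supp[OF V(1)] by auto
  have orth: "?v\<^sup>t * ?v = idm r"
    using arg_cong[OF V(2), of fmat_of] V(1) by (simp add: fmat_of_mult[of _ r d] fmat_of_transpose fmat_of_one)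
  have ls: "?l\<^sup>t = ?l" by (rule fmat_eqI) (use Lc Ld in \<open>auto simp: ent_fmat_of\<close>, metis)
  have li: "idm r * ?l = ?l" "?l * idm r = ?l" using fmat_of_supp[OF Lc] by auto
  have mu: "?mu \<le> L $$ (a, a)" if "a < r" for a using that by (intro Min_le) auto
  have mupos: "0 < ?mu" using r Lpos by (subst Min_gr_iff) auto
  have diag: "?mu * (norm Z)\<^sup>2 \<le> inner Z (?l * Z)" if Z: "idm r * Z = Z" for Z
  proof -
    obtain N0 where "supp_le N0 Z" using ex_supp_le by blast
    define N where "N = max N0 r"
    have N: "supp_le N Z" "r \<le> N" using \<open>supp_le N0 Z\<close> supp_le_mono by (auto simp: N_def)
    have sl: "supp_le r ?l" using Lc by (auto simp: supp_le_def ent_fmat_of)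
    have Z0: "ent Z i j = 0" if "\<not> i < r" for i j using Z that by (metis ent_idm_mult)
    have lZ: "ent (?l * Z) i j = L $$ (i, i) * ent Z i j" if i: "i < r" for i j
    proof -
      have "ent (?l * Z) i j = (\<Sum>k<r. if k = i then L $$ (i, i) * ent Z i j else 0)"
        unfolding ent_mult[OF sl] by (intro sum.cong refl) (use i Lc Ld in \<open>auto simp: ent_fmat_of\<close>)
      then show ?thesis using i by (simp add: sum.delta)
    qed
    have "?mu * (norm Z)\<^sup>2 = (\<Sum>i<N. \<Sum>j<N. ?mu * (ent Z i j * ent Z i j))"
      unfolding power2_norm_eq_inner inner_fmat_eq[OF N(1)] by (simp add: sum_distrib_left)
    also have "\<dots> \<le> (\<Sum>i<N. \<Sum>j<N. ent Z i j * ent (?l * Z) i j)"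
    proof (intro sum_mono)
      fix i j
      show "?mu * (ent Z i j * ent Z i j) \<le> ent Z i j * ent (?l * Z) i j"
      proof (cases "i < r")
        case True
        have "?mu * (ent Z i j * ent Z i j) \<le> L $$ (i, i) * (ent Z i j * ent Z i j)"
          by (rule mult_right_mono[OF mu[OF True]]) simp
        then show ?thesis unfolding lZ[OF True] by (simp add: mult_ac)
      qed (simp add: Z0)
    qed
    also have "\<dots> = inner Z (?l * Z)" by (rule inner_fmat_eq[OF N(1), symmetric])
    finally show ?thesis .
  qed
  have quad: "inner Y (fmat_of M * Y) = sqrt d * inner (?v\<^sup>t * Y) (?l * (?v\<^sup>t * Y))" for Y
    unfolding fM by (simp add: mult.assoc inner_mult_left[of "?v\<^sup>t"])
  have vi: "idm r * (?v\<^sup>t * Y) = ?v\<^sup>t * Y" for Y using v(2) by (metis ft_idm ft_mult mult.assoc)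
  show "ground_truth d r (fmat_of M) ?v m"
  proof unfold_locales
    show "0 < r" by (rule r)
    show "(fmat_of M)\<^sup>t = fmat_of M" unfolding fM by (simp add: ls mult.assoc)
    show "idm d * fmat_of M = fmat_of M" by (rule fmat_of_supp(1)[OF Mc])
    show "0 \<le> inner Y (fmat_of M * Y)" for Y
    proof -
      have "0 \<le> ?mu * (norm (?v\<^sup>t * Y))\<^sup>2" using mupos by simp
      then have "0 \<le> inner (?v\<^sup>t * Y) (?l * (?v\<^sup>t * Y))" using diag[OF vi] order_trans by blast
      then show ?thesis unfolding quad by simp
    qed
    show "idm d * ?v = ?v" "?v * idm r = ?v" "?v\<^sup>t * ?v = idm r" using v orth by auto
    show "?v * (?v\<^sup>t * fmat_of M) = fmat_of M"
    proof -
      have "?v\<^sup>t * (?v * Z) = idm r * Z" for Z using orth by (metis mult.assoc)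
      then show ?thesis unfolding fM by (simp add: mult.assoc) (metis li(1) mult.assoc)
    qed
    show "m * (norm Y)\<^sup>2 \<le> inner (?v * Y) (fmat_of M * (?v * Y))" if Y: "idm r * Y = Y" for Y
    proof -
      have "?v\<^sup>t * (?v * Y) = Y" using orth Y by (metis mult.assoc)
      then show ?thesis
        unfolding quad m_def using mult_left_mono[OF diag[OF Y], of "sqrt d"] by (simp add: mult.assoc)
    qed
  qed
qed

section \<open>Comparison of the debiased and the unregularised factor\<close>

text \<open>The deterministic half of the result: \<epsilon> = K sqrt (d / n) and \<nu> = K \<sigma>
  sqrt d are put into \<open>stationary_comparison\<close>.\<close>

lemma comparison_on_good_event:
  fixes d n r :: nat and K \<sigma> lam C5 :: real and M V L U0 U1 :: "real mat" and \<omega> :: "(nat \<times> nat \<times> nat \<Rightarrow> real) \<times> (nat \<Rightarrow> real)"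
  assumes K: "0 < K" and pos: "0 < d" "0 < n" "0 < r" "0 < \<sigma>" and lam: "0 \<le> lam" "lam \<le> C5 * (\<sigma> * sqrt d)"
    and V: "V \<in> carrier_mat d r" "V\<^sup>T * V = 1\<^sub>m r" and L: "diag_pos r L"
    and M: "M = sqrt d \<cdot>\<^sub>m (V * L * V\<^sup>T)"
    and signal: "(22 * K + 17 * C5) * \<sigma> < Min ((\<lambda>a. L $$ (a,a)) ` {..<r})"
    and eps: "12 * (real r * (K * sqrt (real d / real n))) \<le> 1"
    and design: "design_bounded n d (K * sqrt (real d / real n)) (fst \<omega>)"
    and noise: "noise_bounded n d (K * \<sigma> * sqrt d) \<omega>"
    and U0: "second_order_stationary d r (objective n d M 0 \<omega>) U0"
    and U1: "second_order_stationary d r (objective n d M lam \<omega>) U1"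
  shows "invertible_mat (U1\<^sup>T * U1)"
    "frob_norm (debiased r lam U1 * (debiased r lam U1)\<^sup>T - U0 * U0\<^sup>T) / sqrt (d * r)
      \<le> 16 * K * (6 * K + 2 * C5) * \<sigma> * r * sqrt (d / n)"
proof -
  let ?X = "\<lambda>i. fmat_of (design_mat d (fst \<omega>) i)"
  define \<epsilon> where "\<epsilon> = K * sqrt (real d / real n)"
  define \<nu> where "\<nu> = K * \<sigma> * sqrt d"
  define m where "m = sqrt d * Min ((\<lambda>a. L $$ (a,a)) ` {..<r})"
  have eps0: "0 \<le> \<epsilon>" using K by (simp add: \<epsilon>_def)
  have nu0: "0 \<le> \<nu>" using K pos by (simp add: \<nu>_def)
  have sb: "sensing_bound d n ?X \<epsilon>" by (rule sensing_bound_design[OF eps0 design[folded \<epsilon>_def]])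
  have Nb: "quad_bound \<nu> (noise_mat n d \<omega>)" by (rule noise_mat_bound[OF nu0 noise[folded \<nu>_def]])
  note gt = ground_truth_fmat_of[OF pos(3) V L M, folded m_def]
  have eps': "12 * (real r * \<epsilon>) \<le> 1" using eps by (simp add: \<epsilon>_def)
  note S0 = stationary_of_second_order[OF pos(2) order_refl gt(1) U0 sb gt(2) Nb eps']
  note S1 = stationary_of_second_order[OF pos(2) lam(1) gt(1) U1 sb gt(2) Nb eps']
  interpret S1: stationary d n ?X \<epsilon> r "fmat_of M" "fmat_of V" m "noise_mat n d \<omega>" "fmat_of U1" \<nu> lam by (rule S1)
  have sd: "0 < sqrt d" using pos by simp
  \<comment> \<open>Signal, noise and lam all scale with sqrt d, which drops out and leaves the
    condition on the least diagonal entry.\<close>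
  have "22 * \<nu> + 17 * lam \<le> sqrt d * ((22 * K + 17 * C5) * \<sigma>)"
    using lam(2) by (simp add: \<nu>_def algebra_simps)
  also have "\<dots> < m" unfolding m_def using signal sd by (rule mult_strict_left_mono)
  finally have m: "22 * \<nu> + 17 * lam < m" .
  define s where "s = m - (6 * \<nu> + 5 * lam)"
  have s: "0 < s" "s + (6 * \<nu> + 5 * lam) \<le> m" using m nu0 lam(1) by (auto simp: s_def)
  have Uc: "U1 \<in> carrier_mat d r" "U0 \<in> carrier_mat d r"
    using U0 U1 by (auto simp: second_order_stationary_def)
  have lower: "s * (norm z)\<^sup>2 \<le> (norm (fmat_of U1 * z))\<^sup>2" if "idm r * z = z" for z
    using S1.factor_lower[of "fmat_of U1" 0 s, OF _ _ _ s(2,1) that] fmat_of_supp(2)[OF Uc(1)] by simp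
  show "invertible_mat (U1\<^sup>T * U1)" by (rule mat_inv_of_lower_bound(1)[OF Uc(1) s(1) lower])
  note deb = debiased_gram[OF Uc(1) s(1) lam(1) lower]
  let ?F = "fmat_of (debiased r lam U1)"
  obtain K' where K': "?F = fmat_of U1 * K'" using deb(2) by blast
  have main: "norm (?F * ?F\<^sup>t - fmat_of U0 * (fmat_of U0)\<^sup>t) \<le> 8 * (real r * \<epsilon>) * sqrt (2 * real r) * (6 * \<nu> + 2 * lam)"
    by (rule stationary_comparison[OF S0 S1 fmat_of_supp(2)[OF deb(1)] K' deb(3) deb(4) deb(5) m])
  have fD: "frob_norm (debiased r lam U1 * (debiased r lam U1)\<^sup>T - U0 * U0\<^sup>T) = norm (?F * ?F\<^sup>t - fmat_of U0 * (fmat_of U0)\<^sup>t)"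
  proof -
    have t: "(debiased r lam U1)\<^sup>T \<in> carrier_mat r d" "U0\<^sup>T \<in> carrier_mat r d" using deb(1) Uc by auto
    have p: "debiased r lam U1 * (debiased r lam U1)\<^sup>T \<in> carrier_mat d d" "U0 * U0\<^sup>T \<in> carrier_mat d d"
      using deb(1) Uc by auto
    have "fmat_of (debiased r lam U1 * (debiased r lam U1)\<^sup>T) = ?F * ?F\<^sup>t" "fmat_of (U0 * U0\<^sup>T) = fmat_of U0 * (fmat_of U0)\<^sup>t"
      using fmat_of_mult[OF deb(1) t(1)] fmat_of_mult[OF Uc(2) t(2)] by (simp_all only: fmat_of_transpose)
    then show ?thesis unfolding frob_norm_fmat_of fmat_of_diff[OF p] by (simp only:)
  qed
  \<comment> \<open>The factors sqrt r and sqrt d of the bound make up the normalisation sqrt (d r);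
    bounding sqrt 2 by 2 turns 8 into 16.\<close>
  have "6 * \<nu> + 2 * lam \<le> (6 * K + 2 * C5) * (\<sigma> * sqrt d)"
    using lam(2) by (simp add: \<nu>_def algebra_simps)
  moreover have "sqrt (2 * real r) \<le> 2 * sqrt r"
    by (rule real_le_lsqrt) (auto simp: power_mult_distrib)
  ultimately have "8 * (real r * \<epsilon>) * sqrt (2 * real r) * (6 * \<nu> + 2 * lam)
      \<le> 8 * (real r * \<epsilon>) * (2 * sqrt r) * ((6 * K + 2 * C5) * (\<sigma> * sqrt d))"
    using eps0 nu0 lam(1) by (intro mult_mono mult_nonneg_nonneg) auto
  also have "\<dots> = 16 * K * (6 * K + 2 * C5) * \<sigma> * r * sqrt (d / n) * sqrt (d * r)"
    by (simp add: \<epsilon>_def real_sqrt_mult mult_ac)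
  finally have "norm (?F * ?F\<^sup>t - fmat_of U0 * (fmat_of U0)\<^sup>t) \<le> 16 * K * (6 * K + 2 * C5) * \<sigma> * r * sqrt (d / n) * sqrt (d * r)"
    using main by linarith
  moreover have "0 < sqrt (d * r)" using pos by simp
  ultimately show "frob_norm (debiased r lam U1 * (debiased r lam U1)\<^sup>T - U0 * U0\<^sup>T) / sqrt (d * r)
      \<le> 16 * K * (6 * K + 2 * C5) * \<sigma> * r * sqrt (d / n)"
    unfolding fD by (simp only: pos_divide_le_eq)
qed

theorem theorem7:
  fixes \<kappa> \<sigma>min C4 C5 :: real
  assumes "0 < \<kappa>" "0 < \<sigma>min" "0 < C4" "C4 \<le> C5"
  shows "\<exists>C0::real. \<forall>C1 C2 C3::real. C0 \<le> C1 \<longrightarrow> C0 \<le> C2 \<longrightarrow> C0 \<le> C3 \<longrightarrow>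
    (\<exists>C c::real. 0 < C \<and> 0 < c \<and>
     (\<forall>(d::nat) (n::nat) (r::nat) (\<sigma>::real) (lam::real) M V L.
        0 < d \<longrightarrow> 0 < n \<longrightarrow> 0 < r \<longrightarrow>
        V \<in> carrier_mat d r \<longrightarrow> V\<^sup>T * V = 1\<^sub>m r \<longrightarrow> diag_pos r L \<longrightarrow>
        M = sqrt d \<cdot>\<^sub>m (V * L * V\<^sup>T) \<longrightarrow>
        C1 * sqrt r < Min ((\<lambda>a. L $$ (a,a)) ` {..<r}) / \<sigma> \<longrightarrow>
        Min ((\<lambda>a. L $$ (a,a)) ` {..<r}) / \<sigma> < C2 * sqrt r \<longrightarrow>
        op_norm M / (Min ((\<lambda>a. L $$ (a,a)) ` {..<r}) * sqrt d) \<le> \<kappa> \<longrightarrow>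
        \<sigma>min \<le> \<sigma> \<longrightarrow>
        real n / (real d * real r) \<ge> C3 * real r \<longrightarrow>
        C4 * sqrt d \<le> lam / \<sigma> \<longrightarrow> lam / \<sigma> \<le> C5 * sqrt d \<longrightarrow>
        (\<exists>E \<in> sets (sample_measure n d \<sigma>).
           measure (sample_measure n d \<sigma>) E \<ge>
             1 - C * (exp (- c * (d * r)) + exp (- c * n) + exp (- c * d)) \<and>
           (\<forall>\<omega> \<in> E. \<forall>U0 Ul.
              second_order_stationary d r (objective n d M 0 \<omega>) U0 \<longrightarrow>
              second_order_stationary d r (objective n d M lam \<omega>) Ul \<longrightarrow>
              invertible_mat (Ul\<^sup>T * Ul) \<and>
              frob_norm (debiased r lam Ul * (debiased r lam Ul)\<^sup>T - U0 * U0\<^sup>T)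
                / sqrt (d * r) \<le> C * \<sigma> * r * sqrt (d / n)))))"
proof -
  define K :: real where "K = 6656"
  define C where "C = 16 * K * (6 * K + 2 * C5)"
  \<comment> \<open>The event of \<open>good_event\<close> fails with probability at most 6 exp (-
    d), so exponent 1 and any C \<ge> 6 will do.\<close>
  define c :: real where "c = 1"
  have K: "0 < K" by (simp add: K_def)
  have C5: "0 < C5" using assms by simp
  have C6: "6 \<le> C"
  proof -
    have "(16 * K) * (6 * K) \<le> C" unfolding C_def using K C5 by (intro mult_left_mono) auto
    then show ?thesis by (simp add: K_def)
  qed
  show ?thesis
  \<comment> \<open>One threshold has to serve twice: 22 K + 17 C5 lets the signal dominate through
    C1, and (12 K)^2 gives 12 r \<epsilon> \<le> 1 through n \<ge> C3 r^2 d. The sum exceeds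
    both.\<close>
  proof (rule exI[of _ "(12 * K)\<^sup>2 + 22 * K + 17 * C5"], intro allI impI, rule exI[of _ C], rule exI[of _ c],
      intro conjI allI impI)
    fix C1 C2 C3 :: real and d n r :: nat and \<sigma> lam :: real and M V L :: "real mat"
    assume C1: "(12 * K)\<^sup>2 + 22 * K + 17 * C5 \<le> C1" and C3: "(12 * K)\<^sup>2 + 22 * K + 17 * C5 \<le> C3"
      and pos: "0 < d" "0 < n" "0 < r"
      and V: "V \<in> carrier_mat d r" "V\<^sup>T * V = 1\<^sub>m r" and L: "diag_pos r L"
      and M: "M = sqrt d \<cdot>\<^sub>m (V * L * V\<^sup>T)"
      and signal: "C1 * sqrt r < Min ((\<lambda>a. L $$ (a,a)) ` {..<r}) / \<sigma>"
      and \<sigma>: "\<sigma>min \<le> \<sigma>" and n: "real n / (real d * real r) \<ge> C3 * real r"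
      and lam: "C4 * sqrt d \<le> lam / \<sigma>" "lam / \<sigma> \<le> C5 * sqrt d"
    have \<sigma>0: "0 < \<sigma>" using \<sigma> assms by simp
    have lam0: "0 \<le> lam"
    proof -
      have "0 \<le> C4 * sqrt d" using assms by simp
      then have "0 \<le> lam / \<sigma>" using lam(1) by linarith
      then show ?thesis using \<sigma>0 by (simp add: zero_le_divide_iff)
    qed
    have lam1: "lam \<le> C5 * (\<sigma> * sqrt d)" using lam(2) \<sigma>0 by (simp add: pos_divide_le_eq mult_ac)
    have r1: "1 \<le> real r" using pos by simp
    have signal': "(22 * K + 17 * C5) * \<sigma> < Min ((\<lambda>a. L $$ (a,a)) ` {..<r})"
    proof -
      have C1': "22 * K + 17 * C5 \<le> C1" using C1 zero_le_power2[of "12 * K"] by linarith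
      moreover have "0 \<le> C1" using C1' K C5 by simp
      then have "C1 * 1 \<le> C1 * sqrt r" using r1 by (intro mult_left_mono) auto
      ultimately have "22 * K + 17 * C5 < Min ((\<lambda>a. L $$ (a,a)) ` {..<r}) / \<sigma>" using signal by linarith
      then show ?thesis using \<sigma>0 by (simp add: pos_less_divide_eq)
    qed
    have C3': "(12 * K)\<^sup>2 \<le> C3" using C3 K C5 by linarith
    have nd: "(12 * K)\<^sup>2 * (real r * real r * real d) \<le> real n"
    proof -
      have "C3 * real r * (real d * real r) \<le> real n" using n pos by (simp add: pos_le_divide_eq)
      moreover have "(12 * K)\<^sup>2 * (real r * real r * real d) \<le> C3 * (real r * real r * real d)"
        using C3' by (intro mult_right_mono) auto
      ultimately show ?thesis by (simp add: mult_ac)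
    qed
    have dn: "d \<le> n"
    proof -
      have "1 * (1 * 1 * real d) \<le> (12 * K)\<^sup>2 * (real r * real r * real d)"
        using r1 by (intro mult_mono) (auto simp: K_def)
      then show ?thesis using nd by simp
    qed
    have eps: "12 * (real r * (K * sqrt (real d / real n))) \<le> 1"
    proof -
      have "(12 * K * real r)\<^sup>2 * (real d / real n) \<le> 1"
        using nd pos by (simp add: power_mult_distrib pos_divide_le_eq power2_eq_square mult_ac)
      then have "sqrt ((12 * K * real r)\<^sup>2 * (real d / real n)) \<le> 1" by (simp only: real_sqrt_le_1_iff)
      then have "12 * K * real r * sqrt (real d / real n) \<le> 1"
        using K unfolding real_sqrt_mult by (simp only: real_sqrt_abs) (simp add: abs_mult)
      then show ?thesis by (simp add: mult_ac)
    qed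
    obtain E where E: "E \<in> sets (sample_measure n d \<sigma>)" "1 - 6 * exp (- real d) \<le> measure (sample_measure n d \<sigma>) E"
      "\<And>\<omega>. \<omega> \<in> E \<Longrightarrow> design_bounded n d (K * sqrt (real d / real n)) (fst \<omega>)"
      "\<And>\<omega>. \<omega> \<in> E \<Longrightarrow> noise_bounded n d (K * \<sigma> * sqrt d) \<omega>"
      using good_event[OF pos(1) dn \<sigma>0] unfolding K_def by blast
    show "\<exists>E \<in> sets (sample_measure n d \<sigma>).
           measure (sample_measure n d \<sigma>) E \<ge>
             1 - C * (exp (- c * (d * r)) + exp (- c * n) + exp (- c * d)) \<and>
           (\<forall>\<omega> \<in> E. \<forall>U0 Ul.
              second_order_stationary d r (objective n d M 0 \<omega>) U0 \<longrightarrow>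
              second_order_stationary d r (objective n d M lam \<omega>) Ul \<longrightarrow>
              invertible_mat (Ul\<^sup>T * Ul) \<and>
              frob_norm (debiased r lam Ul * (debiased r lam Ul)\<^sup>T - U0 * U0\<^sup>T)
                / sqrt (d * r) \<le> C * \<sigma> * r * sqrt (d / n))"
    proof (intro bexI[OF _ E(1)] conjI ballI allI impI)
      have "6 * exp (- real d) \<le> C * (exp (- c * (d * r)) + exp (- c * n) + exp (- c * d))"
        using C6 by (intro mult_mono) (auto simp: c_def)
      then show "measure (sample_measure n d \<sigma>) E \<ge>
             1 - C * (exp (- c * (d * r)) + exp (- c * n) + exp (- c * d))" using E(2) by linarith
      fix \<omega> U0 Ul
      assume \<omega>: "\<omega> \<in> E" and "second_order_stationary d r (objective n d M 0 \<omega>) U0"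
        "second_order_stationary d r (objective n d M lam \<omega>) Ul"
      note cmp = comparison_on_good_event[OF K pos \<sigma>0 lam0 lam1 V L M signal' eps E(3)[OF \<omega>] E(4)[OF \<omega>] this(2,3)]
      show "invertible_mat (Ul\<^sup>T * Ul)" by (rule cmp(1))
      show "frob_norm (debiased r lam Ul * (debiased r lam Ul)\<^sup>T - U0 * U0\<^sup>T)
                / sqrt (d * r) \<le> C * \<sigma> * r * sqrt (d / n)" unfolding C_def by (rule cmp(2))
    qed
  qed (use C6 in \<open>simp_all add: c_def\<close>)
qed

end
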